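(* Let $k>4$, $s_k=\frac{k-4}{2k}$, and let $(p,q)$ satisfy $\frac2p+\frac1q=\frac2k$ with $k+2<p<\infty$. Let $$M_k=\sup\{\|D_x^{1/p}U(t)\psi\|_{L^p_tL^q_x}:\ \psi\in\dot H^{s_k}_x(\mathbb R),\ \|D_x^{s_k}\psi\|_{L^2_x}=1\}$$ (which is finite). Then there exists $\psi_k\in\dot H^{s_k}_x(\mathbb R)$ with $\|D_x^{s_k}\psi_k\|_{L^2_x}=1$ such that $$\|D_x^{1/p}U(t)\psi_k\|_{L^p_tL^q_x}=M_k\|D_x^{s_k}\psi_k\|_{L^2_x}.$$
   Context: $U(t)$ is the Airy propagator, $\widehat{U(t)f}(\xi)=e^{it\xi^3}\hat f(\xi)$, solving $\partial_tu+\partial_x^3u=0$. $D_x^s$ is the Fourier multiplier with symbol $|\xi|^s$; $\dot H^s_x(\mathbb R)$ is the homogeneous Sobolev space with norm $\|D_x^sf\|_{L^2_x}$. $\|f\|_{L^p_tL^q_x}=\big(\int_{\mathbb R}\|f(\cdot,t)\|_{L^q_x}^p\,dt\big)^{1/p}$. *)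

theory Defs
  imports "HOL-Analysis.Analysis"
begin

text \<open>Elements psi of the homogeneous Sobolev space are represented through their
Fourier transform phi = psi-hat (convention psi-hat(xi) = integral of e^(-i x xi) psi(x) dx),
a measurable function with |xi|^s phi in L^2.\<close>

definition enn_powr :: "ennreal \<Rightarrow> real \<Rightarrow> ennreal" where
  "enn_powr a r = (if a = \<infinity> then \<infinity> else ennreal (enn2real a powr r))"

definition in_Hs :: "real \<Rightarrow> (real \<Rightarrow> complex) \<Rightarrow> bool" where
  "in_Hs sig phi \<longleftrightarrow> phi \<in> borel_measurable lborel \<and>
     integrable lborel (\<lambda>xi. (abs xi) powr (2 * sig) * (cmod (phi xi))^2)"

text \<open>Plancherel: norm of D^s psi in L^2.\<close>
definition hs_norm :: "real \<Rightarrow> (real \<Rightarrow> complex) \<Rightarrow> real" where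
  "hs_norm sig phi = sqrt ((1/(2*pi)) * (LINT xi|lborel. (abs xi) powr (2 * sig) * (cmod (phi xi))^2))"

definition mixed_norm :: "real \<Rightarrow> real \<Rightarrow> (real \<Rightarrow> real \<Rightarrow> complex) \<Rightarrow> ennreal" where
  "mixed_norm p q u = enn_powr
     (\<integral>\<^sup>+ t. enn_powr (\<integral>\<^sup>+ x. ennreal (cmod (u x t) powr q) \<partial>lborel) (p/q) \<partial>lborel) (1/p)"

text \<open>D^(1/p) U(t) psi with frequencies truncated to 1/R <= |xi| <= R
 (absolutely convergent integral).\<close>
definition airy_trunc :: "real \<Rightarrow> (real \<Rightarrow> complex) \<Rightarrow> real \<Rightarrow> real \<Rightarrow> real \<Rightarrow> complex" where
  "airy_trunc p phi R x t = complex_of_real (1/(2*pi)) *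
     (LINT xi|lborel. indicator {xi. 1/R \<le> (abs xi) \<and> (abs xi) \<le> R} xi *\<^sub>R
        (exp (\<i> * complex_of_real (x*xi + t*xi^3)) * complex_of_real ((abs xi) powr (1/p)) * phi xi))"

text \<open>Norm of D^(1/p) U(t) psi in L^p_t L^q_x, via the (Strichartz) extension by density:
 limit of the norms of the frequency-truncated evolutions.\<close>
definition strich_norm :: "real \<Rightarrow> real \<Rightarrow> (real \<Rightarrow> complex) \<Rightarrow> ennreal" where
  "strich_norm p q phi = lim (\<lambda>n. mixed_norm p q (airy_trunc p phi (real (Suc n))))"

end

theory Submission
  imports Defs "HOL-Probability.Probability" "HOL-Library.Diagonal_Subsequence"
begin

text \<open>
  Writing \<open>f = |\<xi>|^s \<phi> / sqrt (2 \<pi>)\<close>, the problem is to maximise the mixed norm of the evolution over the unit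
  ball of \<open>L^2\<close>. For data at frequencies \<open>|\<xi>| \<sim> N\<close>, van der Corput's bound on the Airy kernel and a
  \<open>T T*\<close> argument bound \<open>sup_x |u|\<close> in \<open>L^r_t\<close> for every \<open>r > 4\<close>. Dyadic pieces are summed with a
  bilinear inequality in which the lower frequency enters only through its sup norm. This gives a
  Strichartz inequality refined by a power of \<open>A = sup_j 2^(- \<beta> j) \<parallel>u_j\<parallel>_\<infinity>\<close>, where \<open>u_j\<close> is the \<open>j\<close>-th
  dyadic piece; hence scaling and space-time translations turn a maximising sequence into one with
  a nonzero weak limit \<open>f\<close>. By local smoothing the evolutions converge almost everywhere, so the
  Brezis--Lieb inequality with exponent \<open>m = min p q > 2\<close> yields \<open>1 \<le> a^m + (1 - a^2)^(m/2)\<close> for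
  \<open>a = \<parallel>f\<parallel>\<close>. This forces \<open>a = 1\<close>, and \<open>f\<close> is an extremiser.
\<close>
section \<open>Powers of extended reals and mixed norms\<close>

text \<open>The strict inequality 2/p + 1/q < 1/2, that is k > 4, is what makes dyadic pieces
  sufficient. It leaves the margin q - 2 - 4 q / p > 0. Half of it pays for moving from the
  weak-type exponent 4 to r > 4 in the maximal estimate, half for a positive power of the sup norm
  of the lower frequency; combined with the scaling weight, that power beats the loss of the
  bilinear inequality. Hence scaling and translations are the only symmetries to be factored out.
  The second obstacle is that a weak limit f in L^2 need not have an absolutely convergent
  evolution. Norms are therefore computed for data with frequencies in an annulus, and an almost
  everywhere limit u of evolutions takes the place of the evolution of f. Interlacing the
  truncations of f with the maximising sequence gives both the same u, and Fatou's lemma bounds u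
  and the remainders by the best constant. The power min p q is chosen because it makes the mixed
  norm subadditive as a functional of |u|^q; p > 4 and q > 2 make it exceed 2.\<close>

lemma enn_powr_ennreal: "0 \<le> x \<Longrightarrow> enn_powr (ennreal x) r = ennreal (x powr r)"
  by (simp add: enn_powr_def)

lemma enn_powr_top [simp]: "enn_powr \<infinity> r = \<infinity>" "enn_powr top r = top"
  by (simp_all add: enn_powr_def)

lemma enn_powr_0 [simp]: "enn_powr 0 r = 0"
  by (simp add: enn_powr_def)

lemma enn_powr_1 [simp]: "enn_powr a 1 = a"
  by (cases a) (auto simp: enn_powr_def)

lemma enn_powr_one [simp]: "enn_powr 1 r = 1"
  using enn_powr_ennreal[of 1 r] by simp

lemma enn_powr_mono: "0 \<le> r \<Longrightarrow> a \<le> b \<Longrightarrow> enn_powr a r \<le> enn_powr b r"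
  by (cases a; cases b) (auto simp: enn_powr_def top_unique intro!: ennreal_leI powr_mono2)

lemma enn_powr_mult: "0 < r \<Longrightarrow> enn_powr (a * b) r = enn_powr a r * enn_powr b r"
proof (cases a; cases b)
  fix x y assume "a = ennreal x" "b = ennreal y" "0 \<le> x" "0 \<le> y"
  then show ?thesis
    by (simp add: enn_powr_ennreal ennreal_mult[symmetric] powr_mult)
next
  fix x assume *: "0 < r" "a = ennreal x" "0 \<le> x" "b = top"
  then show ?thesis
    by (cases "x = 0") (auto simp: enn_powr_ennreal ennreal_mult_top)
next
  fix x assume *: "0 < r" "b = ennreal x" "0 \<le> x" "a = top"
  then show ?thesis
    by (cases "x = 0") (auto simp: enn_powr_ennreal ennreal_top_mult)
qed (auto simp: ennreal_top_mult)

lemma enn_powr_powr: "enn_powr (enn_powr a r) s = enn_powr a (r * s)"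
  by (cases a) (auto simp: enn_powr_ennreal powr_powr)

lemma enn_powr_eq_top_iff: "enn_powr a r = top \<longleftrightarrow> a = top"
  by (cases a) (auto simp: enn_powr_ennreal)

text \<open>A monotone map onto all of \<open>ennreal\<close> is continuous in the order topology;
  the power \<open>1 / r\<close> supplies the preimages.\<close>

lemma continuous_on_enn_powr:
  assumes "0 < r" shows "continuous_on UNIV (\<lambda>a. enn_powr a r)"
proof (rule continuous_onI_mono)
  have "enn_powr (enn_powr y (1/r)) r = y" for y
    using assms by (simp add: enn_powr_powr)
  then have "(\<lambda>a. enn_powr a r) ` UNIV = UNIV" by (metis surj_def)
  then show "open ((\<lambda>a. enn_powr a r) ` UNIV)" by simp
qed (use assms in \<open>auto intro: enn_powr_mono\<close>)

lemma tendsto_enn_powr: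
  "0 < r \<Longrightarrow> (f \<longlongrightarrow> a) F \<Longrightarrow> ((\<lambda>x. enn_powr (f x) r) \<longlongrightarrow> enn_powr a r) F"
  using continuous_on_tendsto_compose[OF continuous_on_enn_powr] by auto

lemma measurable_enn_powr [measurable]:
  "0 < r \<Longrightarrow> f \<in> borel_measurable M \<Longrightarrow> (\<lambda>x. enn_powr (f x) r) \<in> borel_measurable M"
  using measurable_compose[OF _ borel_measurable_continuous_onI[OF continuous_on_enn_powr]] by auto

text \<open>Write (a + b)^r as a (a + b)^(r - 1) + b (a + b)^(r - 1). Since r - 1 is not positive,
  shrinking the base to a or to b can only enlarge each summand.\<close>

lemma powr_subadditive:
  fixes a b r :: real
  assumes "0 \<le> a" "0 \<le> b" "0 < r" "r \<le> 1"
  shows "(a + b) powr r \<le> a powr r + b powr r"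
proof (cases "a + b = 0")
  case False
  then have pos: "a + b > 0" using assms by simp
  have *: "c * (a + b) powr (r - 1) \<le> c powr r" if "0 \<le> c" "c \<le> a + b" for c
  proof (cases "c = 0")
    case False
    with that have "(a + b) powr (r - 1) \<le> c powr (r - 1)"
      using assms powr_mono2'[of "r - 1" c "a + b"] by auto
    then have "c * (a + b) powr (r - 1) \<le> c * c powr (r - 1)"
      using that by (intro mult_left_mono) auto
    also have "\<dots> = c powr r" using False that by (simp add: powr_mult_base)
    finally show ?thesis .
  qed simp
  have "(a + b) powr r = (a + b) * (a + b) powr (r - 1)"
    using pos by (simp add: powr_mult_base)
  also have "\<dots> \<le> a powr r + b powr r"
    using *[of a] *[of b] assms by (simp add: distrib_right)
  finally show ?thesis .
qed (use assms in auto)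

lemma enn_powr_subadditive:
  "0 < r \<Longrightarrow> r \<le> 1 \<Longrightarrow> enn_powr (a + b) r \<le> enn_powr a r + enn_powr b r"
  by (cases a; cases b)
    (auto simp: enn_powr_ennreal ennreal_plus[symmetric] powr_subadditive simp del: ennreal_plus intro!: ennreal_leI)

definition Lnorm :: "real \<Rightarrow> 'a measure \<Rightarrow> ('a \<Rightarrow> ennreal) \<Rightarrow> ennreal" where
  "Lnorm r M F = enn_powr (\<integral>\<^sup>+ x. enn_powr (F x) r \<partial>M) (1 / r)"

text \<open>Convexity of z^r at the points x / A and y / B with weights A / (A + B) and B / (A + B).
  When A and B are the two norms, integrating the right-hand side gives (A + B)^r, which is
  Minkowski's inequality without a detour through duality.\<close>

lemma powr_convex_sum:
  fixes r x y A B :: real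
  assumes "1 \<le> r" "0 \<le> x" "0 \<le> y" "0 < A" "0 < B"
  shows "(x + y) powr r \<le> (A + B) powr (r - 1) * (A powr (1 - r) * x powr r + B powr (1 - r) * y powr r)"
proof (cases "x = 0 \<or> y = 0")
  case True
  have *: "z powr r \<le> (A + B) powr (r - 1) * (C powr (1 - r) * z powr r)" if "0 < C" "C \<le> A + B" for z C
  proof -
    have "1 \<le> ((A + B) / C) powr (r - 1)"
      using that assms by (intro ge_one_powr_ge_zero) auto
    also have "\<dots> = (A + B) powr (r - 1) * C powr (1 - r)"
      using that assms by (simp add: powr_divide powr_diff)
    finally have "1 * z powr r \<le> ((A + B) powr (r - 1) * C powr (1 - r)) * z powr r"
      by (intro mult_right_mono) auto
    then show ?thesis by (simp add: mult.assoc)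
  qed
  show ?thesis using True *[of A y] *[of B y] *[of A x] *[of B x] assms by auto
next
  case False
  then have xy: "0 < x" "0 < y" using assms by auto
  define l where "l = A / (A + B)"
  have l: "0 \<le> l" "l \<le> 1" "1 - l = B / (A + B)" using assms by (auto simp: l_def field_simps)
  have "((1 - l) *\<^sub>R (y / B) + l *\<^sub>R (x / A)) powr r \<le> (1 - l) * (y / B) powr r + l * (x / A) powr r"
    using assms l xy by (intro convex_onD[OF powr_convex]) auto
  moreover have "(1 - l) *\<^sub>R (y / B) + l *\<^sub>R (x / A) = (x + y) / (A + B)"
    using assms unfolding l(3) by (simp add: l_def add_divide_distrib add.commute)
  ultimately have "((x + y) / (A + B)) powr r \<le> (B * (y / B) powr r + A * (x / A) powr r) / (A + B)"
    using assms l(3) by (simp only: l_def) (simp add: add_divide_distrib)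
  then have "(A + B) powr r * ((x + y) / (A + B)) powr r \<le> (A + B) powr r * ((B * (y / B) powr r + A * (x / A) powr r) / (A + B))"
    by (intro mult_left_mono) auto
  moreover have "(A + B) powr r * ((x + y) / (A + B)) powr r = (x + y) powr r"
    using assms by (subst powr_mult[symmetric]) auto
  moreover have "(A + B) powr r * ((B * (y / B) powr r + A * (x / A) powr r) / (A + B))
      = (A + B) powr (r - 1) * (B * (y / B) powr r + A * (x / A) powr r)"
    using assms by (simp add: powr_diff)
  moreover have "A * (x / A) powr r = A powr (1 - r) * x powr r" "B * (y / B) powr r = B powr (1 - r) * y powr r"
    using assms by (simp_all add: powr_divide powr_diff)
  ultimately show ?thesis by (simp add: add.commute)
qed

text \<open>Minkowski's inequality for extended-valued functions: \<open>powr_convex_sum\<close> is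
  integrated with \<open>A\<close> and \<open>B\<close> just above the two norms.\<close>

lemma Lnorm_triangle:
  assumes r: "1 \<le> r" and [measurable]: "F \<in> borel_measurable M" "G \<in> borel_measurable M"
  shows "Lnorm r M (\<lambda>x. F x + G x) \<le> Lnorm r M F + Lnorm r M G"
proof (cases "Lnorm r M F = top \<or> Lnorm r M G = top")
  case False
  then obtain a b where ab: "Lnorm r M F = ennreal a" "Lnorm r M G = ennreal b" "0 \<le> a" "0 \<le> b"
    by (metis ennreal_cases)
  have rp: "0 < r" using r by simp
  show ?thesis
  proof (rule ennreal_le_epsilon)
    fix e :: real assume e: "0 < e"
    \<comment> \<open>The summand \<open>e / 2\<close> keeps \<open>A\<close> and \<open>B\<close>
      positive even if a norm vanishes; it disappears through
      \<open>ennreal_le_epsilon\<close>.\<close>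
    define A where "A = a + e / 2"
    define B where "B = b + e / 2"
    have AB: "0 < A" "0 < B" using ab e by (auto simp: A_def B_def)
    have *: "(\<integral>\<^sup>+ x. enn_powr (H x) r \<partial>M) \<le> ennreal (C powr r)"
      if "Lnorm r M H = ennreal c" "0 \<le> c" "c \<le> C" for H c C
    proof -
      have "(\<integral>\<^sup>+ x. enn_powr (H x) r \<partial>M) = enn_powr (Lnorm r M H) r"
        using rp by (simp add: Lnorm_def enn_powr_powr)
      also have "\<dots> \<le> ennreal (C powr r)"
        using that rp by (auto simp: enn_powr_ennreal intro!: ennreal_leI powr_mono2)
      finally show ?thesis .
    qed
    have F: "(\<integral>\<^sup>+ x. enn_powr (F x) r \<partial>M) \<le> ennreal (A powr r)"
      by (rule *[OF ab(1)]) (use ab e in \<open>auto simp: A_def\<close>)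
    have G: "(\<integral>\<^sup>+ x. enn_powr (G x) r \<partial>M) \<le> ennreal (B powr r)"
      by (rule *[OF ab(2)]) (use ab e in \<open>auto simp: B_def\<close>)
    have pw: "enn_powr (f + g) r \<le> ennreal ((A + B) powr (r - 1)) * (ennreal (A powr (1 - r)) * enn_powr f r + ennreal (B powr (1 - r)) * enn_powr g r)" for f g
    proof (cases f; cases g)
      fix x y assume "f = ennreal x" "0 \<le> x" "g = ennreal y" "0 \<le> y"
      then show ?thesis using powr_convex_sum[OF r _ _ AB, of x y]
        by (simp add: enn_powr_ennreal ennreal_plus[symmetric] ennreal_mult[symmetric] del: ennreal_plus)
    qed (use AB in \<open>auto simp: ennreal_mult_top ennreal_mult_eq_top_iff\<close>)
    have "(\<integral>\<^sup>+ x. enn_powr (F x + G x) r \<partial>M) \<le> (\<integral>\<^sup>+ x. ennreal ((A + B) powr (r - 1)) * (ennreal (A powr (1 - r)) * enn_powr (F x) r + ennreal (B powr (1 - r)) * enn_powr (G x) r) \<partial>M)"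
      by (intro nn_integral_mono pw)
    also have "\<dots> = ennreal ((A + B) powr (r - 1)) * (ennreal (A powr (1 - r)) * (\<integral>\<^sup>+ x. enn_powr (F x) r \<partial>M) + ennreal (B powr (1 - r)) * (\<integral>\<^sup>+ x. enn_powr (G x) r \<partial>M))"
      using rp by (simp add: nn_integral_cmult nn_integral_add)
    also have "\<dots> \<le> ennreal ((A + B) powr (r - 1)) * (ennreal (A powr (1 - r)) * ennreal (A powr r) + ennreal (B powr (1 - r)) * ennreal (B powr r))"
      by (intro mult_left_mono add_mono F G) auto
    also have "\<dots> = ennreal ((A + B) powr (r - 1) * (A powr (1 - r) * A powr r + B powr (1 - r) * B powr r))"
      by (simp add: ennreal_plus[symmetric] ennreal_mult[symmetric] del: ennreal_plus)
    also have "(A + B) powr (r - 1) * (A powr (1 - r) * A powr r + B powr (1 - r) * B powr r) = (A + B) powr r"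
      using AB by (simp add: powr_add[symmetric] powr_diff)
    finally have "Lnorm r M (\<lambda>x. F x + G x) \<le> enn_powr (ennreal ((A + B) powr r)) (1 / r)"
      unfolding Lnorm_def using rp by (intro enn_powr_mono) auto
    also have "\<dots> = ennreal (A + B)" using AB rp by (simp add: enn_powr_ennreal powr_powr)
    also have "\<dots> = Lnorm r M F + Lnorm r M G + ennreal e"
      using ab e by (simp add: A_def B_def ennreal_plus[symmetric] del: ennreal_plus)
    finally show "Lnorm r M (\<lambda>x. F x + G x) \<le> Lnorm r M F + Lnorm r M G + ennreal e" .
  qed
qed auto

lemma Lnorm_mono:
  "0 < r \<Longrightarrow> (\<And>x. F x \<le> G x) \<Longrightarrow> Lnorm r M F \<le> Lnorm r M G"
  unfolding Lnorm_def by (intro enn_powr_mono nn_integral_mono) auto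

text \<open>The exponent makes this functional subadditive on both sides of \<open>r = 1\<close>, so that the cases
  \<open>p \<ge> q\<close> and \<open>p < q\<close> of the mixed norm need not be distinguished later.\<close>

definition Phi :: "real \<Rightarrow> 'a measure \<Rightarrow> ('a \<Rightarrow> ennreal) \<Rightarrow> ennreal" where
  "Phi r M F = enn_powr (\<integral>\<^sup>+ x. enn_powr (F x) r \<partial>M) (min 1 (1 / r))"

lemma Phi_add:
  assumes r: "0 < r" and [measurable]: "F \<in> borel_measurable M" "G \<in> borel_measurable M"
  shows "Phi r M (\<lambda>x. F x + G x) \<le> Phi r M F + Phi r M G"
proof (cases "1 \<le> r")
  case True
  then have "min 1 (1 / r) = 1 / r" by (simp add: min_def)
  with Lnorm_triangle[OF True, of F M G] show ?thesis by (simp add: Phi_def Lnorm_def)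
next
  case False
  then have "min 1 (1 / r) = 1" using r by (simp add: min_def)
  moreover have "(\<integral>\<^sup>+ x. enn_powr (F x + G x) r \<partial>M) \<le> (\<integral>\<^sup>+ x. enn_powr (F x) r + enn_powr (G x) r \<partial>M)"
    using r False by (intro nn_integral_mono enn_powr_subadditive) auto
  ultimately show ?thesis using r by (simp add: Phi_def nn_integral_add)
qed

lemma Phi_mono:
  "0 < r \<Longrightarrow> (\<And>x. F x \<le> G x) \<Longrightarrow> Phi r M F \<le> Phi r M G"
  unfolding Phi_def by (intro enn_powr_mono nn_integral_mono) auto

lemma Phi_cmult:
  assumes r: "0 < r" and [measurable]: "F \<in> borel_measurable M"
  shows "Phi r M (\<lambda>x. c * F x) = enn_powr c (r * min 1 (1 / r)) * Phi r M F"
proof -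
  have "min 1 (1 / r) > 0" using r by auto
  then show ?thesis using r
    by (simp add: Phi_def enn_powr_mult nn_integral_cmult enn_powr_powr)
qed

lemma Phi_zero [simp]: "0 < r \<Longrightarrow> Phi r M (\<lambda>x. 0) = 0"
  by (simp add: Phi_def)

lemma Phi_sum:
  assumes r: "0 < r" and "finite I" and "\<And>i. i \<in> I \<Longrightarrow> F i \<in> borel_measurable M"
  shows "Phi r M (\<lambda>x. \<Sum>i\<in>I. F i x) \<le> (\<Sum>i\<in>I. Phi r M (F i))"
  using assms(2,3)
proof (induction I rule: finite_induct)
  case (insert i I)
  then have [measurable]: "F i \<in> borel_measurable M" "(\<lambda>x. \<Sum>i\<in>I. F i x) \<in> borel_measurable M"
    by (auto intro: borel_measurable_sum)
  have "Phi r M (\<lambda>x. F i x + (\<Sum>i\<in>I. F i x)) \<le> Phi r M (F i) + Phi r M (\<lambda>x. \<Sum>i\<in>I. F i x)"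
    using r by (intro Phi_add) auto
  also have "\<dots> \<le> Phi r M (F i) + (\<Sum>i\<in>I. Phi r M (F i))"
    using insert by (intro add_left_mono) auto
  finally show ?case using insert by simp
qed (use r in auto)


section \<open>Mixed norms: Fatou's lemma and a Brezis-Lieb inequality\<close>

abbreviation meas2 :: "(real \<Rightarrow> real \<Rightarrow> complex) \<Rightarrow> bool" where
  "meas2 u \<equiv> (\<lambda>(t, x). u x t) \<in> borel_measurable (lborel \<Otimes>\<^sub>M lborel)"

lemma meas2_inner:
  assumes u: "meas2 u"
  shows "(\<lambda>t. \<integral>\<^sup>+ x. ennreal (cmod (u x t) powr q) \<partial>lborel) \<in> borel_measurable lborel"
    and "(\<lambda>x. u x t) \<in> borel_measurable lborel"
proof -
  have [measurable]: "(\<lambda>z. u (snd z) (fst z)) \<in> borel_measurable (lborel \<Otimes>\<^sub>M lborel)"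
    using u by (simp add: case_prod_beta')
  have "(\<lambda>z. ennreal (cmod (u (snd z) (fst z)) powr q)) \<in> borel_measurable (lborel \<Otimes>\<^sub>M lborel)"
    by measurable
  from lborel.borel_measurable_nn_integral_fst[OF this]
  show "(\<lambda>t. \<integral>\<^sup>+ x. ennreal (cmod (u x t) powr q) \<partial>lborel) \<in> borel_measurable lborel" by simp
  have "(\<lambda>x. (t, x)) \<in> measurable lborel (lborel \<Otimes>\<^sub>M lborel)" by simp
  from measurable_compose[OF this u] show "(\<lambda>x. u x t) \<in> borel_measurable lborel" by simp
qed

lemma mixed_norm_Lnorm:
  assumes "0 < p" "0 < q"
  shows "mixed_norm p q u = Lnorm p lborel (\<lambda>t. Lnorm q lborel (\<lambda>x. ennreal (cmod (u x t))))"
  using assms by (simp add: mixed_norm_def Lnorm_def enn_powr_ennreal enn_powr_powr)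

text \<open>This explains the exponent \<open>min p q\<close> used throughout: 1/p times it equals
  min 1 (q/p), which is the outer exponent of \<open>Phi\<close> at order p/q.\<close>

lemma mixed_norm_Phi:
  assumes "0 < p" "0 < q"
  shows "enn_powr (mixed_norm p q u) (min p q) =
    Phi (p / q) lborel (\<lambda>t. \<integral>\<^sup>+ x. ennreal (cmod (u x t) powr q) \<partial>lborel)"
proof -
  have "1 / p * min p q = min 1 (1 / (p / q))"
    using assms by (auto simp: min_def field_simps)
  then show ?thesis unfolding mixed_norm_def Phi_def enn_powr_powr by simp
qed

lemma mixed_norm_triangle:
  assumes "1 \<le> p" "1 \<le> q" and u: "meas2 u" and v: "meas2 v"
  shows "mixed_norm p q (\<lambda>x t. u x t + v x t) \<le> mixed_norm p q u + mixed_norm p q v"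
proof -
  have *: "(\<lambda>t. Lnorm q lborel (\<lambda>x. ennreal (cmod (w x t)))) \<in> borel_measurable lborel" if "meas2 w" for w
    using meas2_inner(1)[OF that, of q] assms by (simp add: Lnorm_def enn_powr_ennreal)
  note [measurable] = *[OF u] *[OF v] meas2_inner(2)[OF u] meas2_inner(2)[OF v]
  have "mixed_norm p q (\<lambda>x t. u x t + v x t) = Lnorm p lborel (\<lambda>t. Lnorm q lborel (\<lambda>x. ennreal (cmod (u x t + v x t))))"
    using assms by (intro mixed_norm_Lnorm) auto
  also have "\<dots> \<le> Lnorm p lborel (\<lambda>t. Lnorm q lborel (\<lambda>x. ennreal (cmod (u x t)) + ennreal (cmod (v x t))))"
    using assms by (intro Lnorm_mono) (auto simp flip: ennreal_plus intro!: ennreal_leI norm_triangle_ineq)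
  also have "\<dots> \<le> Lnorm p lborel (\<lambda>t. Lnorm q lborel (\<lambda>x. ennreal (cmod (u x t))) + Lnorm q lborel (\<lambda>x. ennreal (cmod (v x t))))"
    using assms by (intro Lnorm_mono Lnorm_triangle) auto
  also have "\<dots> \<le> mixed_norm p q u + mixed_norm p q v"
    using assms by (subst (1 2) mixed_norm_Lnorm) (auto intro: Lnorm_triangle)
  finally show ?thesis .
qed

text \<open>Fatou's lemma in x and then in t, the power p/q passing through the lower limit by
  continuity and monotonicity. It carries bounds over to pointwise limits that are not known to be
  evolutions of a datum.\<close>

lemma mixed_norm_Fatou:
  assumes pq: "0 < p" "0 < q" and u: "meas2 u" and un: "\<And>n. meas2 (un n)"
    and ae: "AE t in lborel. AE x in lborel. (\<lambda>n. un n x t) \<longlonglongrightarrow> u x t"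
    and le: "\<And>n. mixed_norm p q (un n) \<le> C n" and C: "C \<longlonglongrightarrow> c"
  shows "mixed_norm p q u \<le> c"
proof -
  define I where "I v t = (\<integral>\<^sup>+ x. ennreal (cmod (v x t) powr q) \<partial>lborel)" for v :: "real \<Rightarrow> real \<Rightarrow> complex" and t
  have I: "I v \<in> borel_measurable lborel" if "meas2 v" for v
    using meas2_inner(1)[OF that, of q] by (simp add: I_def[abs_def])
  note [measurable] = I[OF u] I[OF un] meas2_inner(2)[OF u] meas2_inner(2)[OF un]
  have 1: "AE t in lborel. I u t \<le> liminf (\<lambda>n. I (un n) t)"
    using ae
  proof eventually_elim
    case (elim t)
    have "I u t \<le> (\<integral>\<^sup>+ x. liminf (\<lambda>n. ennreal (cmod (un n x t) powr q)) \<partial>lborel)"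
      unfolding I_def
    proof (rule nn_integral_mono_AE, use elim in eventually_elim)
      case (elim x)
      have "(\<lambda>n. ennreal (cmod (un n x t) powr q)) \<longlonglongrightarrow> ennreal (cmod (u x t) powr q)"
        using pq elim by (intro tendsto_ennrealI tendsto_powr' tendsto_norm) auto
      from lim_imp_Liminf[OF _ this] show ?case by simp
    qed
    also have "\<dots> \<le> liminf (\<lambda>n. I (un n) t)"
      unfolding I_def by (intro nn_integral_liminf) auto
    finally show ?case .
  qed
  have mono: "mono (\<lambda>a. enn_powr a (p / q))" using pq by (auto intro!: monoI enn_powr_mono)
  have "(\<integral>\<^sup>+ t. enn_powr (I u t) (p / q) \<partial>lborel) \<le> (\<integral>\<^sup>+ t. liminf (\<lambda>n. enn_powr (I (un n) t) (p / q)) \<partial>lborel)"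
  proof (rule nn_integral_mono_AE, use 1 in eventually_elim)
    case (elim t)
    then have "enn_powr (I u t) (p / q) \<le> enn_powr (liminf (\<lambda>n. I (un n) t)) (p / q)"
      using pq by (intro enn_powr_mono) auto
    also have "\<dots> = liminf (\<lambda>n. enn_powr (I (un n) t) (p / q))"
      using pq by (intro Liminf_compose_continuous_mono[OF continuous_on_enn_powr mono, symmetric]) auto
    finally show ?case .
  qed
  also have "\<dots> \<le> liminf (\<lambda>n. \<integral>\<^sup>+ t. enn_powr (I (un n) t) (p / q) \<partial>lborel)"
    using pq by (intro nn_integral_liminf) auto
  also have "\<dots> \<le> liminf (\<lambda>n. enn_powr (C n) p)"
  proof (intro Liminf_mono always_eventually allI)
    fix n
    have "(\<integral>\<^sup>+ t. enn_powr (I (un n) t) (p / q) \<partial>lborel) = enn_powr (mixed_norm p q (un n)) p"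
      using pq by (simp add: mixed_norm_def enn_powr_powr I_def)
    also have "\<dots> \<le> enn_powr (C n) p" using le pq by (intro enn_powr_mono) auto
    finally show "(\<integral>\<^sup>+ t. enn_powr (I (un n) t) (p / q) \<partial>lborel) \<le> enn_powr (C n) p" .
  qed
  also have "\<dots> = enn_powr c p"
    using tendsto_enn_powr[OF pq(1) C] by (intro lim_imp_Liminf) auto
  finally have "mixed_norm p q u \<le> enn_powr (enn_powr c p) (1 / p)"
    unfolding mixed_norm_def I_def using pq by (intro enn_powr_mono) auto
  then show ?thesis using pq by (simp add: enn_powr_powr)
qed

text \<open>Take d with (1 + d)^q = 1 + e. If |a| <= d |b|, then a is absorbed by the factor 1 + e
  in front of b; otherwise |b| <= |a| / d and b is absorbed by the constant in front of a.\<close>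

lemma powr_norm_perturb:
  assumes "0 < q" "0 < e"
  obtains C where "0 \<le> C" "\<And>a b :: complex. cmod (a + b) powr q \<le> (1 + e) * cmod b powr q + C * cmod a powr q"
proof -
  define d where "d = (1 + e) powr (1 / q) - 1"
  have "1 powr (1 / q) < (1 + e) powr (1 / q)" using assms by (intro powr_less_mono2) auto
  then have d: "0 < d" "(1 + d) powr q = 1 + e" using assms by (auto simp: d_def powr_powr)
  show ?thesis
  proof (rule that[of "(1 + 1 / d) powr q"])
    fix a b :: complex
    show "cmod (a + b) powr q \<le> (1 + e) * cmod b powr q + (1 + 1 / d) powr q * cmod a powr q"
    proof (cases "cmod a \<le> d * cmod b")
      case True
      then have "cmod (a + b) \<le> (1 + d) * cmod b"
        using norm_triangle_ineq[of a b] by (simp add: algebra_simps)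
      then have "cmod (a + b) powr q \<le> ((1 + d) * cmod b) powr q"
        using assms by (intro powr_mono2) auto
      also have "\<dots> = (1 + e) * cmod b powr q" using d by (simp add: powr_mult)
      finally show ?thesis by (simp add: add_increasing2)
    next
      case False
      then have "cmod b \<le> cmod a / d" using d by (simp add: field_simps)
      then have "cmod (a + b) \<le> (1 + 1 / d) * cmod a"
        using norm_triangle_ineq[of a b] by (simp add: algebra_simps)
      then have "cmod (a + b) powr q \<le> ((1 + 1 / d) * cmod a) powr q"
        using assms by (intro powr_mono2) auto
      also have "\<dots> = (1 + 1 / d) powr q * cmod a powr q" using d by (simp add: powr_mult)
      finally show ?thesis using assms by (simp add: add_increasing)
    qed
  qed simp
qed

text \<open>The loss \<open>1 + e\<close> lets the remainder be dominated by
  a multiple of \<open>|u|^q\<close> alone.\<close>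

lemma mixed_norm_Brezis_Lieb:
  assumes pq: "0 < p" "0 < q" and e: "0 < e" and u: "meas2 u" and w: "\<And>n. meas2 (w n)"
    and ae: "AE t in lborel. AE x in lborel. (\<lambda>n. w n x t) \<longlonglongrightarrow> 0"
    and fin: "mixed_norm p q u < top"
  obtains r where "r \<longlonglongrightarrow> 0" "\<And>n. enn_powr (mixed_norm p q (\<lambda>x t. u x t + w n x t)) (min p q) \<le>
      enn_powr (mixed_norm p q u) (min p q) + ennreal (1 + e) * enn_powr (mixed_norm p q (w n)) (min p q) + r n"
proof -
  obtain C where C: "0 \<le> C" "\<And>a b :: complex. cmod (a + b) powr q \<le> (1 + e) * cmod b powr q + C * cmod a powr q"
    using powr_norm_perturb[OF pq(2) e] by blast
  define I where "I v t = (\<integral>\<^sup>+ x. ennreal (cmod (v x t) powr q) \<partial>lborel)" for v :: "real \<Rightarrow> real \<Rightarrow> complex" and t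
  have I: "I v \<in> borel_measurable lborel" if "meas2 v" for v
    using meas2_inner(1)[OF that, of q] by (simp add: I_def[abs_def])
  define G where "G n x t = max 0 (cmod (u x t + w n x t) powr q - cmod (u x t) powr q - (1 + e) * cmod (w n x t) powr q)" for n x t
  define R where "R n t = (\<integral>\<^sup>+ x. ennreal (G n x t) \<partial>lborel)" for n t
  have GC: "G n x t \<le> C * cmod (u x t) powr q" for n x t
    using C(1) C(2)[of "u x t" "w n x t"] powr_ge_zero[of "cmod (u x t)" q]
      mult_nonneg_nonneg[OF C(1) powr_ge_zero[of "cmod (u x t)" q]]
    unfolding G_def by linarith
  have [measurable]: "(\<lambda>z. u (snd z) (fst z)) \<in> borel_measurable (lborel \<Otimes>\<^sub>M lborel)"
    "\<And>n. (\<lambda>z. w n (snd z) (fst z)) \<in> borel_measurable (lborel \<Otimes>\<^sub>M lborel)"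
    using u w by (simp_all add: case_prod_beta')
  have "meas2 (\<lambda>x t. u x t + w n x t)" for n by (simp add: case_prod_beta')
  note [measurable] = I[OF u] I[OF w] I[OF this] meas2_inner(2)[OF u] meas2_inner(2)[OF w]
  have "(\<lambda>z. ennreal (G n (snd z) (fst z))) \<in> borel_measurable (lborel \<Otimes>\<^sub>M lborel)" for n
    unfolding G_def by measurable
  from lborel.borel_measurable_nn_integral_fst[OF this]
  have [measurable]: "R n \<in> borel_measurable lborel" for n by (simp add: R_def[abs_def])
  have [measurable]: "(\<lambda>x. G n x t) \<in> borel_measurable lborel" for n t unfolding G_def by measurable
  have RI: "R n t \<le> ennreal C * I u t" for n t
  proof -
    have "R n t \<le> (\<integral>\<^sup>+ x. ennreal C * ennreal (cmod (u x t) powr q) \<partial>lborel)"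
      unfolding R_def using GC C(1) by (intro nn_integral_mono) (simp add: ennreal_mult[symmetric] ennreal_leI)
    then show ?thesis by (simp add: I_def nn_integral_cmult)
  qed
  have finI: "(\<integral>\<^sup>+ t. enn_powr (I u t) (p / q) \<partial>lborel) < top"
    using fin by (simp add: mixed_norm_def I_def less_top[symmetric] enn_powr_eq_top_iff)
  then have "AE t in lborel. enn_powr (I u t) (p / q) \<noteq> \<infinity>"
    using pq by (intro nn_integral_PInf_AE) auto
  then have Ifin: "AE t in lborel. I u t < top" by (simp add: enn_powr_eq_top_iff less_top)
  have R0: "AE t in lborel. (\<lambda>n. R n t) \<longlonglongrightarrow> 0"
    using ae Ifin
  proof eventually_elim
    case (elim t)
    have "(\<lambda>n. R n t) \<longlonglongrightarrow> (\<integral>\<^sup>+ x. 0 \<partial>(lborel :: real measure))"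
      unfolding R_def
    proof (rule nn_integral_dominated_convergence[where w = "\<lambda>x. ennreal C * ennreal (cmod (u x t) powr q)"])
      show "AE x in lborel. ennreal (G n x t) \<le> ennreal C * ennreal (cmod (u x t) powr q)" for n
        using GC C(1) by (simp add: ennreal_mult[symmetric] ennreal_leI)
      show "(\<integral>\<^sup>+ x. ennreal C * ennreal (cmod (u x t) powr q) \<partial>lborel) < \<infinity>"
        using elim(2) by (simp add: nn_integral_cmult I_def ennreal_mult_less_top)
      show "AE x in lborel. (\<lambda>n. ennreal (G n x t)) \<longlonglongrightarrow> 0"
        using elim(1)
      proof eventually_elim
        case (elim x)
        show ?case
        \<comment> \<open>Continuity of the power is available only at a nonzero base. Where
          \<open>u\<close> vanishes, the domination \<open>GC\<close> already forces
          \<open>G\<close> to be 0.\<close>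
        proof (cases "u x t = 0")
          case True
          then have "G n x t = 0" for n using GC[of n x t] by (simp add: G_def antisym)
          then show ?thesis by simp
        next
          case False
          have "(\<lambda>n. G n x t) \<longlonglongrightarrow> max 0 (cmod (u x t + 0) powr q - cmod (u x t) powr q - (1 + e) * 0)"
            unfolding G_def using pq False
            by (intro tendsto_max tendsto_diff tendsto_mult tendsto_const tendsto_powr tendsto_norm tendsto_add elim
                tendsto_zero_powrI[OF tendsto_norm_zero[OF elim] tendsto_const _ pq(2)]) auto
          then have "(\<lambda>n. G n x t) \<longlonglongrightarrow> 0" by simp
          then show ?thesis using tendsto_ennrealI by fastforce
        qed
      qed
    qed auto
    then show ?case by simp
  qed
  have "(\<lambda>n. \<integral>\<^sup>+ t. enn_powr (R n t) (p / q) \<partial>lborel) \<longlonglongrightarrow> (\<integral>\<^sup>+ t. 0 \<partial>(lborel :: real measure))"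
  proof (rule nn_integral_dominated_convergence[where w = "\<lambda>t. enn_powr (ennreal C) (p / q) * enn_powr (I u t) (p / q)"])
    show "AE t in lborel. enn_powr (R n t) (p / q) \<le> enn_powr (ennreal C) (p / q) * enn_powr (I u t) (p / q)" for n
      using RI[of n] pq by (auto simp: enn_powr_mult[symmetric] intro!: enn_powr_mono)
    show "(\<integral>\<^sup>+ t. enn_powr (ennreal C) (p / q) * enn_powr (I u t) (p / q) \<partial>lborel) < \<infinity>"
      using finI pq C(1) by (simp add: nn_integral_cmult ennreal_mult_less_top enn_powr_ennreal)
    show "AE t in lborel. (\<lambda>n. enn_powr (R n t) (p / q)) \<longlonglongrightarrow> 0"
      using R0 by eventually_elim (use tendsto_enn_powr[of "p / q" _ 0] pq in auto)
  qed (use pq in auto)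
  then have R1: "(\<lambda>n. Phi (p / q) lborel (R n)) \<longlonglongrightarrow> 0"
    unfolding Phi_def using tendsto_enn_powr[of "min 1 (1 / (p / q))" _ 0] pq by simp
  show ?thesis
  proof (rule that[OF R1])
    fix n
    have "ennreal (cmod (u x t + w n x t) powr q) \<le> ennreal (cmod (u x t) powr q) + ennreal (1 + e) * ennreal (cmod (w n x t) powr q) + ennreal (G n x t)" for x t
    proof -
      have "0 \<le> G n x t" by (simp add: G_def)
      then have "ennreal (cmod (u x t) powr q) + ennreal (1 + e) * ennreal (cmod (w n x t) powr q) + ennreal (G n x t) =
          ennreal (cmod (u x t) powr q + (1 + e) * cmod (w n x t) powr q + G n x t)"
        using e by (simp add: ennreal_mult[symmetric] ennreal_plus[symmetric] del: ennreal_plus)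
      moreover have "cmod (u x t + w n x t) powr q \<le> cmod (u x t) powr q + (1 + e) * cmod (w n x t) powr q + G n x t"
        by (simp add: G_def)
      ultimately show ?thesis by (simp only: ennreal_leI)
    qed
    then have "I (\<lambda>x t. u x t + w n x t) t \<le> (\<integral>\<^sup>+ x. ennreal (cmod (u x t) powr q) + ennreal (1 + e) * ennreal (cmod (w n x t) powr q) + ennreal (G n x t) \<partial>lborel)" for t
      unfolding I_def by (intro nn_integral_mono)
    then have "I (\<lambda>x t. u x t + w n x t) t \<le> I u t + ennreal (1 + e) * I (w n) t + R n t" for t
      unfolding I_def R_def by (simp add: nn_integral_add nn_integral_cmult)
    then have "Phi (p / q) lborel (I (\<lambda>x t. u x t + w n x t)) \<le> Phi (p / q) lborel (\<lambda>t. I u t + ennreal (1 + e) * I (w n) t + R n t)"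
      using pq by (intro Phi_mono) auto
    also have "\<dots> \<le> Phi (p / q) lborel (\<lambda>t. I u t + ennreal (1 + e) * I (w n) t) + Phi (p / q) lborel (R n)"
      using pq by (intro Phi_add) auto
    also have "\<dots> \<le> Phi (p / q) lborel (I u) + Phi (p / q) lborel (\<lambda>t. ennreal (1 + e) * I (w n) t) + Phi (p / q) lborel (R n)"
      using pq by (intro add_right_mono Phi_add) auto
    also have "Phi (p / q) lborel (\<lambda>t. ennreal (1 + e) * I (w n) t) \<le> ennreal (1 + e) * Phi (p / q) lborel (I (w n))"
    proof -
      \<comment> \<open>The combined exponent is min (p/q) 1, hence at most 1, so the loss 1 + e is
        not amplified when it leaves \<open>Phi\<close>.\<close>
      have "(1 + e) powr (p / q * min 1 (1 / (p / q))) \<le> (1 + e) powr 1"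
        using pq e by (intro powr_mono) (auto simp: min_def field_simps)
      then have "enn_powr (ennreal (1 + e)) (p / q * min 1 (1 / (p / q))) \<le> ennreal (1 + e)"
        using e by (subst enn_powr_ennreal) (auto simp del: ennreal_plus intro!: ennreal_leI)
      then show ?thesis using pq by (subst Phi_cmult) (auto intro!: mult_right_mono)
    qed
    finally show "enn_powr (mixed_norm p q (\<lambda>x t. u x t + w n x t)) (min p q) \<le>
      enn_powr (mixed_norm p q u) (min p q) + ennreal (1 + e) * enn_powr (mixed_norm p q (w n)) (min p q) + Phi (p / q) lborel (R n)"
      unfolding mixed_norm_Phi[OF pq] I_def by (simp add: add_mono)
  qed
qed

section \<open>Plancherel bounds for the Airy evolution\<close>

abbreviation osc :: "real \<Rightarrow> real \<Rightarrow> real \<Rightarrow> complex" where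
  "osc x t \<xi> \<equiv> exp (\<i> * complex_of_real (x * \<xi> + t * \<xi> ^ 3))"

text \<open>Integrability is not assumed because the Bochner integral of a nonintegrable function is
  0 by convention.\<close>

lemma norm_integral_le_nn_integral:
  fixes f :: "'a \<Rightarrow> complex"
  shows "ennreal (cmod (LINT x|M. f x)) \<le> (\<integral>\<^sup>+ x. ennreal (cmod (f x)) \<partial>M)"
proof (cases "integrable M f")
  case True
  then show ?thesis by (rule integral_norm_bound_ennreal)
qed (simp add: not_integrable_integral_eq)

text \<open>The form of Fubini's theorem suited to oscillatory integrals: the amplitudes carry the
  integrability and dominate the unimodular kernel.\<close>

lemma Fubini_bounded_kernel:
  fixes a b :: "real \<Rightarrow> complex"
  assumes a: "integrable lborel a" and b: "integrable lborel b"
    and K: "(\<lambda>z. K (fst z) (snd z)) \<in> borel_measurable (lborel \<Otimes>\<^sub>M lborel)"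
    and le: "\<And>t x. cmod (K t x) \<le> 1"
  shows "(LINT t|lborel. a t * (LINT x|lborel. K t x * b x)) = (LINT x|lborel. b x * (LINT t|lborel. K t x * a t))"
proof -
  note [measurable] = borel_measurable_integrable[OF a] borel_measurable_integrable[OF b] K
  have Kt [measurable]: "(\<lambda>x. K t x) \<in> borel_measurable lborel" for t
    using measurable_compose[of "\<lambda>x. (t, x)" lborel _ _ _, OF _ K] by simp
  have M: "(\<lambda>(t, x). a t * (K t x * b x)) \<in> borel_measurable (lborel \<Otimes>\<^sub>M lborel)"
    by (simp add: case_prod_beta')
  have "integrable (lborel \<Otimes>\<^sub>M lborel) (\<lambda>(t, x). a t * (K t x * b x))"
  proof (rule lborel_pair.Fubini_integrable[OF M])
    have i: "integrable lborel (\<lambda>x. K t x * b x)" for t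
      by (rule Bochner_Integration.integrable_bound[OF b]) (use le in \<open>auto simp: norm_mult mult_left_le_one_le\<close>)
    show "AE t in lborel. integrable lborel (\<lambda>x. case (t, x) of (t, x) \<Rightarrow> a t * (K t x * b x))"
      using i by auto
    have [measurable]: "(\<lambda>t. LINT x|lborel. cmod (a t * (K t x * b x))) \<in> borel_measurable lborel"
      by (rule lborel.borel_measurable_lebesgue_integral) (simp add: case_prod_beta')
    show "integrable lborel (\<lambda>t. LINT x|lborel. norm (case (t, x) of (t, x) \<Rightarrow> a t * (K t x * b x)))"
    proof (rule Bochner_Integration.integrable_bound[where f = "\<lambda>t. cmod (a t) * (LINT x|lborel. cmod (b x))"])
      show "AE t in lborel. norm (LINT x|lborel. norm (case (t, x) of (t, x) \<Rightarrow> a t * (K t x * b x)))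
          \<le> norm (cmod (a t) * (LINT x|lborel. cmod (b x)))"
      proof (rule AE_I2)
        fix t
        have "(LINT x|lborel. cmod (K t x * b x)) \<le> (LINT x|lborel. cmod (b x))"
          using integrable_norm[OF i[of t]] integrable_norm[OF b]
          by (intro integral_mono) (auto simp: norm_mult le mult_left_le_one_le)
        moreover have "(LINT x|lborel. cmod (a t * (K t x * b x))) = cmod (a t) * (LINT x|lborel. cmod (K t x * b x))"
          unfolding norm_mult[of "a t"] by simp
        ultimately show "norm (LINT x|lborel. norm (case (t, x) of (t, x) \<Rightarrow> a t * (K t x * b x)))
          \<le> norm (cmod (a t) * (LINT x|lborel. cmod (b x)))"
          by (simp add: abs_of_nonneg integral_nonneg_AE mult_left_mono)
      qed
    qed (use a in auto)
  qed
  from lborel_pair.Fubini_integral[OF this]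
  have "(LINT x|lborel. LINT t|lborel. a t * (K t x * b x)) = (LINT t|lborel. LINT x|lborel. a t * (K t x * b x))" .
  moreover have "a t * (K t x * b x) = b x * (K t x * a t)" for t x by simp
  ultimately show ?thesis
    by (simp only: integral_mult_right_zero[symmetric])
qed

text \<open>The characteristic function of the standard normal law after the substitution y = e t.
  The right-hand side is 2 pi times a probability density of width e, an approximate identity as e
  tends to 0.\<close>

lemma gaussian_Fourier:
  assumes e: "0 < e"
  shows "(LINT t|lborel. exp (\<i> * complex_of_real (t * z)) * complex_of_real (exp (- (e * t)\<^sup>2 / 2))) =
    complex_of_real (2 * pi * normal_density 0 e z)"
proof -
  have "complex_of_real (exp (- ((z / e)^2) / 2)) = char std_normal_distribution (z / e)"
    by (simp add: char_std_normal_distribution)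
  also have "\<dots> = (LINT y|lborel. std_normal_density y *\<^sub>R iexp (z / e * y))"
    by (simp add: char_def integral_density)
  also have "\<dots> = \<bar>e\<bar> *\<^sub>R (LINT t|lborel. std_normal_density (0 + e * t) *\<^sub>R iexp (z / e * (0 + e * t)))"
    using e by (intro lborel_integral_real_affine) auto
  also have "\<dots> = complex_of_real (e / sqrt (2 * pi)) * (LINT t|lborel. exp (\<i> * complex_of_real (t * z)) * complex_of_real (exp (- (e * t)\<^sup>2 / 2)))"
    using e by (subst integral_mult_right_zero[symmetric], subst integral_scaleR_right[symmetric])
      (intro Bochner_Integration.integral_cong, auto simp: std_normal_density_def scaleR_conv_of_real mult_ac)
  finally have *: "complex_of_real (exp (- ((z / e)^2) / 2)) = complex_of_real (e / sqrt (2 * pi)) * (LINT t|lborel. exp (\<i> * complex_of_real (t * z)) * complex_of_real (exp (- (e * t)\<^sup>2 / 2)))" .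
  have "complex_of_real (sqrt (2 * pi) / e) * complex_of_real (e / sqrt (2 * pi)) = 1"
    using e by (simp flip: of_real_mult)
  then have "(LINT t|lborel. exp (\<i> * complex_of_real (t * z)) * complex_of_real (exp (- (e * t)\<^sup>2 / 2)))
     = complex_of_real (sqrt (2 * pi) / e) * complex_of_real (exp (- ((z / e)^2) / 2))"
    unfolding * by (simp add: mult.assoc[symmetric] del: of_real_divide of_real_mult)
  also have "\<dots> = complex_of_real (sqrt (2 * pi) / e * exp (- ((z / e)^2) / 2))"
    by simp
  also have "sqrt (2 * pi) / e * exp (- ((z / e)^2) / 2) = 2 * pi * normal_density 0 e z"
  proof -
    have "sqrt (2 * pi) / e = 2 * pi * (1 / (sqrt (2 * pi) * e))"
      using e real_sqrt_mult_self[of "2 * pi"] by (simp add: field_simps)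
    moreover have "sqrt (2 * pi * e\<^sup>2) = sqrt (2 * pi) * e" using e by (simp add: real_sqrt_mult)
    ultimately show ?thesis by (simp add: normal_density_def power_divide)
  qed
  finally show ?thesis .
qed

text \<open>To be applied with \<open>W = \<omega>'\<close>. Gaussian regularisation in \<open>t\<close>, then Schur's test with weights \<open>W\<close>.\<close>

lemma Plancherel_phase:
  fixes g :: "real \<Rightarrow> complex" and \<omega> W :: "real \<Rightarrow> real"
  assumes g: "integrable lborel g" and [measurable]: "\<omega> \<in> borel_measurable borel" "W \<in> borel_measurable borel"
    and W: "\<And>\<xi>. g \<xi> \<noteq> 0 \<Longrightarrow> 0 < W \<xi>"
    and key: "\<And>e \<xi>. 0 < e \<Longrightarrow> (\<integral>\<^sup>+ \<eta>. ennreal (normal_density (\<omega> \<xi>) e (\<omega> \<eta>)) * (ennreal (W \<eta>) * indicator {\<eta>. g \<eta> \<noteq> 0} \<eta>) \<partial>lborel) \<le> 1"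
  shows "(\<integral>\<^sup>+ t. ennreal ((cmod (LINT \<xi>|lborel. exp (\<i> * complex_of_real (t * \<omega> \<xi>)) * g \<xi>))\<^sup>2) \<partial>lborel)
    \<le> ennreal (2 * pi) * (\<integral>\<^sup>+ \<xi>. ennreal ((cmod (g \<xi>))\<^sup>2 / W \<xi>) \<partial>lborel)" (is "?L \<le> ennreal (2 * pi) * ?B")
proof -
  note [measurable] = borel_measurable_integrable[OF g]
  define F where "F t = (LINT \<xi>|lborel. exp (\<i> * complex_of_real (t * \<omega> \<xi>)) * g \<xi>)" for t
  have [measurable]: "F \<in> borel_measurable lborel"
    unfolding F_def[abs_def] by (rule lborel.borel_measurable_lebesgue_integral) (simp add: case_prod_beta')
  have [measurable]: "(\<lambda>t. cnj (F t)) \<in> borel_measurable lborel"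
    by (intro borel_measurable_continuous_on[where f = cnj]) (auto intro: continuous_intros)
  have Fb: "cmod (F t) \<le> (LINT \<xi>|lborel. cmod (g \<xi>))" for t
    unfolding F_def by (rule order_trans[OF integral_norm_bound]) (simp add: norm_mult)
  \<comment> \<open>Expanding |F|^2 under the Gaussian weight and integrating out t turns the phase
    difference into 2 pi times a normal density in
    \<open>\<omega> \<xi> - \<omega> \<eta>\<close>.\<close>
  have reg: "(\<integral>\<^sup>+ t. ennreal (exp (- (e * t)\<^sup>2 / 2) * (cmod (F t))\<^sup>2) \<partial>lborel) \<le> ennreal (2 * pi) * ?B" if e: "0 < e" for e
  proof -
    define w where "w t = exp (- (e * t)\<^sup>2 / 2)" for t
    have w_int: "integrable lborel w"
    proof -
      have "w t = sqrt (2 * pi) / e * normal_density 0 (1 / e) t" for t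
        using e by (simp add: w_def normal_density_def power_divide power_mult_distrib real_sqrt_divide real_sqrt_mult divide_simps)
      then show ?thesis using e by (simp add: w_def[abs_def])
    qed
    note [measurable] = borel_measurable_integrable[OF w_int]
    have wpos: "0 \<le> w t" for t by (simp add: w_def)
    have int1: "integrable lborel (\<lambda>t. complex_of_real (w t) * cnj (F t))"
    proof (rule Bochner_Integration.integrable_bound[where f = "\<lambda>t. w t * (LINT \<xi>|lborel. cmod (g \<xi>))"])
      show "AE t in lborel. norm (complex_of_real (w t) * cnj (F t)) \<le> norm (w t * (LINT \<xi>|lborel. cmod (g \<xi>)))"
        using wpos Fb by (auto simp: norm_mult abs_mult intro!: mult_left_mono order_trans[OF Fb])
    qed (use w_int in auto)
    have int2: "integrable lborel (\<lambda>t. complex_of_real (w t) * cnj (F t) * F t)"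
    proof (rule Bochner_Integration.integrable_bound[where f = "\<lambda>t. w t * (LINT \<xi>|lborel. cmod (g \<xi>))\<^sup>2"])
      show "AE t in lborel. norm (complex_of_real (w t) * cnj (F t) * F t) \<le> norm (w t * (LINT \<xi>|lborel. cmod (g \<xi>))\<^sup>2)"
        using wpos Fb by (auto simp: norm_mult abs_mult power2_eq_square mult.assoc intro!: mult_left_mono mult_mono)
    qed (use w_int in auto)
    have sq: "complex_of_real (w t) * cnj (F t) * F t = complex_of_real (w t * (cmod (F t))\<^sup>2)" for t
      by (simp add: complex_norm_square[symmetric] mult.assoc mult.commute[of "cnj _"])
    have inner: "(LINT t|lborel. exp (\<i> * complex_of_real (t * \<omega> \<xi>)) * (complex_of_real (w t) * cnj (F t)))
      = (LINT \<eta>|lborel. cnj (g \<eta>) * complex_of_real (2 * pi * normal_density 0 e (\<omega> \<xi> - \<omega> \<eta>)))" for \<xi>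
    proof -
      have cF: "cnj (F t) = (LINT \<eta>|lborel. exp (- \<i> * complex_of_real (t * \<omega> \<eta>)) * cnj (g \<eta>))" for t
        unfolding F_def Bochner_Integration.integral_cnj[symmetric] by (intro Bochner_Integration.integral_cong) (auto simp: exp_cnj)
      have "(LINT t|lborel. exp (\<i> * complex_of_real (t * \<omega> \<xi>)) * (complex_of_real (w t) * cnj (F t))) =
        (LINT t|lborel. (exp (\<i> * complex_of_real (t * \<omega> \<xi>)) * complex_of_real (w t)) * (LINT \<eta>|lborel. exp (- \<i> * complex_of_real (t * \<omega> \<eta>)) * cnj (g \<eta>)))"
        by (simp add: cF mult.assoc)
      also have "\<dots> = (LINT \<eta>|lborel. cnj (g \<eta>) * (LINT t|lborel. exp (- \<i> * complex_of_real (t * \<omega> \<eta>)) * (exp (\<i> * complex_of_real (t * \<omega> \<xi>)) * complex_of_real (w t))))"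
      proof (rule Fubini_bounded_kernel)
        show "integrable lborel (\<lambda>t. exp (\<i> * complex_of_real (t * \<omega> \<xi>)) * complex_of_real (w t))"
          by (rule Bochner_Integration.integrable_bound[OF w_int]) (auto simp: norm_mult)
        show "integrable lborel (\<lambda>x. cnj (g x))" using g by simp
      qed auto
      also have "\<dots> = (LINT \<eta>|lborel. cnj (g \<eta>) * (LINT t|lborel. exp (\<i> * complex_of_real (t * (\<omega> \<xi> - \<omega> \<eta>))) * complex_of_real (w t)))"
      proof -
        have "exp (- \<i> * complex_of_real (t * \<omega> \<eta>)) * (exp (\<i> * complex_of_real (t * \<omega> \<xi>)) * c) = exp (\<i> * complex_of_real (t * (\<omega> \<xi> - \<omega> \<eta>))) * c" for t \<eta> c
          by (simp only: mult.assoc[symmetric] exp_add[symmetric]) (simp add: right_diff_distrib)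
        then show ?thesis by (simp only:)
      qed
      also have "\<dots> = (LINT \<eta>|lborel. cnj (g \<eta>) * complex_of_real (2 * pi * normal_density 0 e (\<omega> \<xi> - \<omega> \<eta>)))"
        unfolding w_def gaussian_Fourier[OF e] ..
      finally show ?thesis .
    qed
    have "complex_of_real (LINT t|lborel. w t * (cmod (F t))\<^sup>2) = (LINT t|lborel. complex_of_real (w t) * cnj (F t) * F t)"
      unfolding sq by (rule integral_complex_of_real[symmetric])
    also have "\<dots> = (LINT \<xi>|lborel. g \<xi> * (LINT t|lborel. exp (\<i> * complex_of_real (t * \<omega> \<xi>)) * (complex_of_real (w t) * cnj (F t))))"
      by (rule Fubini_bounded_kernel[OF int1 g, of "\<lambda>t \<xi>. exp (\<i> * complex_of_real (t * \<omega> \<xi>))", folded F_def]) auto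
    also have "\<dots> = (LINT \<xi>|lborel. g \<xi> * (LINT \<eta>|lborel. cnj (g \<eta>) * complex_of_real (2 * pi * normal_density 0 e (\<omega> \<xi> - \<omega> \<eta>))))"
      unfolding inner ..
    finally have eq: "complex_of_real (LINT t|lborel. w t * (cmod (F t))\<^sup>2) = (LINT \<xi>|lborel. g \<xi> * (LINT \<eta>|lborel. cnj (g \<eta>) * complex_of_real (2 * pi * normal_density 0 e (\<omega> \<xi> - \<omega> \<eta>))))" .
    define N where "N \<xi> \<eta> = normal_density 0 e (\<omega> \<xi> - \<omega> \<eta>)" for \<xi> \<eta>
    have N: "0 \<le> N \<xi> \<eta>" "N \<xi> \<eta> = normal_density (\<omega> \<xi>) e (\<omega> \<eta>)" "N \<xi> \<eta> = N \<eta> \<xi>" for \<xi> \<eta>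
      by (simp_all add: N_def normal_density_def power2_commute)
    have [measurable]: "(\<lambda>z. N (fst z) (snd z)) \<in> borel_measurable (lborel \<Otimes>\<^sub>M lborel)" unfolding N_def by measurable
    have [measurable]: "(\<lambda>\<eta>. N \<xi> \<eta>) \<in> borel_measurable lborel" for \<xi> unfolding N_def by measurable
    define A where "A \<xi> \<eta> = ennreal ((cmod (g \<xi>))\<^sup>2 / W \<xi>) * (ennreal (N \<xi> \<eta>) * (ennreal (W \<eta>) * indicator {\<eta>. g \<eta> \<noteq> 0} \<eta>))" for \<xi> \<eta>
    have [measurable]: "(\<lambda>z. A (fst z) (snd z)) \<in> borel_measurable (lborel \<Otimes>\<^sub>M lborel)"
      "(\<lambda>z. A (snd z) (fst z)) \<in> borel_measurable (lborel \<Otimes>\<^sub>M lborel)" unfolding A_def N_def by measurable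
    have [measurable]: "(\<lambda>\<eta>. A \<xi> \<eta>) \<in> borel_measurable lborel" "(\<lambda>\<eta>. A \<eta> \<xi>) \<in> borel_measurable lborel" for \<xi>
      unfolding A_def N_def by measurable
    have Ab: "(\<integral>\<^sup>+ \<xi>. (\<integral>\<^sup>+ \<eta>. A \<xi> \<eta> \<partial>lborel) \<partial>lborel) \<le> ?B"
    proof (rule nn_integral_mono)
      fix \<xi>
      have "(\<integral>\<^sup>+ \<eta>. A \<xi> \<eta> \<partial>lborel) = ennreal ((cmod (g \<xi>))\<^sup>2 / W \<xi>) * (\<integral>\<^sup>+ \<eta>. ennreal (N \<xi> \<eta>) * (ennreal (W \<eta>) * indicator {\<eta>. g \<eta> \<noteq> 0} \<eta>) \<partial>lborel)"
        unfolding A_def by (intro nn_integral_cmult) measurable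
      also have "\<dots> \<le> ennreal ((cmod (g \<xi>))\<^sup>2 / W \<xi>) * 1"
        using key[OF e, of \<xi>] by (intro mult_left_mono) (auto simp: N(2))
      finally show "(\<integral>\<^sup>+ \<eta>. A \<xi> \<eta> \<partial>lborel) \<le> ennreal ((cmod (g \<xi>))\<^sup>2 / W \<xi>)" by simp
    qed
    have swap: "(\<integral>\<^sup>+ \<xi>. (\<integral>\<^sup>+ \<eta>. A \<eta> \<xi> \<partial>lborel) \<partial>lborel) = (\<integral>\<^sup>+ \<xi>. (\<integral>\<^sup>+ \<eta>. A \<xi> \<eta> \<partial>lborel) \<partial>lborel)"
      by (rule lborel_pair.Fubini') (simp add: case_prod_beta')
    \<comment> \<open>Schur's test: the square of |g \<xi>| W \<eta> - |g \<eta>| W \<xi> is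
      nonnegative, which splits the product into two terms, each of which has total mass controlled
      by \<open>key\<close>.\<close>
    have pw: "ennreal (cmod (g \<xi>)) * ennreal (cmod (g \<eta>) * (2 * pi * N \<xi> \<eta>)) \<le> ennreal pi * (A \<xi> \<eta> + A \<eta> \<xi>)" for \<xi> \<eta>
    proof (cases "g \<xi> = 0 \<or> g \<eta> = 0")
      case False
      then have Wp: "0 < W \<xi>" "0 < W \<eta>" using W by auto
      have "0 \<le> (cmod (g \<xi>) * W \<eta> - cmod (g \<eta>) * W \<xi>)\<^sup>2 / (W \<xi> * W \<eta>)" using Wp by simp
      also have "\<dots> = (cmod (g \<xi>))\<^sup>2 / W \<xi> * W \<eta> + (cmod (g \<eta>))\<^sup>2 / W \<eta> * W \<xi> - 2 * (cmod (g \<xi>) * cmod (g \<eta>))"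
        using Wp by (simp add: field_simps power2_eq_square)
      finally have "2 * (cmod (g \<xi>) * cmod (g \<eta>)) * (pi * N \<xi> \<eta>) \<le> ((cmod (g \<xi>))\<^sup>2 / W \<xi> * W \<eta> + (cmod (g \<eta>))\<^sup>2 / W \<eta> * W \<xi>) * (pi * N \<xi> \<eta>)"
        using N(1) by (intro mult_right_mono) auto
      moreover have "a * (b * (2 * pi * n)) \<le> pi * (X * (n * v) + Y * (n * u))"
        if "2 * (a * b) * (pi * n) \<le> (X * v + Y * u) * (pi * n)" for a b n X Y u v :: real
        using that by (simp add: algebra_simps)
      ultimately have "cmod (g \<xi>) * (cmod (g \<eta>) * (2 * pi * N \<xi> \<eta>)) \<le>
          pi * ((cmod (g \<xi>))\<^sup>2 / W \<xi> * (N \<xi> \<eta> * W \<eta>) + (cmod (g \<eta>))\<^sup>2 / W \<eta> * (N \<xi> \<eta> * W \<xi>))"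
        by blast
      then have "ennreal (cmod (g \<xi>) * (cmod (g \<eta>) * (2 * pi * N \<xi> \<eta>))) \<le>
          ennreal (pi * ((cmod (g \<xi>))\<^sup>2 / W \<xi> * (N \<xi> \<eta> * W \<eta>) + (cmod (g \<eta>))\<^sup>2 / W \<eta> * (N \<xi> \<eta> * W \<xi>)))"
        by (rule ennreal_leI)
      also have "\<dots> = ennreal pi * (A \<xi> \<eta> + A \<eta> \<xi>)"
      proof -
        have "ennreal (pi * (X * (n * v) + Y * (n * u))) = ennreal pi * (ennreal X * (ennreal n * ennreal v) + ennreal Y * (ennreal n * ennreal u))"
          if "0 \<le> X" "0 \<le> Y" "0 \<le> n" "0 \<le> u" "0 \<le> v" for X Y n u v
          using that by (simp add: ennreal_mult ennreal_plus)
        from this[of "(cmod (g \<xi>))\<^sup>2 / W \<xi>" "(cmod (g \<eta>))\<^sup>2 / W \<eta>" "N \<xi> \<eta>" "W \<xi>" "W \<eta>"] show ?thesis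
          using False Wp N(1) unfolding A_def N(3)[of \<eta> \<xi>] by simp
      qed
      finally show ?thesis using N(1) by (simp add: ennreal_mult)
    qed auto
    have "(\<integral>\<^sup>+ t. ennreal (w t * (cmod (F t))\<^sup>2) \<partial>lborel) = ennreal (LINT t|lborel. w t * (cmod (F t))\<^sup>2)"
      using int2 wpos unfolding sq complex_of_real_integrable_eq by (intro nn_integral_eq_integral) auto
    also have "\<dots> \<le> ennreal (cmod (complex_of_real (LINT t|lborel. w t * (cmod (F t))\<^sup>2)))"
      by (intro ennreal_leI) simp
    also have "\<dots> \<le> (\<integral>\<^sup>+ \<xi>. ennreal (cmod (g \<xi> * (LINT \<eta>|lborel. cnj (g \<eta>) * complex_of_real (2 * pi * normal_density 0 e (\<omega> \<xi> - \<omega> \<eta>))))) \<partial>lborel)"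
      unfolding eq by (rule norm_integral_le_nn_integral)
    also have "\<dots> \<le> (\<integral>\<^sup>+ \<xi>. ennreal (cmod (g \<xi>)) * (\<integral>\<^sup>+ \<eta>. ennreal (cmod (g \<eta>) * (2 * pi * N \<xi> \<eta>)) \<partial>lborel) \<partial>lborel)"
    proof (rule nn_integral_mono)
      fix \<xi>
      show "ennreal (cmod (g \<xi> * (LINT \<eta>|lborel. cnj (g \<eta>) * complex_of_real (2 * pi * normal_density 0 e (\<omega> \<xi> - \<omega> \<eta>)))))
        \<le> ennreal (cmod (g \<xi>)) * (\<integral>\<^sup>+ \<eta>. ennreal (cmod (g \<eta>) * (2 * pi * N \<xi> \<eta>)) \<partial>lborel)"
      proof -
        have "cmod (cnj (g \<eta>) * complex_of_real (2 * pi * N \<xi> \<eta>)) = cmod (g \<eta>) * (2 * pi * N \<xi> \<eta>)" for \<eta>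
          using N(1)[of \<xi> \<eta>] by (simp add: norm_mult)
        then have "ennreal (cmod (LINT \<eta>|lborel. cnj (g \<eta>) * complex_of_real (2 * pi * N \<xi> \<eta>))) \<le> (\<integral>\<^sup>+ \<eta>. ennreal (cmod (g \<eta>) * (2 * pi * N \<xi> \<eta>)) \<partial>lborel)"
          using norm_integral_le_nn_integral[of lborel "\<lambda>\<eta>. cnj (g \<eta>) * complex_of_real (2 * pi * N \<xi> \<eta>)"] by (simp only:)
        then show ?thesis
          unfolding norm_mult[of "g \<xi>"] N_def ennreal_mult[OF norm_ge_zero norm_ge_zero] by (rule mult_left_mono) simp
      qed
    qed
    also have "\<dots> = (\<integral>\<^sup>+ \<xi>. (\<integral>\<^sup>+ \<eta>. ennreal (cmod (g \<xi>)) * ennreal (cmod (g \<eta>) * (2 * pi * N \<xi> \<eta>)) \<partial>lborel) \<partial>lborel)"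
      by (subst nn_integral_cmult) auto
    also have "\<dots> \<le> (\<integral>\<^sup>+ \<xi>. (\<integral>\<^sup>+ \<eta>. ennreal pi * (A \<xi> \<eta> + A \<eta> \<xi>) \<partial>lborel) \<partial>lborel)"
      by (intro nn_integral_mono pw)
    also have "\<dots> = ennreal pi * ((\<integral>\<^sup>+ \<xi>. (\<integral>\<^sup>+ \<eta>. A \<xi> \<eta> \<partial>lborel) \<partial>lborel) + (\<integral>\<^sup>+ \<xi>. (\<integral>\<^sup>+ \<eta>. A \<eta> \<xi> \<partial>lborel) \<partial>lborel))"
    proof -
      have [measurable]: "(\<lambda>\<xi>. \<integral>\<^sup>+ \<eta>. A \<xi> \<eta> \<partial>lborel) \<in> borel_measurable lborel" "(\<lambda>\<xi>. \<integral>\<^sup>+ \<eta>. A \<eta> \<xi> \<partial>lborel) \<in> borel_measurable lborel"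
        by (rule lborel.borel_measurable_nn_integral, simp add: case_prod_beta')+
      show ?thesis by (simp add: nn_integral_cmult nn_integral_add)
    qed
    also have "\<dots> \<le> ennreal pi * (?B + ?B)"
      unfolding swap by (intro mult_left_mono add_mono Ab) auto
    also have "\<dots> = ennreal (2 * pi) * ?B"
    proof -
      have "ennreal (2 * pi) = 2 * ennreal pi" by (subst ennreal_mult) auto
      then show ?thesis by (simp only: mult_2[symmetric] mult.assoc mult.left_commute)
    qed
    finally show ?thesis by (simp add: w_def)
  qed
  \<comment> \<open>The Gaussian weight is removed by Fatou's lemma along widths 1 / (n + 1), since
    the bound \<open>reg\<close> does not depend on the width.\<close>
  have "?L = (\<integral>\<^sup>+ t. liminf (\<lambda>n. ennreal (exp (- (1 / real (Suc n) * t)\<^sup>2 / 2) * (cmod (F t))\<^sup>2)) \<partial>lborel)"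
  proof (rule nn_integral_cong)
    fix t
    have "(\<lambda>n. exp (- (1 / real (Suc n) * t)\<^sup>2 / 2) * (cmod (F t))\<^sup>2) \<longlonglongrightarrow> exp (- (0 * t)\<^sup>2 / 2) * (cmod (F t))\<^sup>2"
      by (intro tendsto_intros LIMSEQ_Suc[OF lim_1_over_n]) simp
    then have "(\<lambda>n. ennreal (exp (- (1 / real (Suc n) * t)\<^sup>2 / 2) * (cmod (F t))\<^sup>2)) \<longlonglongrightarrow> ennreal ((cmod (F t))\<^sup>2)"
      by (intro tendsto_ennrealI) simp
    from lim_imp_Liminf[OF _ this]
    show "ennreal ((cmod (LINT \<xi>|lborel. exp (\<i> * complex_of_real (t * \<omega> \<xi>)) * g \<xi>))\<^sup>2) = liminf (\<lambda>n. ennreal (exp (- (1 / real (Suc n) * t)\<^sup>2 / 2) * (cmod (F t))\<^sup>2))"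
      by (simp add: F_def)
  qed
  also have "\<dots> \<le> liminf (\<lambda>n. \<integral>\<^sup>+ t. ennreal (exp (- (1 / real (Suc n) * t)\<^sup>2 / 2) * (cmod (F t))\<^sup>2) \<partial>lborel)"
    by (intro nn_integral_liminf) auto
  also have "\<dots> \<le> liminf (\<lambda>n. ennreal (2 * pi) * ?B)"
    by (intro Liminf_mono always_eventually allI reg) auto
  finally show ?thesis by (simp add: Liminf_const)
qed

text \<open>\<open>ev g\<close> is the Airy evolution with initial datum of Fourier transform \<open>2 \<pi> g\<close>.\<close>

definition ev :: "(real \<Rightarrow> complex) \<Rightarrow> real \<Rightarrow> real \<Rightarrow> complex" where
  "ev g x t = (LINT \<xi>|lborel. osc x t \<xi> * g \<xi>)"

lemma nn_integral_normal_density: "0 < e \<Longrightarrow> (\<integral>\<^sup>+ y. ennreal (normal_density m e y) \<partial>lborel) = 1"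
  using integral_normal_density integrable_normal_density
  by (subst nn_integral_eq_integral) auto

text \<open>Phase \<xi> and weight 1 in the dual variable x; the unimodular factor with phase t
  \<xi>^3 is absorbed into the datum.\<close>

lemma ev_energy:
  assumes g: "integrable lborel g"
  shows "(\<integral>\<^sup>+ x. ennreal ((cmod (ev g x t))\<^sup>2) \<partial>lborel) \<le> ennreal (2 * pi) * (\<integral>\<^sup>+ \<xi>. ennreal ((cmod (g \<xi>))\<^sup>2) \<partial>lborel)"
proof -
  note [measurable] = borel_measurable_integrable[OF g]
  define h where "h \<xi> = exp (\<i> * complex_of_real (t * \<xi> ^ 3)) * g \<xi>" for \<xi>
  have h: "integrable lborel h" unfolding h_def
    by (rule Bochner_Integration.integrable_bound[OF g]) (auto simp: norm_mult)
  have "(\<integral>\<^sup>+ x. ennreal ((cmod (LINT \<xi>|lborel. exp (\<i> * complex_of_real (x * \<xi>)) * h \<xi>))\<^sup>2) \<partial>lborel)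
    \<le> ennreal (2 * pi) * (\<integral>\<^sup>+ \<xi>. ennreal ((cmod (h \<xi>))\<^sup>2 / 1) \<partial>lborel)"
  proof (rule Plancherel_phase[OF h, where \<omega> = "\<lambda>\<xi>. \<xi>" and W = "\<lambda>_. 1"])
    fix e \<xi> :: real assume "0 < e"
    have "(\<integral>\<^sup>+ \<eta>. ennreal (normal_density \<xi> e \<eta>) * (ennreal 1 * indicator {\<eta>. h \<eta> \<noteq> 0} \<eta>) \<partial>lborel)
      \<le> (\<integral>\<^sup>+ \<eta>. ennreal (normal_density \<xi> e \<eta>) \<partial>lborel)"
      by (intro nn_integral_mono) (auto split: split_indicator)
    with nn_integral_normal_density[OF \<open>0 < e\<close>]
    show "(\<integral>\<^sup>+ \<eta>. ennreal (normal_density \<xi> e \<eta>) * (ennreal 1 * indicator {\<eta>. h \<eta> \<noteq> 0} \<eta>) \<partial>lborel) \<le> 1" by simp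
  qed auto
  moreover have eq: "exp (\<i> * complex_of_real (x * \<xi>)) * h \<xi> = osc x t \<xi> * g \<xi>" for x \<xi>
    by (simp add: h_def mult.assoc[symmetric] exp_add[symmetric] distrib_left)
  moreover have "cmod (h \<xi>) = cmod (g \<xi>)" for \<xi> by (simp add: h_def norm_mult)
  ultimately show ?thesis unfolding ev_def by (simp only: eq div_by_1)
qed

text \<open>Kato's local smoothing, uniformly in x: now t is the dual variable, the phase is \<xi>^3
  and the weight its derivative 3 \<xi>^2. Substituting \<tau> = \<eta>^3 turns the hypothesis
  \<open>key\<close> into the total mass of a normal density. The radius \<open>R\<close> serves
  this substitution and does not enter the bound.\<close>

lemma ev_smoothing:
  assumes g: "integrable lborel g" and supp: "\<And>\<xi>. g \<xi> \<noteq> 0 \<Longrightarrow> \<xi> \<noteq> 0 \<and> \<bar>\<xi>\<bar> \<le> R" and R: "0 < R"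
  shows "(\<integral>\<^sup>+ t. ennreal ((cmod (ev g x t))\<^sup>2) \<partial>lborel) \<le> ennreal (2 * pi) * (\<integral>\<^sup>+ \<xi>. ennreal ((cmod (g \<xi>))\<^sup>2 / (3 * \<xi>\<^sup>2)) \<partial>lborel)"
proof -
  note [measurable] = borel_measurable_integrable[OF g]
  define h where "h \<xi> = exp (\<i> * complex_of_real (x * \<xi>)) * g \<xi>" for \<xi>
  have h: "integrable lborel h" unfolding h_def
    by (rule Bochner_Integration.integrable_bound[OF g]) (auto simp: norm_mult)
  have "(\<integral>\<^sup>+ t. ennreal ((cmod (LINT \<xi>|lborel. exp (\<i> * complex_of_real (t * \<xi> ^ 3)) * h \<xi>))\<^sup>2) \<partial>lborel)
    \<le> ennreal (2 * pi) * (\<integral>\<^sup>+ \<xi>. ennreal ((cmod (h \<xi>))\<^sup>2 / (3 * \<xi>\<^sup>2)) \<partial>lborel)"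
  proof (rule Plancherel_phase[OF h])
    fix e \<xi> :: real assume e: "0 < e"
    have "(\<integral>\<^sup>+ \<eta>. ennreal (normal_density (\<xi> ^ 3) e (\<eta> ^ 3)) * (ennreal (3 * \<eta>\<^sup>2) * indicator {\<eta>. h \<eta> \<noteq> 0} \<eta>) \<partial>lborel)
      \<le> (\<integral>\<^sup>+ \<eta>. ennreal (normal_density (\<xi> ^ 3) e (\<eta> ^ 3) * (3 * \<eta>\<^sup>2) * indicator {-R..R} \<eta>) \<partial>lborel)"
      using supp by (intro nn_integral_mono) (auto simp: h_def ennreal_mult[symmetric] abs_le_iff minus_le_iff split: split_indicator)
    also have "\<dots> = (\<integral>\<^sup>+ \<tau>. ennreal (normal_density (\<xi> ^ 3) e \<tau> * indicator {(-R) ^ 3..R ^ 3} \<tau>) \<partial>lborel)"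
      using R by (intro nn_integral_substitution[symmetric])
        (auto simp: set_borel_measurable_def intro!: derivative_eq_intros continuous_intros)
    also have "\<dots> \<le> (\<integral>\<^sup>+ \<tau>. ennreal (normal_density (\<xi> ^ 3) e \<tau>) \<partial>lborel)"
      by (intro nn_integral_mono) (auto split: split_indicator)
    finally show "(\<integral>\<^sup>+ \<eta>. ennreal (normal_density (\<xi> ^ 3) e (\<eta> ^ 3)) * (ennreal (3 * \<eta>\<^sup>2) * indicator {\<eta>. h \<eta> \<noteq> 0} \<eta>) \<partial>lborel) \<le> 1"
      using nn_integral_normal_density[OF e] by simp
  qed (use supp in \<open>auto simp: h_def\<close>)
  moreover have eq: "exp (\<i> * complex_of_real (t * \<xi> ^ 3)) * h \<xi> = osc x t \<xi> * g \<xi>" for t \<xi>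
    by (simp add: h_def mult.assoc[symmetric] exp_add[symmetric] distrib_left add.commute)
  moreover have "cmod (h \<xi>) = cmod (g \<xi>)" for \<xi> by (simp add: h_def norm_mult)
  ultimately show ?thesis unfolding ev_def by (simp only: eq div_by_1)
qed

section \<open>Square-integrable functions and weak compactness\<close>

definition sqint :: "'a measure \<Rightarrow> ('a \<Rightarrow> complex) \<Rightarrow> bool" where
  "sqint M f \<longleftrightarrow> f \<in> borel_measurable M \<and> integrable M (\<lambda>x. (cmod (f x))\<^sup>2)"

definition n2 :: "'a measure \<Rightarrow> ('a \<Rightarrow> complex) \<Rightarrow> real" where
  "n2 M f = (LINT x|M. (cmod (f x))\<^sup>2)"

definition ip :: "'a measure \<Rightarrow> ('a \<Rightarrow> complex) \<Rightarrow> ('a \<Rightarrow> complex) \<Rightarrow> complex" where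
  "ip M f g = (LINT x|M. cnj (f x) * g x)"

lemma sqint_measurable [measurable_dest]: "sqint M f \<Longrightarrow> f \<in> borel_measurable M"
  by (simp add: sqint_def)

lemma n2_nonneg [simp]: "0 \<le> n2 M f"
  unfolding n2_def by (rule integral_nonneg_AE) simp

lemma sqint_nn_integral: "sqint M f \<Longrightarrow> (\<integral>\<^sup>+ x. ennreal ((cmod (f x))\<^sup>2) \<partial>M) = ennreal (n2 M f)"
  unfolding sqint_def n2_def by (intro nn_integral_eq_integral) auto

lemma sqintI_nn:
  assumes "f \<in> borel_measurable M" "(\<integral>\<^sup>+ x. ennreal ((cmod (f x))\<^sup>2) \<partial>M) \<le> ennreal c"
  shows "sqint M f"
  unfolding sqint_def using assms
  by (auto intro!: integrableI_bounded order.strict_trans1[OF assms(2)])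

lemma n2_le_nn:
  assumes "f \<in> borel_measurable M" "(\<integral>\<^sup>+ x. ennreal ((cmod (f x))\<^sup>2) \<partial>M) \<le> ennreal c" "0 \<le> c"
  shows "n2 M f \<le> c"
  using sqint_nn_integral[OF sqintI_nn[OF assms(1,2)]] assms by simp

lemma sqint_bound:
  assumes "sqint M g" "f \<in> borel_measurable M" "\<And>x. cmod (f x) \<le> cmod (g x)"
  shows "sqint M f"
  unfolding sqint_def using assms
  by (auto simp: sqint_def intro!: Bochner_Integration.integrable_bound[of M "\<lambda>x. (cmod (g x))\<^sup>2"] power_mono)

lemma n2_mono:
  assumes "sqint M g" "sqint M f" "\<And>x. cmod (f x) \<le> cmod (g x)"
  shows "n2 M f \<le> n2 M g"
  unfolding n2_def using assms by (intro integral_mono) (auto simp: sqint_def intro: power_mono)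

lemma sqint_add: 
  assumes "sqint M f" "sqint M g" shows "sqint M (\<lambda>x. f x + g x)"
  unfolding sqint_def
proof
  show "integrable M (\<lambda>x. (cmod (f x + g x))\<^sup>2)"
  proof (rule Bochner_Integration.integrable_bound)
    show "integrable M (\<lambda>x. 2 * (cmod (f x))\<^sup>2 + 2 * (cmod (g x))\<^sup>2)"
      using assms by (auto simp: sqint_def)
    have "(cmod (f x + g x))\<^sup>2 \<le> 2 * (cmod (f x))\<^sup>2 + 2 * (cmod (g x))\<^sup>2" for x
    proof -
      have "(cmod (f x + g x))\<^sup>2 \<le> (cmod (f x) + cmod (g x))\<^sup>2"
        by (intro power_mono norm_triangle_ineq) auto
      also have "\<dots> \<le> 2 * (cmod (f x))\<^sup>2 + 2 * (cmod (g x))\<^sup>2"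
        using sum_squares_bound[of "cmod (f x)" "cmod (g x)"] by (simp add: power2_sum)
      finally show ?thesis .
    qed
    then show "AE x in M. norm ((cmod (f x + g x))\<^sup>2) \<le> norm (2 * (cmod (f x))\<^sup>2 + 2 * (cmod (g x))\<^sup>2)" by simp
  qed (use assms in \<open>auto simp: sqint_def\<close>)
qed (use assms in \<open>auto simp: sqint_def\<close>)

lemma sqint_cmult: "sqint M f \<Longrightarrow> sqint M (\<lambda>x. c * f x)"
  by (auto simp: sqint_def norm_mult power_mult_distrib)

lemma n2_cmult: "n2 M (\<lambda>x. c * f x) = (cmod c)\<^sup>2 * n2 M f"
  by (simp add: n2_def norm_mult power_mult_distrib)

lemma sqint_diff: "sqint M f \<Longrightarrow> sqint M g \<Longrightarrow> sqint M (\<lambda>x. f x - g x)"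
  using sqint_add[of M f "\<lambda>x. -1 * g x"] sqint_cmult[of M g "-1"] by simp

lemma sqint_sum: "finite I \<Longrightarrow> (\<And>i. i \<in> I \<Longrightarrow> sqint M (f i)) \<Longrightarrow> sqint M (\<lambda>x. \<Sum>i\<in>I. f i x)"
  by (induction I rule: finite_induct) (auto intro: sqint_add simp: sqint_def[of M "\<lambda>x. 0"])

lemma sqint_integrable_mult:
  assumes "sqint M f" "sqint M g" shows "integrable M (\<lambda>x. f x * g x)"
proof (rule Bochner_Integration.integrable_bound)
  show "integrable M (\<lambda>x. (cmod (f x))\<^sup>2 + (cmod (g x))\<^sup>2)"
    using assms by (auto simp: sqint_def)
  have "cmod (f x) * cmod (g x) \<le> (cmod (f x))\<^sup>2 + (cmod (g x))\<^sup>2" for x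
    using sum_squares_bound[of "cmod (f x)" "cmod (g x)"]
      mult_nonneg_nonneg[OF norm_ge_zero[of "f x"] norm_ge_zero[of "g x"]] by linarith
  then show "AE x in M. norm (f x * g x) \<le> norm ((cmod (f x))\<^sup>2 + (cmod (g x))\<^sup>2)"
    by (auto simp: norm_mult)
qed (use assms in \<open>auto simp: sqint_def\<close>)

lemma sqint_cnj: "sqint M f \<Longrightarrow> sqint M (\<lambda>x. cnj (f x))"
  unfolding sqint_def
  by (auto intro!: borel_measurable_continuous_on[where f = cnj] continuous_intros)

lemma sqint_integrable_ip: "sqint M f \<Longrightarrow> sqint M g \<Longrightarrow> integrable M (\<lambda>x. cnj (f x) * g x)"
  by (intro sqint_integrable_mult sqint_cnj)

lemma Cauchy_Schwarz_sqint:
  assumes f: "sqint M f" and g: "sqint M g"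
  shows "(cmod (LINT x|M. f x * g x))\<^sup>2 \<le> n2 M f * n2 M g"
proof -
  note [measurable] = sqint_measurable[OF f] sqint_measurable[OF g]
  have "ennreal ((cmod (LINT x|M. f x * g x))\<^sup>2) = (ennreal (cmod (LINT x|M. f x * g x)))\<^sup>2"
    by (simp add: ennreal_power)
  also have "\<dots> \<le> (\<integral>\<^sup>+ x. ennreal (cmod (f x)) * ennreal (cmod (g x)) \<partial>M)\<^sup>2"
    using integral_norm_bound_ennreal[OF sqint_integrable_mult[OF f g]]
    by (intro power_mono) (auto simp: norm_mult ennreal_mult)
  also have "\<dots> \<le> (\<integral>\<^sup>+ x. ennreal (cmod (f x)) ^ 2 \<partial>M) * (\<integral>\<^sup>+ x. ennreal (cmod (g x)) ^ 2 \<partial>M)"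
    by (rule Cauchy_Schwarz_nn_integral) auto
  also have "\<dots> = ennreal (n2 M f * n2 M g)"
    by (simp add: ennreal_power sqint_nn_integral[OF f] sqint_nn_integral[OF g] ennreal_mult)
  finally show ?thesis by (simp add: ennreal_le_iff)
qed

lemma ip_bound:
  assumes "sqint M f" "sqint M g" shows "cmod (ip M f g) \<le> sqrt (n2 M f) * sqrt (n2 M g)"
proof -
  have "n2 M (\<lambda>x. cnj (f x)) = n2 M f" by (simp add: n2_def)
  then have "(cmod (ip M f g))\<^sup>2 \<le> n2 M f * n2 M g"
    unfolding ip_def using Cauchy_Schwarz_sqint[OF sqint_cnj[OF assms(1)] assms(2)] by simp
  then show ?thesis by (simp add: real_le_rsqrt real_sqrt_mult[symmetric])
qed

lemma ip_add_right: "sqint M f \<Longrightarrow> sqint M g \<Longrightarrow> sqint M h \<Longrightarrow> ip M f (\<lambda>x. g x + h x) = ip M f g + ip M f h"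
  unfolding ip_def by (simp add: distrib_left sqint_integrable_ip)

lemma ip_diff_right: "sqint M f \<Longrightarrow> sqint M g \<Longrightarrow> sqint M h \<Longrightarrow> ip M f (\<lambda>x. g x - h x) = ip M f g - ip M f h"
  unfolding ip_def by (simp add: right_diff_distrib sqint_integrable_ip)

lemma ip_cmult_right: "ip M f (\<lambda>x. c * g x) = c * ip M f g"
  unfolding ip_def by (simp add: mult.left_commute)

lemma ip_commute: "ip M f g = cnj (ip M g f)"
  unfolding ip_def by (simp add: Bochner_Integration.integral_cnj[symmetric] mult.commute del: Bochner_Integration.integral_cnj)

lemma ip_self: "ip M f f = complex_of_real (n2 M f)"
  unfolding ip_def n2_def
  by (simp only: complex_norm_square mult.commute[of "cnj _"] integral_complex_of_real[symmetric])

lemma n2_diff: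
  assumes "sqint M f" "sqint M g"
  shows "n2 M (\<lambda>x. f x - g x) = n2 M f - 2 * Re (ip M g f) + n2 M g"
proof -
  have "n2 M (\<lambda>x. f x - g x) = (LINT x|M. (cmod (f x))\<^sup>2 - 2 * Re (cnj (g x) * f x) + (cmod (g x))\<^sup>2)"
    unfolding n2_def by (intro Bochner_Integration.integral_cong refl) (simp only: cmod_power2, simp add: power2_eq_square algebra_simps)
  also have "\<dots> = n2 M f - 2 * Re (ip M g f) + n2 M g"
  proof -
    have i: "integrable M (\<lambda>x. cnj (g x) * f x)" using assms by (intro sqint_integrable_ip)
    have "(LINT x|M. Re (cnj (g x) * f x)) = Re (ip M g f)"
      unfolding ip_def using integral_Re[OF i] .
    moreover have "integrable M (\<lambda>x. Re (cnj (g x) * f x))" using integrable_Re[OF i] .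
    ultimately show ?thesis using assms unfolding n2_def sqint_def
      by (simp only: Bochner_Integration.integral_add Bochner_Integration.integral_diff integrable_mult_right
          Bochner_Integration.integrable_diff integral_mult_right_zero)
  qed
  finally show ?thesis .
qed

lemma parallelogram_n2:
  assumes "sqint M f" "sqint M g"
  shows "n2 M (\<lambda>x. f x - g x) = 2 * n2 M f + 2 * n2 M g - 4 * n2 M (\<lambda>x. (f x + g x) / 2)"
proof -
  have s: "sqint M (\<lambda>x. f x + g x)" using assms by (rule sqint_add)
  have "n2 M (\<lambda>x. f x - g x) = (LINT x|M. 2 * (cmod (f x))\<^sup>2 + 2 * (cmod (g x))\<^sup>2 - (cmod (f x + g x))\<^sup>2)"
    unfolding n2_def by (intro Bochner_Integration.integral_cong refl) (simp only: cmod_power2, simp add: power2_eq_square algebra_simps)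
  also have "\<dots> = 2 * n2 M f + 2 * n2 M g - n2 M (\<lambda>x. f x + g x)"
    using assms s unfolding n2_def sqint_def by simp
  also have "n2 M (\<lambda>x. f x + g x) = 4 * n2 M (\<lambda>x. (f x + g x) / 2)"
    using n2_cmult[of M "1/2" "\<lambda>x. f x + g x"] by (simp add: power_divide)
  finally show ?thesis .
qed

lemma sqrt_n2_triangle:
  assumes "sqint M f" "sqint M g"
  shows "sqrt (n2 M (\<lambda>x. f x + g x)) \<le> sqrt (n2 M f) + sqrt (n2 M g)"
proof -
  have g: "sqint M (\<lambda>x. -1 * g x)" by (rule sqint_cmult[OF assms(2)])
  have "n2 M (\<lambda>x. f x + g x) = n2 M f + 2 * Re (ip M g f) + n2 M g"
    using n2_diff[OF assms(1) g] n2_cmult[of M "-1" g]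
    by (simp add: ip_commute[of M "\<lambda>x. - g x"] ip_cmult_right[of M f "-1" g, simplified] ip_commute[of M g f])
  also have "\<dots> \<le> n2 M f + 2 * (sqrt (n2 M g) * sqrt (n2 M f)) + n2 M g"
    using ip_bound[OF assms(2,1)] complex_Re_le_cmod[of "ip M g f"] by simp
  also have "\<dots> = (sqrt (n2 M f) + sqrt (n2 M g))\<^sup>2" by (simp add: power2_sum)
  finally show ?thesis by (intro real_le_lsqrt) auto
qed

section \<open>Completeness and weak sequential compactness of L^2\<close>

lemma n2_diff_swap: "n2 M (\<lambda>x. f x - g x) = n2 M (\<lambda>x. g x - f x)"
  by (simp add: n2_def norm_minus_commute)

text \<open>Riesz-Fischer. A subsequence whose consecutive differences have squared norm below
  16^(-k) makes the sum of 4^k d_k^2 integrable. Thus d_k is almost everywhere at most a multiple of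
  2^(-k), the subsequence converges, and Fatou's lemma returns to the full sequence.\<close>

theorem sqint_complete:
  assumes g: "\<And>n. sqint M (g n)"
    and Cauchy: "\<And>e. 0 < e \<Longrightarrow> \<exists>N. \<forall>m\<ge>N. \<forall>n\<ge>N. n2 M (\<lambda>x. g m x - g n x) < e"
  obtains f where "sqint M f" "(\<lambda>n. n2 M (\<lambda>x. g n x - f x)) \<longlonglongrightarrow> 0"
proof -
  have [measurable]: "g n \<in> borel_measurable M" for n using g by (rule sqint_measurable)
  have "\<exists>N>K. \<forall>m\<ge>N. \<forall>n\<ge>N. n2 M (\<lambda>x. g m x - g n x) < (1 / 16) ^ k" for k K
  proof -
    obtain N where "\<forall>m\<ge>N. \<forall>n\<ge>N. n2 M (\<lambda>x. g m x - g n x) < (1 / 16) ^ k"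
      using Cauchy[of "(1 / 16) ^ k"] by auto
    then show ?thesis by (intro exI[of _ "max N (Suc K)"]) auto
  qed
  then have "\<forall>k K. \<exists>N. K < N \<and> (\<forall>m\<ge>N. \<forall>n\<ge>N. n2 M (\<lambda>x. g m x - g n x) < (1 / 16) ^ k)" by blast
  then obtain F where F: "\<forall>k K. K < F k K \<and> (\<forall>m\<ge>F k K. \<forall>n\<ge>F k K. n2 M (\<lambda>x. g m x - g n x) < (1 / 16) ^ k)"
    unfolding choice_iff by blast
  define r where "r = rec_nat (F 0 0) (\<lambda>k rk. F (Suc k) rk)"
  have r_simps: "r 0 = F 0 0" "r (Suc k) = F (Suc k) (r k)" for k by (simp_all add: r_def)
  have r_mono: "strict_mono r" using F by (auto simp: strict_mono_Suc_iff r_simps)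
  have r: "n2 M (\<lambda>x. g m x - g n x) < (1 / 16) ^ k" if "m \<ge> r k" "n \<ge> r k" for k m n
  proof (cases k)
    case 0
    then show ?thesis using that F[rule_format, of 0 0] by (simp add: r_simps)
  next
    case (Suc l)
    then show ?thesis using that F[rule_format, of "r l" "Suc l"] by (simp only: r_simps)
  qed
  define d where "d k x = cmod (g (r (Suc k)) x - g (r k) x)" for k x
  have [measurable]: "d k \<in> borel_measurable M" for k unfolding d_def by measurable
  have "(\<integral>\<^sup>+ x. (\<Sum>k. ennreal (4 ^ k * (d k x)\<^sup>2)) \<partial>M) = (\<Sum>k. \<integral>\<^sup>+ x. ennreal (4 ^ k * (d k x)\<^sup>2) \<partial>M)"
    by (intro nn_integral_suminf) auto
  also have "\<dots> \<le> (\<Sum>k. ennreal ((1 / 4) ^ k))"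
  proof (intro suminf_le)
    fix k
    have "(\<integral>\<^sup>+ x. ennreal (4 ^ k * (d k x)\<^sup>2) \<partial>M) = ennreal (4 ^ k) * ennreal (n2 M (\<lambda>x. g (r (Suc k)) x - g (r k) x))"
      unfolding sqint_nn_integral[OF sqint_diff[OF g g], symmetric] d_def
      by (subst nn_integral_cmult[symmetric]) (auto simp: ennreal_mult)
    also have "\<dots> \<le> ennreal (4 ^ k) * ennreal ((1 / 16) ^ k)"
      using r[of k "r (Suc k)" "r k"] strict_mono_less_eq[OF r_mono]
      by (intro mult_left_mono ennreal_leI) auto
    also have "\<dots> = ennreal ((1 / 4) ^ k)"
      by (simp add: ennreal_mult[symmetric] power_mult_distrib[symmetric])
    finally show "(\<integral>\<^sup>+ x. ennreal (4 ^ k * (d k x)\<^sup>2) \<partial>M) \<le> ennreal ((1 / 4) ^ k)" .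
  qed auto
  also have "\<dots> < \<infinity>"
    by (subst suminf_ennreal2) (auto intro!: summable_geometric)
  finally have "(\<integral>\<^sup>+ x. (\<Sum>k. ennreal (4 ^ k * (d k x)\<^sup>2)) \<partial>M) \<noteq> \<infinity>" by simp
  then have "AE x in M. (\<Sum>k. ennreal (4 ^ k * (d k x)\<^sup>2)) \<noteq> \<infinity>"
    by (intro nn_integral_PInf_AE) auto
  then have conv: "AE x in M. convergent (\<lambda>k. g (r k) x)"
  proof eventually_elim
    case (elim x)
    have "\<exists>C. S = ennreal C \<and> 0 \<le> C" if "S \<noteq> \<infinity>" for S using that by (cases S) auto
    from this[OF elim] obtain C where C: "(\<Sum>k. ennreal (4 ^ k * (d k x)\<^sup>2)) = ennreal C" "0 \<le> C"
      by blast
    have db: "d k x \<le> sqrt C * (1 / 2) ^ k" for k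
    proof -
      have "ennreal (4 ^ k * (d k x)\<^sup>2) = (\<Sum>k\<in>{k}. ennreal (4 ^ k * (d k x)\<^sup>2))" by simp
      also have "\<dots> \<le> ennreal C"
        unfolding C(1)[symmetric] by (intro sum_le_suminf) auto
      finally have "4 ^ k * (d k x)\<^sup>2 \<le> C" using C(2) by (simp add: ennreal_le_iff)
      then have "(2 ^ k * d k x)\<^sup>2 \<le> C"
        by (simp add: power_mult_distrib power_mult[symmetric] mult.commute[of k 2] power_mult)
      then have "2 ^ k * d k x \<le> sqrt C" by (rule real_le_rsqrt)
      then show ?thesis by (simp add: power_one_over field_simps)
    qed
    have "summable (\<lambda>k. g (r (Suc k)) x - g (r k) x)"
    proof (rule summable_norm_cancel, rule summable_comparison_test)
      show "\<exists>N. \<forall>n\<ge>N. norm (norm (g (r (Suc n)) x - g (r n) x)) \<le> sqrt C * (1 / 2) ^ n"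
        using db by (auto simp: d_def)
      show "summable (\<lambda>n. sqrt C * (1 / 2) ^ n)" by (intro summable_mult summable_geometric) auto
    qed
    then have "convergent (\<lambda>n. \<Sum>k<n. g (r (Suc k)) x - g (r k) x)"
      by (simp add: summable_iff_convergent)
    moreover have "(\<Sum>k<n. g (r (Suc k)) x - g (r k) x) = g (r n) x - g (r 0) x" for n
      by (rule sum_lessThan_telescope)
    ultimately have "convergent (\<lambda>n. g (r n) x - g (r 0) x)" by simp
    then show ?case by (simp add: convergent_diff_const_right_iff)
  qed
  define f where "f x = lim (\<lambda>k. g (r k) x)" for x
  have [measurable]: "f \<in> borel_measurable M" unfolding f_def by measurable
  have lim: "AE x in M. (\<lambda>k. g (r k) x) \<longlonglongrightarrow> f x"
    using conv by eventually_elim (simp add: f_def convergent_LIMSEQ_iff)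
  have bound: "(\<integral>\<^sup>+ x. ennreal ((cmod (g n x - f x))\<^sup>2) \<partial>M) \<le> ennreal e"
    if N: "\<forall>m\<ge>N. \<forall>n\<ge>N. n2 M (\<lambda>x. g m x - g n x) < e" "n \<ge> N" for e n N
  proof -
    have "(\<integral>\<^sup>+ x. ennreal ((cmod (g n x - f x))\<^sup>2) \<partial>M) \<le> (\<integral>\<^sup>+ x. liminf (\<lambda>k. ennreal ((cmod (g n x - g (r k) x))\<^sup>2)) \<partial>M)"
    proof (rule nn_integral_mono_AE, use lim in eventually_elim)
      case (elim x)
      have "(\<lambda>k. ennreal ((cmod (g n x - g (r k) x))\<^sup>2)) \<longlonglongrightarrow> ennreal ((cmod (g n x - f x))\<^sup>2)"
        by (intro tendsto_intros elim)
      from lim_imp_Liminf[OF _ this] show ?case by simp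
    qed
    also have "\<dots> \<le> liminf (\<lambda>k. \<integral>\<^sup>+ x. ennreal ((cmod (g n x - g (r k) x))\<^sup>2) \<partial>M)"
      by (intro nn_integral_liminf) auto
    also have "\<dots> \<le> liminf (\<lambda>k. ennreal e)"
    proof (rule Liminf_mono)
      have "r k \<ge> N" if "k \<ge> N" for k using seq_suble[OF r_mono, of k] that by simp
      then have "\<forall>k\<ge>N. (\<integral>\<^sup>+ x. ennreal ((cmod (g n x - g (r k) x))\<^sup>2) \<partial>M) \<le> ennreal e"
        using N by (auto simp: sqint_nn_integral[OF sqint_diff[OF g g]] intro!: ennreal_leI intro: less_imp_le)
      then show "\<forall>\<^sub>F k in sequentially. (\<integral>\<^sup>+ x. ennreal ((cmod (g n x - g (r k) x))\<^sup>2) \<partial>M) \<le> ennreal e"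
        by (auto simp: eventually_sequentially)
    qed
    finally show ?thesis by (simp add: Liminf_const)
  qed
  obtain N1 where "\<forall>m\<ge>N1. \<forall>n\<ge>N1. n2 M (\<lambda>x. g m x - g n x) < 1" using Cauchy[of 1] by auto
  from bound[OF this order_refl] have "sqint M (\<lambda>x. g N1 x - f x)" by (intro sqintI_nn[where c = 1]) auto
  from sqint_diff[OF g[of N1] this] have f: "sqint M f" by simp
  show ?thesis
  proof (rule that[OF f], rule LIMSEQ_I)
    fix e :: real assume e: "0 < e"
    obtain N where N: "\<forall>m\<ge>N. \<forall>n\<ge>N. n2 M (\<lambda>x. g m x - g n x) < e / 2" using Cauchy[of "e / 2"] e by auto
    have "n2 M (\<lambda>x. g n x - f x) \<le> e / 2" if "n \<ge> N" for n
      using bound[OF N that] e by (intro n2_le_nn) auto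
    moreover have "e / 2 < e" using e by simp
    ultimately have "n2 M (\<lambda>x. g n x - f x) < e" if "n \<ge> N" for n
      using that order.strict_trans1 by blast
    then show "\<exists>no. \<forall>n\<ge>no. norm (n2 M (\<lambda>x. g n x - f x) - 0) < e"
      by (intro exI[of _ N]) simp
  qed
qed

text \<open>Convex combinations of the tail \<open>h N, h (N + 1), \<dots>\<close>; closure under midpoints is all that the
  parallelogram argument for the nearly minimal elements needs.\<close>

inductive midhull :: "(nat \<Rightarrow> 'a \<Rightarrow> complex) \<Rightarrow> nat \<Rightarrow> ('a \<Rightarrow> complex) \<Rightarrow> bool" for h N where
  base: "N \<le> n \<Longrightarrow> midhull h N (h n)"
| mid: "midhull h N f \<Longrightarrow> midhull h N g \<Longrightarrow> midhull h N (\<lambda>x. (f x + g x) / 2)"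

lemma midhull_antimono: "midhull h N f \<Longrightarrow> K \<le> N \<Longrightarrow> midhull h K f"
  by (induction rule: midhull.induct) (auto intro: midhull.intros)

lemma midhull_sqint: "midhull h N f \<Longrightarrow> (\<And>n. sqint M (h n)) \<Longrightarrow> sqint M f"
proof (induction rule: midhull.induct)
  case (mid f g)
  then show ?case using sqint_cmult[OF sqint_add, of M f g "1/2"] by simp
qed auto

text \<open>Plays the role of the Riesz representation theorem. The minimal norms over the hulls of
  the tails increase and stay below C, so near-minimisers form a Cauchy sequence by the
  parallelogram law. Its strong limit inherits every limit of pairings, because such limits survive
  midpoints of the tail.\<close>

lemma weak_limit_candidate:
  assumes h: "\<And>n. sqint M (h n)" and C: "\<And>n. n2 M (h n) \<le> C"
  obtains f where "sqint M f" "\<And>e l. sqint M e \<Longrightarrow> (\<lambda>n. ip M e (h n)) \<longlonglongrightarrow> l \<Longrightarrow> ip M e f = l"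
proof -
  define S where "S N = {n2 M f | f. midhull h N f}" for N
  have ne: "S N \<noteq> {}" for N using midhull.base[of N N h] by (auto simp: S_def)
  have bdd: "bdd_below (S N)" for N by (auto simp: S_def intro!: bdd_belowI[of _ 0])
  define d where "d N = Inf (S N)" for N
  have d_le: "d N \<le> n2 M f" if "midhull h N f" for f N
    unfolding d_def using that bdd by (intro cInf_lower) (auto simp: S_def)
  have d_mono: "incseq d"
  proof (rule monoI)
    fix m n :: nat assume "m \<le> n"
    then show "d m \<le> d n" unfolding d_def
      by (intro cInf_superset_mono ne bdd) (auto simp: S_def dest: midhull_antimono)
  qed
  have "d n \<le> C" for n using d_le[OF midhull.base[OF order_refl]] C order_trans by blast
  then obtain L where "d \<longlonglongrightarrow> L" using incseq_convergent[OF d_mono, of C] by blast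
  then have "convergent d" by (rule convergentI)
  then have d_Cauchy: "Cauchy d" by (rule convergent_Cauchy)
  have "\<exists>f. midhull h N f \<and> n2 M f < d N + 1 / real (Suc N)" for N
  proof -
    have "Inf (S N) < d N + 1 / real (Suc N)" by (simp add: d_def)
    then obtain y where "y \<in> S N" "y < d N + 1 / real (Suc N)"
      using cInf_lessD[OF ne] by blast
    then show ?thesis by (auto simp: S_def)
  qed
  then obtain g where g: "\<And>N. midhull h N (g N)" "\<And>N. n2 M (g N) < d N + 1 / real (Suc N)" by metis
  have gs: "sqint M (g N)" for N using midhull_sqint[OF g(1) h] .
  \<comment> \<open>For m <= n the midpoint of \<open>g m\<close> and \<open>g n\<close> lies in the
    hull of the m-th tail, so its squared norm is at least \<open>d m\<close>; the parallelogram law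
    converts this into a bound for the difference.\<close>
  have step: "n2 M (\<lambda>x. g m x - g n x) \<le> 2 * (d n - d m) + 4 / real (Suc m)" if "m \<le> n" for m n
  proof -
    have "d m \<le> n2 M (\<lambda>x. (g m x + g n x) / 2)"
      using that by (intro d_le midhull.mid g(1) midhull_antimono[OF g(1)])
    moreover define a b where "a = 1 / real (Suc m)" and "b = 1 / real (Suc n)"
    moreover have "b \<le> a" unfolding a_def b_def using that by (simp add: frac_le)
    moreover have "4 / real (Suc m) = 4 * a" by (simp add: a_def)
    ultimately show ?thesis
      using parallelogram_n2[OF gs[of m] gs[of n]] g(2)[of m] g(2)[of n] by simp
  qed
  have "\<exists>N. \<forall>m\<ge>N. \<forall>n\<ge>N. n2 M (\<lambda>x. g m x - g n x) < e" if e: "0 < e" for e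
  proof -
    obtain N1 where N1: "\<And>m n. m \<ge> N1 \<Longrightarrow> n \<ge> N1 \<Longrightarrow> \<bar>d m - d n\<bar> < e / 4"
      using d_Cauchy e unfolding Cauchy_def dist_real_def by (metis divide_pos_pos zero_less_numeral)
    obtain N2 where N2: "real N2 > 8 / e" using reals_Archimedean2 by blast
    have *: "n2 M (\<lambda>x. g m x - g n x) < e" if "m \<ge> max N1 N2" "m \<le> n" for m n
    proof -
      have "real (Suc m) > 8 / e" using N2 that by simp
      then have "4 / real (Suc m) < e / 2" using e by (simp add: field_simps)
      moreover have "\<bar>d n - d m\<bar> < e / 4" using N1[of n m] that by auto
      moreover have "y \<le> 2 * D + c \<Longrightarrow> c < e / 2 \<Longrightarrow> \<bar>D\<bar> < e / 4 \<Longrightarrow> y < e" for y D c :: real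
        by linarith
      ultimately show ?thesis using step[OF that(2)] by blast
    qed
    then show ?thesis using n2_diff_swap[of M] by (intro exI[of _ "max N1 N2"]) (metis nle_le)
  qed
  from sqint_complete[OF gs this] obtain f where f: "sqint M f" "(\<lambda>n. n2 M (\<lambda>x. g n x - f x)) \<longlonglongrightarrow> 0"
    by blast
  show ?thesis
  proof (rule that[OF f(1)])
    fix e l assume e: "sqint M e" and l: "(\<lambda>n. ip M e (h n)) \<longlonglongrightarrow> l"
    have "(\<lambda>n. ip M e (g n)) \<longlonglongrightarrow> l"
    proof (rule LIMSEQ_I)
      fix \<epsilon> :: real assume \<epsilon>: "0 < \<epsilon>"
      obtain N where N: "\<And>n. n \<ge> N \<Longrightarrow> cmod (ip M e (h n) - l) < \<epsilon>" using LIMSEQ_D[OF l \<epsilon>] by blast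
      \<comment> \<open>A ball around \<open>l\<close> is convex, so the estimate passes from the
        tail of \<open>h\<close> to its midpoint hull by induction.\<close>
      have *: "cmod (ip M e u - l) < \<epsilon>" if "midhull h N u" for u
        using that
      proof (induction rule: midhull.induct)
        case (mid u v)
        have uv: "sqint M u" "sqint M v" using mid midhull_sqint h by blast+
        have "ip M e (\<lambda>x. (u x + v x) / 2) = (ip M e u + ip M e v) / 2"
          using ip_cmult_right[of M e "1/2" "\<lambda>x. u x + v x"] ip_add_right[OF e uv] by simp
        then have "ip M e (\<lambda>x. (u x + v x) / 2) - l = ((ip M e u - l) + (ip M e v - l)) / 2"
          by (simp add: field_simps)
        then have "cmod (ip M e (\<lambda>x. (u x + v x) / 2) - l) = cmod ((ip M e u - l) + (ip M e v - l)) / 2"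
          by (simp only: norm_divide) simp
        also have "\<dots> \<le> (cmod (ip M e u - l) + cmod (ip M e v - l)) / 2"
          by (intro divide_right_mono norm_triangle_ineq) auto
        also have "\<dots> < \<epsilon>" using mid.IH by simp
        finally show ?case .
      qed (use N in auto)
      then show "\<exists>no. \<forall>n\<ge>no. norm (ip M e (g n) - l) < \<epsilon>"
        using midhull_antimono[OF g(1)] by blast
    qed
    moreover have "(\<lambda>n. ip M e (g n)) \<longlonglongrightarrow> ip M e f"
    proof (rule Lim_transform2[OF tendsto_const], rule tendsto_0_le[where K = 1])
      show "(\<lambda>n. sqrt (n2 M e) * sqrt (n2 M (\<lambda>x. g n x - f x))) \<longlonglongrightarrow> 0"
        using tendsto_mult_right_zero[OF tendsto_real_sqrt[OF f(2), simplified]] by simp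
      show "\<forall>\<^sub>F n in sequentially. norm (ip M e f - ip M e (g n)) \<le> norm (sqrt (n2 M e) * sqrt (n2 M (\<lambda>x. g n x - f x))) * 1"
        using ip_bound[OF e sqint_diff[OF gs f(1)]]
        by (intro always_eventually allI) (simp add: ip_diff_right[OF e gs f(1)] norm_minus_commute abs_mult)
    qed
    ultimately show "ip M e f = l" by (rule LIMSEQ_unique[symmetric])
  qed
qed

text \<open>A diagonal subsequence makes all pairings with members of the sequence converge, and
  \<open>weak_limit_candidate\<close> provides f. If some pairing failed to converge to the value at
  f, a further subsequence would produce a second candidate f'. The two candidates turn out to be
  equal in L^2, a contradiction.\<close>

theorem weak_compactness:
  fixes h :: "nat \<Rightarrow> 'a \<Rightarrow> complex"
  assumes h: "\<And>n. sqint M (h n)" and C: "\<And>n. n2 M (h n) \<le> C"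
  obtains r f where "strict_mono r" "sqint M f" "\<And>e. sqint M e \<Longrightarrow> (\<lambda>n. ip M e (h (r n))) \<longlonglongrightarrow> ip M e f"
proof -
  have C0: "0 \<le> C" using C[of 0] n2_nonneg[of M "h 0"] by linarith
  have bdd: "bounded (range (\<lambda>n. ip M e (h (s n))))" if "sqint M e" for e and s :: "nat \<Rightarrow> nat"
  proof (rule boundedI)
    fix z assume "z \<in> range (\<lambda>n. ip M e (h (s n)))"
    then obtain n where "z = ip M e (h (s n))" by auto
    then have "norm z \<le> sqrt (n2 M e) * sqrt (n2 M (h (s n)))" using ip_bound[OF that h] by simp
    also have "\<dots> \<le> sqrt (n2 M e) * sqrt C" using C by (intro mult_left_mono) auto
    finally show "norm z \<le> sqrt (n2 M e) * sqrt C" .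
  qed
  \<comment> \<open>Only pairings with the members \<open>h m\<close> are diagonalised; this
    countable family takes the place of a dense subset of L^2.\<close>
  interpret subseqs "\<lambda>m s. convergent (\<lambda>n. ip M (h m) (h (s n)))"
  proof
    fix m and s :: "nat \<Rightarrow> nat" assume "strict_mono s"
    obtain l r where "strict_mono r" "((\<lambda>n. ip M (h m) (h (s n))) \<circ> r) \<longlonglongrightarrow> l"
      using bounded_imp_convergent_subsequence[OF bdd[OF h]] by blast
    then show "\<exists>r'. strict_mono r' \<and> convergent (\<lambda>n. ip M (h m) (h ((s \<circ> r') n)))"
      by (auto simp: convergent_def o_def)
  qed
  define r where "r = diagseq"
  have r: "strict_mono r" unfolding r_def by (rule subseq_diagseq)
  have conv: "convergent (\<lambda>n. ip M (h m) (h (r n)))" for m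
  proof -
    \<comment> \<open>The diagonal sequence is controlled for the m-th pairing from index
      \<open>Suc m\<close> on; the initial segment is discarded afterwards.\<close>
    have "convergent (\<lambda>n. ip M (h m) (h ((diagseq \<circ> (+) (Suc m)) n)))"
    proof (rule diagseq_holds)
      fix r s :: "nat \<Rightarrow> nat" and n
      assume "strict_mono r" "convergent (\<lambda>k. ip M (h n) (h (s k)))"
      then show "convergent (\<lambda>k. ip M (h n) (h ((s \<circ> r) k)))"
        using convergent_subseq_convergent[of "\<lambda>k. ip M (h n) (h (s k))" r] by (simp add: o_def)
    qed
    then have "convergent (\<lambda>n. ip M (h m) (h (r (n + Suc m))))" by (simp add: r_def add.commute)
    then show ?thesis by (rule convergent_ignore_initial_segment[THEN iffD1])
  qed
  obtain f where f: "sqint M f" "\<And>e l. sqint M e \<Longrightarrow> (\<lambda>n. ip M e (h (r n))) \<longlonglongrightarrow> l \<Longrightarrow> ip M e f = l"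
    using weak_limit_candidate[of M "\<lambda>n. h (r n)" C] h C by blast
  have "(\<lambda>n. ip M e (h (r n))) \<longlonglongrightarrow> ip M e f" if e: "sqint M e" for e
  proof (rule ccontr)
    assume "\<not> ?thesis"
    then obtain \<epsilon> where \<epsilon>: "0 < \<epsilon>" "\<And>N. \<exists>n\<ge>N. \<epsilon> \<le> cmod (ip M e (h (r n)) - ip M e f)"
      unfolding LIMSEQ_def dist_norm by (meson not_less)
    then have "infinite {n. \<epsilon> \<le> cmod (ip M e (h (r n)) - ip M e f)}"
      unfolding infinite_nat_iff_unbounded_le by auto
    from infinite_enumerate[OF this] obtain s :: "nat \<Rightarrow> nat" where s: "strict_mono s" "\<And>n. \<epsilon> \<le> cmod (ip M e (h (r (s n))) - ip M e f)"
      by blast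
    obtain l s' where s': "strict_mono s'" "((\<lambda>n. ip M e (h (r (s n)))) \<circ> s') \<longlonglongrightarrow> l"
      using bounded_imp_convergent_subsequence[OF bdd[OF e, of "\<lambda>n. r (s n)"]] by auto
    define t where "t n = s (s' n)" for n
    have t: "strict_mono t" using s s' by (auto simp: t_def strict_mono_def)
    obtain f' where f': "sqint M f'" "\<And>e l. sqint M e \<Longrightarrow> (\<lambda>n. ip M e (h (r (t n)))) \<longlonglongrightarrow> l \<Longrightarrow> ip M e f' = l"
      using weak_limit_candidate[of M "\<lambda>n. h (r (t n))" C] h C by blast
    have l: "ip M e f' = l" using f'(2)[OF e] s'(2) by (simp add: o_def t_def)
    define w where "w x = f x - f' x" for x
    have w: "sqint M w" unfolding w_def by (rule sqint_diff[OF f(1) f'(1)])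
    \<comment> \<open>Both candidates pair with \<open>h m\<close> to the same limit
      \<open>c\<close>, so \<open>w\<close> is orthogonal to every \<open>h m\<close>. The sequence
      of pairings with \<open>w\<close> is then constantly 0, and the defining property of the
      candidates makes \<open>w\<close> orthogonal to f and to f', hence to itself.\<close>
    have "ip M (h m) w = 0" for m
    proof -
      obtain c where c: "(\<lambda>n. ip M (h m) (h (r n))) \<longlonglongrightarrow> c" using conv[of m] by (auto simp: convergent_def)
      then have "(\<lambda>n. ip M (h m) (h (r (t n)))) \<longlonglongrightarrow> c" using LIMSEQ_subseq_LIMSEQ[OF c t] by (simp add: o_def)
      then show ?thesis unfolding w_def ip_diff_right[OF h f(1) f'(1)] using f(2)[OF h c] f'(2)[OF h] by simp
    qed
    then have wh: "ip M w (h m) = 0" for m by (subst ip_commute) simp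
    have "ip M w f = 0" "ip M w f' = 0" using f(2)[OF w, of 0] f'(2)[OF w, of 0] by (auto simp: wh)
    then have "ip M w w = 0" using ip_diff_right[OF w f(1) f'(1)] by (simp add: w_def[symmetric])
    then have "n2 M w = 0" by (simp add: ip_self)
    then have "ip M e w = 0" using ip_bound[OF e w] by simp
    then have "ip M e f = l" using ip_diff_right[OF e f(1) f'(1)] l by (simp add: w_def[symmetric])
    moreover have "(\<lambda>n. cmod (ip M e (h (r (t n))) - ip M e f)) \<longlonglongrightarrow> cmod (l - ip M e f)"
      using s'(2) by (intro tendsto_intros) (simp add: o_def t_def)
    then have "\<epsilon> \<le> cmod (l - ip M e f)"
      by (rule LIMSEQ_le_const) (use s(2) in \<open>auto simp: t_def\<close>)
    ultimately show False using \<epsilon>(1) by simp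
  qed
  with r f(1) show ?thesis by (rule that)
qed

section \<open>Estimates at a single frequency scale\<close>

text \<open>Integration by parts against the phase derivative d. Each boundary term costs 1/l. Since
  6 t \<xi> has constant sign on the interval, the modulus of the remainder is exactly the
  derivative of -1/d, so it integrates to at most another 1/l.\<close>

lemma oscillatory_first_derivative:
  fixes a b x t l :: real
  assumes ab: "0 \<le> a" "a \<le> b" and t: "0 < t" and l: "0 < l"
    and D: "(\<forall>\<xi>\<in>{a..b}. l \<le> x + 3 * t * \<xi>\<^sup>2) \<or> (\<forall>\<xi>\<in>{a..b}. x + 3 * t * \<xi>\<^sup>2 \<le> - l)"
  shows "cmod (integral {a..b} (\<lambda>\<xi>. osc x t \<xi>)) \<le> 3 / l"
proof -
  define E where "E \<xi> = osc x t \<xi>" for \<xi>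
  define d where "d \<xi> = x + 3 * t * \<xi>\<^sup>2" for \<xi>
  \<comment> \<open>The boundary term of the integration by parts, as a function of a complex
    variable so that field derivative rules apply; \<open>r\<close> below is the remainder.\<close>
  define G where "G z = exp (\<i> * (complex_of_real x * z + complex_of_real t * z ^ 3)) / (\<i> * (complex_of_real x + 3 * complex_of_real t * z\<^sup>2))" for z
  have dl: "l \<le> \<bar>d \<xi>\<bar>" if "\<xi> \<in> {a..b}" for \<xi> using D that l by (force simp: d_def)
  then have dn: "d \<xi> \<noteq> 0" if "\<xi> \<in> {a..b}" for \<xi> using that l by fastforce
  have E1: "cmod (E \<xi>) = 1" for \<xi> unfolding E_def by (rule norm_exp_i_times)
  define r where "r \<xi> = E \<xi> * complex_of_real (6 * t * \<xi>) / (\<i> * complex_of_real ((d \<xi>)\<^sup>2))" for \<xi>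
  have deriv: "((\<lambda>\<xi>. G (complex_of_real \<xi>)) has_vector_derivative (E \<xi> - r \<xi>)) (at \<xi> within {a..b})" if "\<xi> \<in> {a..b}" for \<xi>
  proof (rule has_vector_derivative_real_field)
    have nz: "complex_of_real x + 3 * complex_of_real t * (complex_of_real \<xi>)\<^sup>2 \<noteq> 0"
    proof -
      have "complex_of_real (d \<xi>) \<noteq> 0" using dn[OF that] by simp
      then show ?thesis by (simp add: d_def)
    qed
    define e where "e = exp (\<i> * (complex_of_real x * complex_of_real \<xi> + complex_of_real t * complex_of_real \<xi> ^ 3))"
    define w where "w = complex_of_real x + 3 * complex_of_real t * (complex_of_real \<xi>)\<^sup>2"
    have "(G has_field_derivative ((e * (\<i> * w)) * (\<i> * w) - e * (\<i> * (6 * complex_of_real t * complex_of_real \<xi>))) / ((\<i> * w) * (\<i> * w))) (at (complex_of_real \<xi>))"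
      unfolding G_def[abs_def] e_def w_def using nz by (auto intro!: derivative_eq_intros) (simp add: algebra_simps)?
    moreover have "((e * (\<i> * w)) * (\<i> * w) - e * (\<i> * (6 * complex_of_real t * complex_of_real \<xi>))) / ((\<i> * w) * (\<i> * w)) = e - e * (6 * complex_of_real t * complex_of_real \<xi>) / (\<i> * w\<^sup>2)"
      using nz unfolding w_def[symmetric] by (simp add: field_simps power2_eq_square)
    moreover have "E \<xi> - r \<xi> = e - e * (6 * complex_of_real t * complex_of_real \<xi>) / (\<i> * w\<^sup>2)"
      by (simp add: E_def r_def e_def w_def d_def)
    ultimately show "(G has_field_derivative (E \<xi> - r \<xi>)) (at (complex_of_real \<xi>))" by simp
  qed
  have int1: "((\<lambda>\<xi>. E \<xi> - r \<xi>) has_integral (G (complex_of_real b) - G (complex_of_real a))) {a..b}"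
    by (rule fundamental_theorem_of_calculus[OF ab(2) deriv])
  have int2: "((\<lambda>\<xi>. 6 * t * \<xi> / (d \<xi>)\<^sup>2) has_integral (- (1 / d b) - (- (1 / d a)))) {a..b}"
  proof (rule fundamental_theorem_of_calculus[OF ab(2)])
    fix \<xi> assume "\<xi> \<in> {a..b}"
    then have "d \<xi> \<noteq> 0" by (rule dn)
    then have "((\<lambda>\<xi>. - (1 / d \<xi>)) has_real_derivative 6 * t * \<xi> / (d \<xi>)\<^sup>2) (at \<xi> within {a..b})"
      unfolding d_def by (auto intro!: derivative_eq_intros simp: power2_eq_square)
    then show "((\<lambda>\<xi>. - (1 / d \<xi>)) has_vector_derivative 6 * t * \<xi> / (d \<xi>)\<^sup>2) (at \<xi> within {a..b})"
      by (simp add: has_real_derivative_iff_has_vector_derivative)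
  qed
  have contE: "continuous_on {a..b} E" unfolding E_def by (intro continuous_intros)
  have contd: "continuous_on {a..b} d" unfolding d_def by (intro continuous_intros)
  have contr: "continuous_on {a..b} r" unfolding r_def
    by (intro continuous_intros contE contd) (use dn in auto)
  have intr: "r integrable_on {a..b}" "E integrable_on {a..b}"
    using contr contE by (auto intro: integrable_continuous_interval)
  have "integral {a..b} E = integral {a..b} (\<lambda>\<xi>. E \<xi> - r \<xi>) + integral {a..b} r"
    using intr by (simp add: integral_diff)
  also have "integral {a..b} (\<lambda>\<xi>. E \<xi> - r \<xi>) = G (complex_of_real b) - G (complex_of_real a)"
    using int1 by (rule integral_unique)
  finally have "cmod (integral {a..b} E) \<le> cmod (G (complex_of_real b)) + cmod (G (complex_of_real a)) + cmod (integral {a..b} r)"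
    by (simp only:) (rule order_trans[OF norm_triangle_ineq add_right_mono[OF norm_triangle_ineq4]])
  moreover have "cmod (G (complex_of_real \<xi>)) \<le> 1 / l" if "\<xi> \<in> {a..b}" for \<xi>
  proof -
    have "G (complex_of_real \<xi>) = E \<xi> / (\<i> * complex_of_real (d \<xi>))"
      by (simp add: G_def E_def d_def)
    then have "cmod (G (complex_of_real \<xi>)) = 1 / \<bar>d \<xi>\<bar>"
      using E1 by (simp add: norm_divide norm_mult)
    then show ?thesis using dl[OF that] l by (simp add: frac_le)
  qed
  then have "cmod (G (complex_of_real b)) \<le> 1 / l" "cmod (G (complex_of_real a)) \<le> 1 / l" using ab by auto
  moreover have "cmod (integral {a..b} r) \<le> - (1 / d b) - (- (1 / d a))"
    unfolding integral_unique[OF int2, symmetric]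
  proof (rule integral_norm_bound_integral)
    fix \<xi> assume "\<xi> \<in> {a..b}"
    then show "norm (r \<xi>) \<le> 6 * t * \<xi> / (d \<xi>)\<^sup>2"
      using ab t E1 by (simp add: r_def norm_divide norm_mult norm_power)
  qed (use intr int2 in auto)
  moreover have "- (1 / d b) - (- (1 / d a)) \<le> 1 / l"
  proof -
    have ends: "a \<in> {a..b}" "b \<in> {a..b}" using ab by auto
    from D have "(l \<le> d a \<and> l \<le> d b) \<or> (d a \<le> - l \<and> d b \<le> - l)"
      using ends unfolding d_def by blast
    then show ?thesis
    proof
      assume "l \<le> d a \<and> l \<le> d b"
      then have "1 / d a \<le> 1 / l" "0 \<le> 1 / d b" using l by (auto intro: divide_left_mono)
      then show ?thesis by linarith
    next
      assume *: "d a \<le> - l \<and> d b \<le> - l"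
      then have "1 / (- d b) \<le> 1 / l" "1 / d a \<le> 0"
        using l by (auto intro!: divide_left_mono mult_pos_pos simp: divide_le_0_iff simp del: divide_minus_right)
      moreover have "1 / (- d b) = - (1 / d b)" by simp
      ultimately show ?thesis by linarith
    qed
  qed
  ultimately show ?thesis by (simp add: E_def[abs_def])
qed

text \<open>Van der Corput's second-derivative bound with threshold l = sqrt (N t). Outside the set
  where the phase derivative is smaller than l the two ends contribute 3/l each. Inside, (e - c) 2 N
  <= e^2 - c^2 <= 2 l / (3 t) bounds the length by 1/l. The total is 7/l.\<close>

lemma oscillatory_band:
  fixes N x t :: real
  assumes N: "0 < N" and t: "0 < t"
  shows "cmod (integral {N..2 * N} (\<lambda>\<xi>. osc x t \<xi>)) \<le> 7 / sqrt (N * t)"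
proof -
  define E where "E \<xi> = osc x t \<xi>" for \<xi>
  define l where "l = sqrt (N * t)"
  have l: "0 < l" "l\<^sup>2 = N * t" using N t by (auto simp: l_def)
  \<comment> \<open>Clamps to [N, 2N] the points where the phase derivative equals -l or l.
    \<open>sqrt\<close> of a negative real is negative, so a threshold that has no real root is
    clamped to \<open>N\<close>.\<close>
  define cl where "cl v = max N (min (2 * N) (sqrt v))" for v
  define c where "c = cl ((- l - x) / (3 * t))"
  define e where "e = cl ((l - x) / (3 * t))"
  have order: "N \<le> c" "c \<le> e" "e \<le> 2 * N"
  proof -
    have "sqrt ((- l - x) / (3 * t)) \<le> sqrt ((l - x) / (3 * t))"
      using l t by (intro real_sqrt_le_mono divide_right_mono) auto
    then show "c \<le> e" unfolding c_def e_def cl_def by (intro max.mono min.mono) auto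
  qed (use N in \<open>auto simp: c_def e_def cl_def\<close>)
  have I: "E integrable_on {u..v}" for u v
    unfolding E_def by (intro integrable_continuous_interval continuous_intros)
  have split: "integral {N..2 * N} E = integral {N..c} E + (integral {c..e} E + integral {e..2 * N} E)"
    using order Henstock_Kurzweil_Integration.integral_combine[of N c "2 * N" E, OF _ _ I]
      Henstock_Kurzweil_Integration.integral_combine[of c e "2 * N" E, OF _ _ I] by simp
  have 1: "cmod (integral {N..c} E) \<le> 3 / l"
  proof (cases "c = N")
    case False
    have c2: "c\<^sup>2 \<le> (- l - x) / (3 * t)"
    proof -
      have *: "c \<le> sqrt ((- l - x) / (3 * t))" using False unfolding c_def cl_def by auto
      then have "c\<^sup>2 \<le> (sqrt ((- l - x) / (3 * t)))\<^sup>2" using order N by (intro power_mono) auto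
      moreover have "0 \<le> (- l - x) / (3 * t)" using * order N by (metis dual_order.trans less_imp_le real_sqrt_ge_0_iff)
      ultimately show ?thesis by simp
    qed
    have "x + 3 * t * \<xi>\<^sup>2 \<le> - l" if "\<xi> \<in> {N..c}" for \<xi>
    proof -
      have "\<xi>\<^sup>2 \<le> c\<^sup>2" using that N by (intro power_mono) auto
      then have "\<xi>\<^sup>2 \<le> (- l - x) / (3 * t)" using c2 by simp
      then show ?thesis using t by (simp add: field_simps)
    qed
    then show ?thesis unfolding E_def using N t l order by (intro oscillatory_first_derivative) auto
  qed (use l in auto)
  have 3: "cmod (integral {e..2 * N} E) \<le> 3 / l"
  proof (cases "e = 2 * N")
    case False
    have e2: "(l - x) / (3 * t) \<le> e\<^sup>2"
    proof -
      have "sqrt ((l - x) / (3 * t)) \<le> e" using False N unfolding e_def cl_def by auto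
      then show ?thesis by (rule sqrt_le_D)
    qed
    have "l \<le> x + 3 * t * \<xi>\<^sup>2" if "\<xi> \<in> {e..2 * N}" for \<xi>
    proof -
      have "e\<^sup>2 \<le> \<xi>\<^sup>2" using that N order by (intro power_mono) auto
      then have "(l - x) / (3 * t) \<le> \<xi>\<^sup>2" using e2 by simp
      then show ?thesis using t by (simp add: field_simps)
    qed
    then show ?thesis unfolding E_def using N t l order by (intro oscillatory_first_derivative) auto
  qed (use l in auto)
  have 2: "cmod (integral {c..e} E) \<le> 1 / l"
  proof -
    have "cmod (integral {c..e} E) \<le> integral {c..e} (\<lambda>_. 1 :: real)"
    proof (rule integral_norm_bound_integral)
      show "norm (E \<xi>) \<le> 1" for \<xi> unfolding E_def norm_exp_i_times by simp
    qed (use I in auto)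
    then have b: "cmod (integral {c..e} E) \<le> e - c" using order by simp
    have "e - c \<le> 1 / l"
    proof (cases "c < e")
      case True
      have "e \<le> sqrt ((l - x) / (3 * t))" using True order unfolding e_def cl_def by auto
      then have e2: "e\<^sup>2 \<le> (l - x) / (3 * t)"
      proof -
        assume *: "e \<le> sqrt ((l - x) / (3 * t))"
        then have "e\<^sup>2 \<le> (sqrt ((l - x) / (3 * t)))\<^sup>2" using order N by (intro power_mono) auto
        moreover have "0 \<le> (l - x) / (3 * t)" using * order N by (metis dual_order.trans less_imp_le real_sqrt_ge_0_iff)
        ultimately show ?thesis by simp
      qed
      have c2: "(- l - x) / (3 * t) \<le> c\<^sup>2"
      proof -
        have "sqrt ((- l - x) / (3 * t)) \<le> c" using True order unfolding c_def cl_def by auto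
        then show ?thesis by (rule sqrt_le_D)
      qed
      have "(e - c) * (2 * N) \<le> (e - c) * (e + c)" using order by (intro mult_left_mono) auto
      also have "\<dots> = e\<^sup>2 - c\<^sup>2" by (simp add: power2_eq_square algebra_simps)
      also have "\<dots> \<le> (l - x) / (3 * t) - (- l - x) / (3 * t)" using e2 c2 by linarith
      also have "\<dots> = 2 * l / (3 * t)" using t by (simp add: field_simps)
      finally have "(e - c) * (N * t) \<le> l / 3" using t by (simp add: field_simps)
      then have "(e - c) * (l * l) \<le> 1 * l" using l by (simp add: power2_eq_square)
      then have "(e - c) * l \<le> 1" using l by (simp only: mult.assoc[symmetric] mult_le_cancel_right_pos)
      then show ?thesis using l by (simp add: field_simps)
    next
      case False
      then have "e = c" using order by simp
      then show ?thesis using l by simp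
    qed
    with b show ?thesis by linarith
  qed
  have "cmod (integral {N..2 * N} E) \<le> 3 / l + (1 / l + 3 / l)"
    unfolding split by (intro order_trans[OF norm_triangle_ineq] add_mono 1 2 3)
  then show ?thesis by (simp add: E_def[abs_def] l_def)
qed


text \<open>Half open, so that the bands at scales 2^j partition the nonzero frequencies.\<close>

definition band :: "real \<Rightarrow> real set" where
  "band N = {\<xi>. N \<le> \<bar>\<xi>\<bar> \<and> \<bar>\<xi>\<bar> < 2 * N}"

lemma band_measurable [measurable]: "band N \<in> sets borel"
  unfolding band_def by measurable

definition band_kernel :: "real \<Rightarrow> real \<Rightarrow> real \<Rightarrow> complex" where
  "band_kernel N x t = (LINT \<xi>|lborel. complex_of_real (indicator (band N) \<xi>) * osc x t \<xi>)"

lemma integral_indicator_interval: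
  fixes N x t :: real
  assumes N: "0 < N"
  shows "(LINT \<xi>|lborel. complex_of_real (indicator {N..<2 * N} \<xi>) * osc x t \<xi>)
    = integral {N..2 * N} (\<lambda>\<xi>. osc x t \<xi>)"
    and "integrable lborel (\<lambda>\<xi>. complex_of_real (indicator {N..<2 * N} \<xi>) * osc x t \<xi>)"
proof -
  let ?E = "\<lambda>\<xi>. osc x t \<xi>"
  have i: "set_integrable lborel {N..2 * N} ?E"
    by (intro borel_integrable_atLeastAtMost' continuous_intros)
  have ae: "AE \<xi> in lborel. complex_of_real (indicator {N..<2 * N} \<xi>) * ?E \<xi> = indicator {N..2 * N} \<xi> *\<^sub>R ?E \<xi>"
    using AE_lborel_singleton[of "2 * N"] by eventually_elim (auto simp: scaleR_conv_of_real split: split_indicator)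
  have "(LINT \<xi>|lborel. complex_of_real (indicator {N..<2 * N} \<xi>) * ?E \<xi>) = (LINT \<xi>|lborel. indicator {N..2 * N} \<xi> *\<^sub>R ?E \<xi>)"
    by (intro integral_cong_AE ae) auto
  also have "\<dots> = integral {N..2 * N} ?E"
    using set_borel_integral_eq_integral(2)[OF i] by (simp add: set_lebesgue_integral_def)
  finally show "(LINT \<xi>|lborel. complex_of_real (indicator {N..<2 * N} \<xi>) * ?E \<xi>) = integral {N..2 * N} ?E" .
  show "integrable lborel (\<lambda>\<xi>. complex_of_real (indicator {N..<2 * N} \<xi>) * ?E \<xi>)"
    using i unfolding set_integrable_def by (subst integrable_cong_AE[OF _ _ ae]) auto
qed

text \<open>Reflecting \<xi> shows that the negative half of the band contributes the complex
  conjugate of the positive half. The same conjugation reduces negative times to positive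
  ones.\<close>

lemma band_kernel_bound:
  assumes N: "0 < N"
  shows "cmod (band_kernel N x t) \<le> 2 * N" and "t \<noteq> 0 \<Longrightarrow> cmod (band_kernel N x t) \<le> 14 / sqrt (N * \<bar>t\<bar>)"
proof -
  define J where "J x t = integral {N..2 * N} (\<lambda>\<xi>. osc x t \<xi>)" for x t
  define P where "P x t \<xi> = complex_of_real (indicator {N..<2 * N} \<xi>) * osc x t \<xi>" for x t \<xi>
  have P: "integrable lborel (P x t)" "(LINT \<xi>|lborel. P x t \<xi>) = J x t" for x t
    unfolding P_def J_def using integral_indicator_interval[OF N] by auto
  have P': "integrable lborel (\<lambda>\<xi>. P x t (- \<xi>))" "(LINT \<xi>|lborel. P x t (- \<xi>)) = J x t" for x t
    using lborel_integrable_real_affine[OF P(1)[of x t], of "-1" 0] lborel_integral_real_affine[of "-1" "P x t" 0] P(2)[of x t] by auto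
  have "complex_of_real (indicator (band N) \<xi>) * osc x t \<xi> = P x t \<xi> + P (- x) (- t) (- \<xi>)" for \<xi>
    using N by (auto simp: P_def band_def split: split_indicator)
  then have K: "band_kernel N x t = J x t + J (- x) (- t)"
    unfolding band_kernel_def by (simp add: Bochner_Integration.integral_add P P')
  have cnj: "J (- x) (- t) = cnj (J x t)" for x t
    unfolding J_def Henstock_Kurzweil_Integration.integral_cnj by (intro Henstock_Kurzweil_Integration.integral_cong) (simp add: exp_cnj algebra_simps)
  have JN: "cmod (J x t) \<le> N" for x t
  proof -
    have "cmod (J x t) \<le> integral {N..2 * N} (\<lambda>_. 1 :: real)"
      unfolding J_def
    proof (rule integral_norm_bound_integral)
      show "(\<lambda>\<xi>. osc x t \<xi>) integrable_on {N..2 * N}"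
        by (intro integrable_continuous_interval continuous_intros)
      show "norm (osc x t \<xi>) \<le> 1" for \<xi> unfolding norm_exp_i_times by simp
    qed auto
    then show ?thesis using N by simp
  qed
  have K2: "cmod (band_kernel N x t) \<le> 2 * cmod (J x t)"
    unfolding K cnj by (rule order_trans[OF norm_triangle_ineq]) simp
  show "cmod (band_kernel N x t) \<le> 2 * N" using K2 JN[of x t] by linarith
  assume "t \<noteq> 0"
  then consider "0 < t" | "0 < - t" by linarith
  then have "cmod (J x t) \<le> 7 / sqrt (N * \<bar>t\<bar>)"
  proof cases
    case 1
    then show ?thesis using oscillatory_band[OF N 1, of x] by (simp add: J_def)
  next
    case 2
    then have "cmod (J (- x) (- t)) \<le> 7 / sqrt (N * \<bar>t\<bar>)" using oscillatory_band[OF N 2, of "- x"] by (simp add: J_def)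
    then show ?thesis by (simp add: cnj)
  qed
  then show "cmod (band_kernel N x t) \<le> 14 / sqrt (N * \<bar>t\<bar>)" using K2 by simp
qed

section \<open>Discrete fractional integration and the weak-type maximal bound\<close>

lemma sum_inverse_sqrt_le: "(\<Sum>k=1..n. 1 / sqrt (real k)) \<le> 2 * sqrt (real n)"
proof (induction n)
  case (Suc n)
  define a b where "a = sqrt (real n)" and "b = sqrt (real (Suc n))"
  have ab: "a\<^sup>2 = real n" "b\<^sup>2 = real n + 1" "0 \<le> a" "0 < b" by (auto simp: a_def b_def)
  have "2 * a * b \<le> a\<^sup>2 + b\<^sup>2" using sum_squares_bound[of a b] by simp
  then have "2 * a * b + 1 \<le> 2 * b\<^sup>2" using ab by simp
  then have "2 * a + 1 / b \<le> 2 * b" using ab by (simp add: field_simps power2_eq_square)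
  then show ?case using Suc by (simp add: a_def b_def)
qed simp

text \<open>A rearrangement bound: with m elements, those in [-m, m] contribute at most 1 + 4 sqrt
  m, and each of the others at most 1 / sqrt m. It replaces the Hardy-Littlewood-Sobolev inequality
  for the kernel |t|^(-1/2).\<close>

lemma sum_inverse_sqrt_int_le:
  fixes F :: "int set"
  assumes F: "finite F" "F \<noteq> {}"
  shows "(\<Sum>d\<in>F. 1 / sqrt (max 1 \<bar>real_of_int d\<bar>)) \<le> 6 * sqrt (real (card F))"
proof -
  define m where "m = card F"
  have m: "1 \<le> m" using F by (simp add: m_def Suc_le_eq card_gt_0_iff)
  define k where "k d = 1 / sqrt (max 1 \<bar>real_of_int d\<bar>)" for d
  have k0: "0 \<le> k d" for d by (simp add: k_def)
  define S where "S = {- int m..int m}"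
  have "(\<Sum>d\<in>F. k d) = (\<Sum>d\<in>F \<inter> S. k d) + (\<Sum>d\<in>F - S. k d)"
    using F by (metis sum.Int_Diff)
  moreover have "(\<Sum>d\<in>F \<inter> S. k d) \<le> (\<Sum>d\<in>S. k d)"
    using k0 by (intro sum_mono2) (auto simp: S_def)
  moreover have "(\<Sum>d\<in>S. k d) = 1 + 2 * (\<Sum>i=1..m. 1 / sqrt (real i))"
  proof -
    have S: "S = insert 0 ((int ` {1..m}) \<union> ((\<lambda>i. - int i) ` {1..m}))"
    proof (intro equalityI subsetI)
      fix d assume "d \<in> S"
      then have "d = int (nat \<bar>d\<bar>) \<or> d = - int (nat \<bar>d\<bar>)" "nat \<bar>d\<bar> \<le> m" by (auto simp: S_def)
      then show "d \<in> insert 0 ((int ` {1..m}) \<union> ((\<lambda>i. - int i) ` {1..m}))"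
        by (cases "d = 0") (auto simp: image_iff Bex_def intro!: exI[of _ "nat \<bar>d\<bar>"])
    qed (auto simp: S_def)
    have "(\<Sum>d\<in>S. k d) = k 0 + ((\<Sum>d\<in>int ` {1..m}. k d) + (\<Sum>d\<in>(\<lambda>i. - int i) ` {1..m}. k d))"
      unfolding S by (subst sum.insert, simp, force, subst sum.union_disjoint) auto
    also have "(\<Sum>d\<in>int ` {1..m}. k d) = (\<Sum>i=1..m. 1 / sqrt (real i))"
      by (subst sum.reindex) (auto simp: k_def max_def intro!: sum.cong)
    also have "(\<Sum>d\<in>(\<lambda>i. - int i) ` {1..m}. k d) = (\<Sum>i=1..m. 1 / sqrt (real i))"
      by (subst sum.reindex) (auto simp: k_def max_def inj_on_def intro!: sum.cong)
    finally show ?thesis by (simp add: k_def)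
  qed
  moreover have "(\<Sum>d\<in>F - S. k d) \<le> (\<Sum>d\<in>F - S. 1 / sqrt (real m))"
  proof (intro sum_mono)
    fix d assume "d \<in> F - S"
    then have "int m \<le> \<bar>d\<bar>" by (auto simp: S_def)
    then have "real m \<le> \<bar>real_of_int d\<bar>" by linarith
    then show "k d \<le> 1 / sqrt (real m)" unfolding k_def using m by (intro divide_left_mono) auto
  qed
  moreover have "(\<Sum>d\<in>F - S. 1 / sqrt (real m)) \<le> sqrt (real m)"
  proof -
    have "real (card (F - S)) \<le> real m" using F by (auto simp: m_def intro: card_mono)
    then have "real (card (F - S)) * (1 / sqrt (real m)) \<le> real m * (1 / sqrt (real m))" by (intro mult_right_mono) auto
    then show ?thesis using m by (simp add: real_div_sqrt)
  qed
  moreover have "1 \<le> sqrt (real m)" using m by simp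
  moreover note sum_inverse_sqrt_le[of m]
  ultimately show ?thesis unfolding k_def[symmetric] m_def[symmetric] by linarith
qed

text \<open>A \<open>T T*\<close> argument with point masses in place of functions; it yields the weak-type
  \<open>L^4_t L^\<infinity>_x\<close> bound without a measurable selection of the points.\<close>

lemma band_level_count:
  fixes F :: "int set" and X T :: "int \<Rightarrow> real"
  assumes N: "0 < N" and g: "sqint lborel g" and supp: "\<And>\<xi>. g \<xi> \<noteq> 0 \<Longrightarrow> \<xi> \<in> band N"
    and F: "finite F" "F \<noteq> {}" and cell: "\<And>l. l \<in> F \<Longrightarrow> \<lfloor>N ^ 3 * T l\<rfloor> = l"
    and v: "0 \<le> v" "\<And>l. l \<in> F \<Longrightarrow> v \<le> cmod (ev g (X l) (T l))"
  shows "v ^ 4 * real (card F) \<le> (120 * N * n2 lborel g)\<^sup>2"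
proof -
  define m where "m = card F"
  have m: "1 \<le> m" using F by (simp add: m_def Suc_le_eq card_gt_0_iff)
  \<comment> \<open>Phases that make all the sampled values real and nonnegative, so that they add
    up without cancellation.\<close>
  define c where "c l = cnj (sgn (ev g (X l) (T l)))" for l
  have c1: "cmod (c l) \<le> 1" for l by (simp add: c_def norm_sgn)
  have cv: "c l * ev g (X l) (T l) = complex_of_real (cmod (ev g (X l) (T l)))" for l
    by (simp add: c_def sgn_div_norm scaleR_conv_of_real) (simp add: complex_norm_square[symmetric] mult.commute field_simps power2_eq_square)
  define B where "B l \<xi> = complex_of_real (indicator (band N) \<xi>) * osc (X l) (T l) \<xi>" for l \<xi>
  have bandfin: "emeasure lborel (band N) < \<infinity>"
  proof -
    have "emeasure lborel (band N) \<le> emeasure lborel {- (2 * N)..2 * N}"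
      by (intro emeasure_mono) (auto simp: band_def)
    also have "\<dots> < \<infinity>" using N by simp
    finally show ?thesis .
  qed
  have Bs: "sqint lborel (B l)" for l
    unfolding sqint_def
  proof
    show "B l \<in> borel_measurable lborel" unfolding B_def by measurable
    have "(\<lambda>\<xi>. (cmod (B l \<xi>))\<^sup>2) = indicator (band N)"
      by (auto simp: B_def norm_mult fun_eq_iff split: split_indicator)
    then show "integrable lborel (\<lambda>\<xi>. (cmod (B l \<xi>))\<^sup>2)" using bandfin by simp
  qed
  define P where "P \<xi> = (\<Sum>l\<in>F. c l * B l \<xi>)" for \<xi>
  have Ps: "sqint lborel P" unfolding P_def by (intro sqint_sum F sqint_cmult Bs)
  have evB: "ev g (X l) (T l) = (LINT \<xi>|lborel. g \<xi> * B l \<xi>)" for l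
    unfolding ev_def by (intro Bochner_Integration.integral_cong refl) (use supp in \<open>force simp: B_def split: split_indicator\<close>)
  have lower: "real m * v \<le> cmod (LINT \<xi>|lborel. g \<xi> * P \<xi>)"
  proof -
    have "(LINT \<xi>|lborel. g \<xi> * P \<xi>) = (LINT \<xi>|lborel. (\<Sum>l\<in>F. c l * (g \<xi> * B l \<xi>)))"
      by (simp add: P_def sum_distrib_left mult.left_commute)
    also have "\<dots> = (\<Sum>l\<in>F. c l * ev g (X l) (T l))"
      using sqint_integrable_mult[OF g Bs] by (subst Bochner_Integration.integral_sum) (auto simp: evB)
    also have "\<dots> = complex_of_real (\<Sum>l\<in>F. cmod (ev g (X l) (T l)))" by (simp add: cv)
    finally have "cmod (LINT \<xi>|lborel. g \<xi> * P \<xi>) = (\<Sum>l\<in>F. cmod (ev g (X l) (T l)))"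
      by (simp only: norm_of_real) (simp add: sum_nonneg)
    moreover have "(\<Sum>l\<in>F. v) \<le> (\<Sum>l\<in>F. cmod (ev g (X l) (T l)))" using v(2) by (intro sum_mono)
    ultimately show ?thesis by (simp add: m_def)
  qed
  have n2P: "n2 lborel P \<le> (\<Sum>l\<in>F. \<Sum>l'\<in>F. cmod (band_kernel N (X l' - X l) (T l' - T l)))"
  proof -
    have ipB: "ip lborel (B l) (B l') = band_kernel N (X l' - X l) (T l' - T l)" for l l'
      unfolding ip_def band_kernel_def
    proof (intro Bochner_Integration.integral_cong refl)
      fix \<xi>
      have "cnj (osc (X l) (T l) \<xi>) * osc (X l') (T l') \<xi>
        = exp (\<i> * complex_of_real ((X l' - X l) * \<xi> + (T l' - T l) * \<xi> ^ 3))"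
        by (simp add: exp_cnj exp_add[symmetric] algebra_simps)
      then show "cnj (B l \<xi>) * B l' \<xi> = complex_of_real (indicator (band N) \<xi>) * exp (\<i> * complex_of_real ((X l' - X l) * \<xi> + (T l' - T l) * \<xi> ^ 3))"
        by (simp add: B_def split: split_indicator)
    qed
    have "complex_of_real (n2 lborel P) = (LINT \<xi>|lborel. (\<Sum>l\<in>F. \<Sum>l'\<in>F. cnj (c l) * c l' * (cnj (B l \<xi>) * B l' \<xi>)))"
      unfolding ip_self[symmetric] ip_def P_def
      by (intro Bochner_Integration.integral_cong refl) (simp only: sum_product cnj_sum complex_cnj_mult, simp add: mult_ac)
    also have "\<dots> = (\<Sum>l\<in>F. \<Sum>l'\<in>F. cnj (c l) * c l' * ip lborel (B l) (B l'))"
      using sqint_integrable_ip[OF Bs Bs] unfolding ip_def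
      by (subst Bochner_Integration.integral_sum, force, subst Bochner_Integration.integral_sum) auto
    finally have "n2 lborel P = cmod (\<Sum>l\<in>F. \<Sum>l'\<in>F. cnj (c l) * c l' * ip lborel (B l) (B l'))"
      using n2_nonneg[of lborel P] by (metis abs_of_nonneg norm_of_real)
    also have "\<dots> \<le> (\<Sum>l\<in>F. \<Sum>l'\<in>F. cmod (cnj (c l) * c l' * ip lborel (B l) (B l')))"
      by (intro order_trans[OF norm_sum] sum_mono norm_sum)
    also have "\<dots> \<le> (\<Sum>l\<in>F. \<Sum>l'\<in>F. cmod (band_kernel N (X l' - X l) (T l' - T l)))"
    proof (intro sum_mono)
      fix l l'
      have "cmod (c l) * cmod (c l') \<le> 1 * 1" using c1 by (intro mult_mono) auto
      then have "cmod (c l) * cmod (c l') * cmod (ip lborel (B l) (B l')) \<le> 1 * cmod (ip lborel (B l) (B l'))"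
        by (intro mult_right_mono) auto
      then show "cmod (cnj (c l) * c l' * ip lborel (B l) (B l')) \<le> cmod (band_kernel N (X l' - X l) (T l' - T l))"
        by (simp add: norm_mult ipB)
    qed
    finally show ?thesis .
  qed
  \<comment> \<open>Nearby cells use the trivial bound 2 N. For index distance D >= 2 the times
    differ by at least D / (2 N^3), and the dispersive bound gives 14 sqrt 2 N / sqrt D; the
    constant 20 exceeds 14 sqrt 2.\<close>
  have ker: "cmod (band_kernel N (X l' - X l) (T l' - T l)) \<le> 20 * N * (1 / sqrt (max 1 \<bar>real_of_int (l' - l)\<bar>))"
    if l: "l \<in> F" "l' \<in> F" for l l'
  proof (cases "\<bar>l' - l\<bar> \<le> 1")
    case True
    then have "max 1 \<bar>real_of_int (l' - l)\<bar> = 1" by linarith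
    then show ?thesis using band_kernel_bound(1)[OF N, of "X l' - X l" "T l' - T l"] N by simp
  next
    case False
    define D where "D = \<bar>real_of_int (l' - l)\<bar>"
    have D: "2 \<le> D" using False unfolding D_def by linarith
    have fl: "\<bar>N ^ 3 * T l' - N ^ 3 * T l\<bar> \<ge> D - 1"
      using cell[OF l(1)] cell[OF l(2)] unfolding D_def by linarith
    have N3: "\<bar>N ^ 3 * T l' - N ^ 3 * T l\<bar> = N ^ 3 * \<bar>T l' - T l\<bar>"
      using N by (simp add: right_diff_distrib[symmetric] abs_mult)
    then have lowN: "D / 2 \<le> N ^ 3 * \<bar>T l' - T l\<bar>" using fl D by linarith
    then have Tn: "T l' - T l \<noteq> 0" using D by auto
    have "(D * 49) \<le> 100 * (N ^ 3 * \<bar>T l' - T l\<bar>)" using lowN D by linarith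
    then have "49 * D \<le> 100 * N\<^sup>2 * (N * \<bar>T l' - T l\<bar>)" by (simp add: power3_eq_cube power2_eq_square mult_ac)
    then have "sqrt (49 * D) \<le> sqrt (100 * N\<^sup>2 * (N * \<bar>T l' - T l\<bar>))" by (rule real_sqrt_le_mono)
    moreover have "sqrt (49 :: real) = 7" "sqrt (100 :: real) = 10" by (simp_all add: real_sqrt_unique)
    ultimately have "7 * sqrt D \<le> 10 * N * sqrt (N * \<bar>T l' - T l\<bar>)" using N by (simp add: real_sqrt_mult)
    moreover have "0 < sqrt D" "0 < sqrt (N * \<bar>T l' - T l\<bar>)" using D N Tn by auto
    ultimately have "14 / sqrt (N * \<bar>T l' - T l\<bar>) \<le> 20 * N * (1 / sqrt D)"
      by (simp add: divide_simps mult_ac)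
    moreover have "max 1 \<bar>real_of_int (l' - l)\<bar> = D" using D unfolding D_def by linarith
    ultimately show ?thesis using band_kernel_bound(2)[OF N Tn, of "X l' - X l"] by simp
  qed
  have "n2 lborel P \<le> (\<Sum>l\<in>F. \<Sum>l'\<in>F. 20 * N * (1 / sqrt (max 1 \<bar>real_of_int (l' - l)\<bar>)))"
    by (rule order_trans[OF n2P]) (intro sum_mono ker)
  also have "\<dots> \<le> (\<Sum>l\<in>F. 20 * N * (6 * sqrt (real m)))"
  proof (intro sum_mono)
    fix l assume "l \<in> F"
    have inj: "inj_on (\<lambda>l'. l' - l) F" by (auto simp: inj_on_def)
    have "(\<Sum>l'\<in>F. 1 / sqrt (max 1 \<bar>real_of_int (l' - l)\<bar>)) = (\<Sum>d\<in>(\<lambda>l'. l' - l) ` F. 1 / sqrt (max 1 \<bar>real_of_int d\<bar>))"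
      by (subst sum.reindex[OF inj]) simp
    also have "\<dots> \<le> 6 * sqrt (real (card ((\<lambda>l'. l' - l) ` F)))"
      using F by (intro sum_inverse_sqrt_int_le) auto
    also have "card ((\<lambda>l'. l' - l) ` F) = m" unfolding m_def using inj by (rule card_image)
    finally show "(\<Sum>l'\<in>F. 20 * N * (1 / sqrt (max 1 \<bar>real_of_int (l' - l)\<bar>))) \<le> 20 * N * (6 * sqrt (real m))"
      unfolding sum_distrib_left[symmetric] using N by (intro mult_left_mono) auto
  qed
  finally have n2P': "n2 lborel P \<le> 120 * N * (real m * sqrt (real m))" by (simp add: m_def mult_ac)
  \<comment> \<open>Duality: \<open>P\<close> has squared norm at most 120 N m^(3/2), where 120 = 20
    * 6. Cancelling m, then sqrt m, and squaring leaves the fourth power of v.\<close>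
  have "(real m * v)\<^sup>2 \<le> (cmod (LINT \<xi>|lborel. g \<xi> * P \<xi>))\<^sup>2"
    using lower v by (intro power_mono) auto
  also have "\<dots> \<le> n2 lborel g * n2 lborel P" by (rule Cauchy_Schwarz_sqint[OF g Ps])
  also have "\<dots> \<le> n2 lborel g * (120 * N * (real m * sqrt (real m)))"
    using n2P' by (intro mult_left_mono) auto
  finally have "real m * (real m * v\<^sup>2) \<le> real m * (120 * N * n2 lborel g * sqrt (real m))"
    by (simp add: power2_eq_square mult_ac)
  then have "real m * v\<^sup>2 \<le> 120 * N * n2 lborel g * sqrt (real m)" using m by simp
  moreover have "sqrt (real m) * (sqrt (real m) * v\<^sup>2) = real m * v\<^sup>2"
    by (simp flip: mult.assoc)
  ultimately have "sqrt (real m) * (sqrt (real m) * v\<^sup>2) \<le> sqrt (real m) * (120 * N * n2 lborel g)"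
    by (simp only: mult.commute)
  then have "sqrt (real m) * v\<^sup>2 \<le> 120 * N * n2 lborel g" using m by simp
  then have "(sqrt (real m) * v\<^sup>2)\<^sup>2 \<le> (120 * N * n2 lborel g)\<^sup>2"
    by (intro power_mono) auto
  then show ?thesis by (simp add: power_mult_distrib m_def mult.commute power_mult[symmetric])
qed

text \<open>In decreasing order the k-th value satisfies v^4 k <= K, so its r-th power is at most
  K^(r/4) k^(-r/4), summable because r > 4. The induction removes a minimal element, which is the
  last one in this order.\<close>

lemma sum_powr_from_level_count:
  fixes F :: "'i set" and v :: "'i \<Rightarrow> real"
  assumes "finite F" and r: "4 < r" and K: "0 \<le> K" and v: "\<And>i. i \<in> F \<Longrightarrow> 0 \<le> v i"
    and count: "\<And>G c. G \<subseteq> F \<Longrightarrow> G \<noteq> {} \<Longrightarrow> 0 \<le> c \<Longrightarrow> (\<And>i. i \<in> G \<Longrightarrow> c \<le> v i) \<Longrightarrow> c ^ 4 * real (card G) \<le> K"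
  shows "(\<Sum>i\<in>F. v i powr r) \<le> K powr (r / 4) * (\<Sum>k=1..card F. real k powr (- (r / 4)))"
  using assms(1) v count
proof (induction "card F" arbitrary: F)
  case 0
  then show ?case using K by simp
next
  case (Suc n)
  then have ne: "F \<noteq> {}" by auto
  define i where "i = arg_min_on v F"
  have i: "i \<in> F" "\<And>j. j \<in> F \<Longrightarrow> v i \<le> v j"
    using arg_min_if_finite[OF \<open>finite F\<close> ne, of v] unfolding i_def by (auto simp: not_less)
  have "v i ^ 4 * real (card F) \<le> K" using Suc.prems(2)[OF i(1)] i ne by (intro Suc.prems(3)) auto
  moreover have "0 < real (card F)" using ne Suc.prems(1) by (simp add: card_gt_0_iff)
  ultimately have "v i ^ 4 \<le> K / real (card F)" by (simp add: pos_le_divide_eq)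
  then have "(v i ^ 4) powr (r / 4) \<le> (K / real (card F)) powr (r / 4)"
    using r by (intro powr_mono2) auto
  moreover have "(v i ^ 4) powr (r / 4) = v i powr r"
  proof -
    have "v i ^ 4 = v i powr 4" using Suc.prems(2)[OF i(1)] by simp
    then show ?thesis by (simp only: powr_powr) simp
  qed
  moreover have "(K / real (card F)) powr (r / 4) = K powr (r / 4) * real (card F) powr (- (r / 4))"
    using K by (simp add: powr_divide powr_minus_divide)
  ultimately have vi: "v i powr r \<le> K powr (r / 4) * real (Suc n) powr (- (r / 4))" using Suc.hyps(2) by simp
  have n: "n = card (F - {i})" using Suc.hyps(2) i(1) Suc.prems(1) by simp
  have "(\<Sum>j\<in>F - {i}. v j powr r) \<le> K powr (r / 4) * (\<Sum>k=1..card (F - {i}). real k powr (- (r / 4)))"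
  proof (rule Suc.hyps(1)[OF n])
    fix G c assume "G \<subseteq> F - {i}" "G \<noteq> {}" "0 \<le> c" "\<And>i. i \<in> G \<Longrightarrow> c \<le> v i"
    then show "c ^ 4 * real (card G) \<le> K" by (intro Suc.prems(3)) auto
  qed (use Suc.prems(1,2) in auto)
  then have "(\<Sum>j\<in>F. v j powr r) \<le> v i powr r + K powr (r / 4) * (\<Sum>k=1..n. real k powr (- (r / 4)))"
    using i(1) Suc.prems(1) by (simp add: sum.remove n[symmetric])
  also have "\<dots> \<le> K powr (r / 4) * (\<Sum>k=1..Suc n. real k powr (- (r / 4)))"
    using vi by (simp add: distrib_left)
  finally show ?case using Suc.hyps(2) by simp
qed


text \<open>The integrand is constant on cells of length 1/c. Truncating to finitely many cells and
  applying Fatou's lemma makes bounds on finite sums sufficient.\<close>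

lemma nn_integral_step_le:
  fixes f :: "int \<Rightarrow> ennreal"
  assumes c: "0 < c" and le: "\<And>F. finite F \<Longrightarrow> (\<Sum>l\<in>F. f l) \<le> B"
  shows "(\<integral>\<^sup>+ t. f \<lfloor>c * t\<rfloor> \<partial>lborel) \<le> ennreal (1 / c) * B"
proof -
  have unit: "(\<integral>\<^sup>+ t. f \<lfloor>t\<rfloor> \<partial>(lborel :: real measure)) \<le> B"
  proof -
    define h where "h n t = (\<Sum>l\<in>{- int n..int n}. f l * indicator {real_of_int l..<real_of_int l + 1} t)" for n and t :: real
    have [measurable]: "h n \<in> borel_measurable lborel" for n unfolding h_def by measurable
    have hn: "h n t = (if \<bar>\<lfloor>t\<rfloor>\<bar> \<le> int n then f \<lfloor>t\<rfloor> else 0)" for n t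
    proof -
      have "(real_of_int l \<le> t \<and> t < real_of_int l + 1) \<longleftrightarrow> l = \<lfloor>t\<rfloor>" for l by linarith
      then have "indicator {real_of_int l..<real_of_int l + 1} t = (if l = \<lfloor>t\<rfloor> then 1 else 0 :: ennreal)" for l
        by (simp add: indicator_def)
      then have "h n t = (\<Sum>l\<in>{- int n..int n}. if l = \<lfloor>t\<rfloor> then f l else 0)"
        unfolding h_def by (intro sum.cong) auto
      then show ?thesis by (auto simp: abs_le_iff)
    qed
    have "(\<integral>\<^sup>+ t. f \<lfloor>t\<rfloor> \<partial>(lborel :: real measure)) = (\<integral>\<^sup>+ t. liminf (\<lambda>n. h n t) \<partial>lborel)"
    proof (rule nn_integral_cong)
      fix t :: real
      have "\<forall>\<^sub>F n in sequentially. h n t = f \<lfloor>t\<rfloor>"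
        using eventually_ge_at_top[of "nat \<bar>\<lfloor>t\<rfloor>\<bar>"] by eventually_elim (auto simp: hn)
      from lim_imp_Liminf[OF _ tendsto_eventually[OF this]] show "f \<lfloor>t\<rfloor> = liminf (\<lambda>n. h n t)" by simp
    qed
    also have "\<dots> \<le> liminf (\<lambda>n. \<integral>\<^sup>+ t. h n t \<partial>lborel)" by (intro nn_integral_liminf) auto
    also have "\<dots> \<le> liminf (\<lambda>n. B)"
    proof (intro Liminf_mono always_eventually allI)
      fix n
      have "(\<integral>\<^sup>+ t. h n t \<partial>lborel) = (\<Sum>l\<in>{- int n..int n}. f l)"
        unfolding h_def by (subst nn_integral_sum) (auto simp: nn_integral_cmult intro!: sum.cong)
      then show "(\<integral>\<^sup>+ t. h n t \<partial>lborel) \<le> B" using le by simp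
    qed
    finally show ?thesis by (simp add: Liminf_const)
  qed
  have [measurable]: "(\<lambda>t. f \<lfloor>t\<rfloor>) \<in> borel_measurable (borel :: real measure)"
    by (rule measurable_compose[of floor _ "count_space UNIV"]) auto
  have "(\<integral>\<^sup>+ t. f \<lfloor>t\<rfloor> \<partial>(lborel :: real measure)) = ennreal \<bar>c\<bar> * (\<integral>\<^sup>+ t. f \<lfloor>0 + c * t\<rfloor> \<partial>lborel)"
    using c by (intro nn_integral_real_affine) auto
  then have "ennreal (1 / c) * (\<integral>\<^sup>+ t. f \<lfloor>t\<rfloor> \<partial>(lborel :: real measure)) = (ennreal (1 / c) * ennreal c) * (\<integral>\<^sup>+ t. f \<lfloor>c * t\<rfloor> \<partial>lborel)"
    using c by (simp add: mult.assoc)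
  also have "ennreal (1 / c) * ennreal c = 1" using c by (simp add: ennreal_mult[symmetric])
  finally have "(\<integral>\<^sup>+ t. f \<lfloor>c * t\<rfloor> \<partial>lborel) = ennreal (1 / c) * (\<integral>\<^sup>+ t. f \<lfloor>t\<rfloor> \<partial>(lborel :: real measure))" by simp
  also have "\<dots> \<le> ennreal (1 / c) * B" using unit by (intro mult_left_mono) auto
  finally show ?thesis .
qed

text \<open>Bernstein's inequality, read off from the level count for a single point.\<close>

lemma band_ev_bound:
  assumes N: "0 < N" and g: "sqint lborel g" and supp: "\<And>\<xi>. g \<xi> \<noteq> 0 \<Longrightarrow> \<xi> \<in> band N"
  shows "(cmod (ev g x t))\<^sup>2 \<le> 120 * N * n2 lborel g"
proof -
  have "cmod (ev g x t) ^ 4 * real (card {\<lfloor>N ^ 3 * t\<rfloor>}) \<le> (120 * N * n2 lborel g)\<^sup>2"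
    by (rule band_level_count[OF N g supp, where X = "\<lambda>_. x" and T = "\<lambda>_. t"]) auto
  then have "((cmod (ev g x t))\<^sup>2)\<^sup>2 \<le> (120 * N * n2 lborel g)\<^sup>2" by (simp add: power_mult[symmetric])
  then show ?thesis by (rule power2_le_imp_le) (use N in auto)
qed

text \<open>The supremum over x and over each time cell of length N^(-3) is a step function of t.
  Providing it as a majorant \<open>b\<close> settles measurability, and its r-th power integrates
  through the level count.\<close>

lemma band_maximal_estimate:
  assumes r: "4 < r"
  obtains Z where "0 \<le> Z" "\<And>N g. 0 < N \<Longrightarrow> sqint lborel g \<Longrightarrow> (\<And>\<xi>. g \<xi> \<noteq> 0 \<Longrightarrow> \<xi> \<in> band N) \<Longrightarrow>
    \<exists>b. b \<in> borel_measurable lborel \<and> (\<forall>t. 0 \<le> b t) \<and> (\<forall>x t. cmod (ev g x t) \<le> b t) \<and>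
      (\<integral>\<^sup>+ t. ennreal (b t powr r) \<partial>lborel) \<le> ennreal (1 / N ^ 3 * (Z * (N * n2 lborel g) powr (r / 2)))"
proof -
  define \<zeta> where "\<zeta> = (\<Sum>k. real k powr (- (r / 4)))"
  have sm: "summable (\<lambda>k. real k powr (- (r / 4)))" using r by (simp add: summable_real_powr_iff)
  have \<zeta>0: "0 \<le> \<zeta>" unfolding \<zeta>_def using sm by (intro suminf_nonneg) auto
  define Z where "Z = 2 powr r * (120 powr (r / 2) * \<zeta>)"
  show ?thesis
  proof (rule that[of Z])
    show "0 \<le> Z" using \<zeta>0 by (simp add: Z_def)
    fix N :: real and g assume N: "0 < N" and g: "sqint lborel g" and supp: "\<And>\<xi>. g \<xi> \<noteq> 0 \<Longrightarrow> \<xi> \<in> band N"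
    define E where "E l = {cmod (ev g x t) | x t. \<lfloor>N ^ 3 * t\<rfloor> = l}" for l
    define b where "b l = Sup (E l)" for l
    have bdd: "bdd_above (E l)" for l
      using band_ev_bound[OF N g supp] by (auto simp: E_def intro!: bdd_aboveI[of _ "sqrt (120 * N * n2 lborel g)"] real_le_rsqrt)
    have ub: "cmod (ev g x t) \<le> b \<lfloor>N ^ 3 * t\<rfloor>" for x t
      unfolding b_def using bdd by (intro cSup_upper) (auto simp: E_def)
    have cell: "\<lfloor>N ^ 3 * (real_of_int l / N ^ 3)\<rfloor> = l" for l using N by simp
    have b0: "0 \<le> b l" for l using order_trans[OF norm_ge_zero ub[of 0 "real_of_int l / N ^ 3"]] unfolding cell .
    \<comment> \<open>The supremum over a cell need not be attained; a point reaching half of it is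
      chosen, which costs the factor 2^r in \<open>Z\<close>.\<close>
    have "\<exists>x t. \<lfloor>N ^ 3 * t\<rfloor> = l \<and> b l / 2 \<le> cmod (ev g x t)" for l
    proof (cases "b l = 0")
      case True
      show ?thesis by (intro exI conjI, rule cell) (simp add: True)
    next
      case False
      then have "b l / 2 < Sup (E l)" using b0[of l] by (simp add: b_def)
      moreover have "cmod (ev g 0 (real_of_int l / N ^ 3)) \<in> E l" unfolding E_def using cell by blast
      then have "E l \<noteq> {}" by blast
      ultimately obtain y where "y \<in> E l" "b l / 2 < y" using less_cSupD by blast
      then show ?thesis by (auto simp: E_def intro: less_imp_le)
    qed
    then obtain X T where XT: "\<And>l. \<lfloor>N ^ 3 * T l\<rfloor> = l" "\<And>l. b l / 2 \<le> cmod (ev g (X l) (T l))" by metis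
    have sum: "(\<Sum>l\<in>F. b l powr r) \<le> Z * (N * n2 lborel g) powr (r / 2)" if F: "finite F" for F
    proof -
      have "(\<Sum>l\<in>F. b l powr r) \<le> (\<Sum>l\<in>F. 2 powr r * cmod (ev g (X l) (T l)) powr r)"
      proof (intro sum_mono)
        fix l
        have "b l powr r \<le> (2 * cmod (ev g (X l) (T l))) powr r"
          using XT(2)[of l] b0[of l] r by (intro powr_mono2) auto
        then show "b l powr r \<le> 2 powr r * cmod (ev g (X l) (T l)) powr r" by (simp add: powr_mult)
      qed
      also have "\<dots> = 2 powr r * (\<Sum>l\<in>F. cmod (ev g (X l) (T l)) powr r)" by (simp add: sum_distrib_left)
      also have "\<dots> \<le> 2 powr r * (((120 * N * n2 lborel g)\<^sup>2) powr (r / 4) * (\<Sum>k=1..card F. real k powr (- (r / 4))))"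
      proof (intro mult_left_mono sum_powr_from_level_count[OF F r])
        fix G c assume G: "G \<subseteq> F" "G \<noteq> {}" "0 \<le> c" "\<And>i. i \<in> G \<Longrightarrow> c \<le> cmod (ev g (X i) (T i))"
        then show "c ^ 4 * real (card G) \<le> (120 * N * n2 lborel g)\<^sup>2"
          using F XT(1) by (intro band_level_count[OF N g supp, where X = X and T = T]) (auto intro: finite_subset)
      qed auto
      also have "\<dots> \<le> 2 powr r * (((120 * N * n2 lborel g)\<^sup>2) powr (r / 4) * \<zeta>)"
        unfolding \<zeta>_def by (intro mult_left_mono sum_le_suminf sm) auto
      also have "((120 * N * n2 lborel g)\<^sup>2) powr (r / 4) = 120 powr (r / 2) * (N * n2 lborel g) powr (r / 2)"
      proof -
        have "(120 * N * n2 lborel g)\<^sup>2 = (120 * (N * n2 lborel g)) powr 2" using N by (simp add: mult.assoc)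
        then show ?thesis using N by (simp only: powr_powr) (simp add: powr_mult)
      qed
      finally show ?thesis by (simp add: Z_def mult_ac)
    qed
    have meas: "(\<lambda>t. b \<lfloor>N ^ 3 * t\<rfloor>) \<in> borel_measurable lborel"
      by (rule measurable_compose[of "\<lambda>t. \<lfloor>N ^ 3 * t\<rfloor>" _ "count_space UNIV"]) auto
    have "(\<integral>\<^sup>+ t. ennreal (b \<lfloor>N ^ 3 * t\<rfloor> powr r) \<partial>lborel) \<le> ennreal (1 / N ^ 3) * ennreal (Z * (N * n2 lborel g) powr (r / 2))"
      using sum N by (intro nn_integral_step_le) (auto simp: sum_ennreal ennreal_leI)
    also have "\<dots> = ennreal (1 / N ^ 3 * (Z * (N * n2 lborel g) powr (r / 2)))"
      using N \<zeta>0 by (intro ennreal_mult[symmetric]) (auto simp: Z_def)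
    finally show "\<exists>b. b \<in> borel_measurable lborel \<and> (\<forall>t. 0 \<le> b t) \<and> (\<forall>x t. cmod (ev g x t) \<le> b t) \<and>
      (\<integral>\<^sup>+ t. ennreal (b t powr r) \<partial>lborel) \<le> ennreal (1 / N ^ 3 * (Z * (N * n2 lborel g) powr (r / 2)))"
      using b0 ub meas by (intro exI[of _ "\<lambda>t. b \<lfloor>N ^ 3 * t\<rfloor>"]) auto
  qed
qed

section \<open>The refined Strichartz inequality\<close>

lemma sum_geometric_le:
  fixes J :: "int set"
  assumes "finite J" "0 \<le> \<rho>" "\<rho> < (1 :: real)"
  shows "(\<Sum>i\<in>{i \<in> J. i \<le> j}. \<rho> ^ nat (j - i)) \<le> 1 / (1 - \<rho>)"
    and "(\<Sum>i\<in>J. \<rho> ^ nat \<bar>i - j\<bar>) \<le> 2 / (1 - \<rho>)"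
proof -
  have *: "(\<Sum>i\<in>I. \<rho> ^ f i) \<le> 1 / (1 - \<rho>)" if "finite I" "inj_on f I" for I :: "int set" and f
  proof -
    have "(\<Sum>i\<in>I. \<rho> ^ f i) = (\<Sum>n\<in>f ` I. \<rho> ^ n)" using that by (simp add: sum.reindex)
    also have "\<dots> \<le> (\<Sum>n. \<rho> ^ n)" using that assms by (intro sum_le_suminf summable_geometric) auto
    finally show ?thesis using assms by (simp add: suminf_geometric)
  qed
  show "(\<Sum>i\<in>{i \<in> J. i \<le> j}. \<rho> ^ nat (j - i)) \<le> 1 / (1 - \<rho>)"
    using assms by (intro *) (auto simp: inj_on_def)
  have "(\<Sum>i\<in>J. \<rho> ^ nat \<bar>i - j\<bar>) = (\<Sum>i\<in>J \<inter> {..j}. \<rho> ^ nat \<bar>i - j\<bar>) + (\<Sum>i\<in>J - {..j}. \<rho> ^ nat \<bar>i - j\<bar>)"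
    using assms by (metis sum.Int_Diff)
  also have "\<dots> \<le> 1 / (1 - \<rho>) + 1 / (1 - \<rho>)"
    using assms by (intro add_mono *) (auto simp: inj_on_def)
  finally show "(\<Sum>i\<in>J. \<rho> ^ nat \<bar>i - j\<bar>) \<le> 2 / (1 - \<rho>)" by simp
qed

text \<open>Only pairs \<open>i \<le> j\<close> occur, so the lower-frequency factor can be estimated in \<open>L^\<infinity>\<close>. The proof
  compares every term with the largest one.\<close>

lemma sum_powr_le_bilinear:
  fixes x :: "int \<Rightarrow> real" and q \<eta> e :: real
  assumes J: "finite J" and x: "\<And>j. 0 \<le> x j" and q: "0 < q" and \<eta>: "0 < \<eta>" "\<eta> < q" and e: "0 < e"
  shows "(\<Sum>j\<in>J. x j) powr q \<le> (2 / (1 - 2 powr (- (e / q)))) powr q *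
    (\<Sum>(i, j)\<in>{(i, j) \<in> J \<times> J. i \<le> j}. 2 powr (e * real_of_int (j - i)) * (x i powr \<eta> * x j powr (q - \<eta>)))"
proof (cases "J = {}")
  case False
  define P where "P = {(i, j) \<in> J \<times> J. i \<le> j}"
  have P: "finite P" unfolding P_def using J by (auto intro: finite_subset[of _ "J \<times> J"])
  define F where "F = (\<lambda>(i, j). 2 powr (e * real_of_int (j - i)) * (x i powr \<eta> * x j powr (q - \<eta>)))"
  have F0: "0 \<le> F z" for z by (auto simp: F_def split: prod.split)
  define T where "T = (\<Sum>z\<in>P. F z)"
  have FT: "F z \<le> T" if "z \<in> P" for z unfolding T_def using that P F0 by (intro member_le_sum) auto
  define \<rho> where "\<rho> = 2 powr (- (e / q))"
  have \<rho>: "0 < \<rho>" "\<rho> < 1" using e q by (auto simp: \<rho>_def powr_less_one)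
  have "Max (x ` J) \<in> x ` J" using J False by (intro Max_in) auto
  then obtain M where "M \<in> J" "Max (x ` J) = x M" by auto
  then have M: "M \<in> J" "\<And>j. j \<in> J \<Longrightarrow> x j \<le> x M"
    using Max_ge[of "x ` J"] J by auto
  have T0: "0 \<le> T" unfolding T_def using F0 by (intro sum_nonneg) auto
  have xj: "x j \<le> T powr (1 / q) * \<rho> ^ nat \<bar>j - M\<bar>" if j: "j \<in> J" for j
  proof -
    have sp: "x j powr q = x j powr \<eta> * x j powr (q - \<eta>)" by (simp add: powr_add[symmetric])
    \<comment> \<open>One of the two factors of \<open>x j powr q\<close> is enlarged to a power of
      the maximum \<open>x M\<close>: the one belonging to the lower index. Either way the result is
      a single term of \<open>T\<close>, so every \<open>x j\<close> decays geometrically away from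
      \<open>M\<close>.\<close>
    have "2 powr (e * real_of_int \<bar>j - M\<bar>) * x j powr q \<le> T"
    proof (cases "M \<le> j")
      case True
      have "x j powr q \<le> x M powr \<eta> * x j powr (q - \<eta>)"
        unfolding sp using \<eta> x M(2)[OF j] by (intro mult_right_mono powr_mono2) auto
      then have "2 powr (e * real_of_int \<bar>j - M\<bar>) * x j powr q \<le> F (M, j)"
        using True by (simp add: F_def mult_left_mono)
      also have "\<dots> \<le> T" using True j M(1) by (intro FT) (auto simp: P_def)
      finally show ?thesis .
    next
      case False
      have "x j powr q \<le> x j powr \<eta> * x M powr (q - \<eta>)"
        unfolding sp using \<eta> x M(2)[OF j] by (intro mult_left_mono powr_mono2) auto
      then have "2 powr (e * real_of_int \<bar>j - M\<bar>) * x j powr q \<le> F (j, M)"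
        using False by (simp add: F_def mult_left_mono)
      also have "\<dots> \<le> T" using False j M(1) by (intro FT) (auto simp: P_def)
      finally show ?thesis .
    qed
    then have "(2 powr (e * real_of_int \<bar>j - M\<bar>) * x j powr q) powr (1 / q) \<le> T powr (1 / q)"
      using q by (intro powr_mono2) auto
    then have "2 powr (e * real_of_int \<bar>j - M\<bar> / q) * x j \<le> T powr (1 / q)"
      using q x by (simp add: powr_mult powr_powr)
    then have "2 powr (- (e * real_of_int \<bar>j - M\<bar> / q)) * (2 powr (e * real_of_int \<bar>j - M\<bar> / q) * x j)
        \<le> 2 powr (- (e * real_of_int \<bar>j - M\<bar> / q)) * T powr (1 / q)"
      by (intro mult_left_mono) auto
    then have "x j \<le> 2 powr (- (e * real_of_int \<bar>j - M\<bar> / q)) * T powr (1 / q)"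
      by (simp add: mult.assoc[symmetric] powr_add[symmetric])
    also have "2 powr (- (e * real_of_int \<bar>j - M\<bar> / q)) = \<rho> ^ nat \<bar>j - M\<bar>"
      unfolding \<rho>_def by (simp add: powr_realpow[symmetric] powr_powr mult.commute)
    finally show ?thesis by (simp add: mult.commute)
  qed
  have "(\<Sum>j\<in>J. x j) \<le> (\<Sum>j\<in>J. T powr (1 / q) * \<rho> ^ nat \<bar>j - M\<bar>)" by (intro sum_mono xj)
  also have "\<dots> = T powr (1 / q) * (\<Sum>j\<in>J. \<rho> ^ nat \<bar>j - M\<bar>)" by (simp add: sum_distrib_left)
  also have "\<dots> \<le> T powr (1 / q) * (2 / (1 - \<rho>))"
    using sum_geometric_le(2)[OF J, of \<rho> M] \<rho> by (intro mult_left_mono) auto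
  finally have "(\<Sum>j\<in>J. x j) powr q \<le> (T powr (1 / q) * (2 / (1 - \<rho>))) powr q"
    using q x by (intro powr_mono2 sum_nonneg) auto
  also have "\<dots> = (2 / (1 - \<rho>)) powr q * T"
    using \<rho> q T0 by (simp add: powr_mult powr_powr powr_divide)
  finally show ?thesis by (simp add: \<rho>_def T_def P_def F_def case_prod_beta')
qed simp

section \<open>Measurability and linearity of the evolution\<close>

lemma meas2_ev:
  assumes [measurable]: "g \<in> borel_measurable lborel"
  shows "meas2 (ev g)"
proof -
  have "(\<lambda>z. LINT \<xi>|lborel. osc (snd z) (fst z) \<xi> * g \<xi>) \<in> borel_measurable (lborel \<Otimes>\<^sub>M lborel)"
    by (rule lborel.borel_measurable_lebesgue_integral) (simp add: case_prod_beta')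
  then show ?thesis by (simp add: ev_def case_prod_beta')
qed

lemma sqint_integrable_bounded_supp:
  fixes g :: "real \<Rightarrow> complex"
  assumes g: "sqint lborel g" and supp: "\<And>\<xi>. g \<xi> \<noteq> 0 \<Longrightarrow> \<bar>\<xi>\<bar> \<le> R"
  shows "integrable lborel g"
proof -
  have eq: "(\<lambda>\<xi>. (cmod (complex_of_real (indicator {-R..R} \<xi>)))\<^sup>2) = (indicator {-R..R} :: real \<Rightarrow> real)"
    by (auto simp: fun_eq_iff split: split_indicator)
  have "sqint lborel (\<lambda>\<xi>. complex_of_real (indicator {-R..R} \<xi>))"
    unfolding sqint_def eq by (auto simp: emeasure_lborel_Icc_eq)
  from sqint_integrable_mult[OF g this] have "integrable lborel (\<lambda>\<xi>. g \<xi> * complex_of_real (indicator {-R..R} \<xi>))" .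
  moreover have "g \<xi> * complex_of_real (indicator {-R..R} \<xi>) = g \<xi>" for \<xi>
    using supp[of \<xi>] by (cases "g \<xi> = 0") (auto split: split_indicator)
  ultimately show ?thesis by simp
qed

lemma ev_integrand_integrable:
  "integrable lborel g \<Longrightarrow> integrable lborel (\<lambda>\<xi>. osc x t \<xi> * g \<xi>)"
  by (rule Bochner_Integration.integrable_bound[of _ g]) (auto simp: norm_mult norm_exp_i_times simp del: of_real_add of_real_mult of_real_power)

lemma ev_add: "integrable lborel g \<Longrightarrow> integrable lborel h \<Longrightarrow> ev (\<lambda>\<xi>. g \<xi> + h \<xi>) x t = ev g x t + ev h x t"
  unfolding ev_def using ev_integrand_integrable by (simp add: distrib_left)

lemma ev_diff: "integrable lborel g \<Longrightarrow> integrable lborel h \<Longrightarrow> ev (\<lambda>\<xi>. g \<xi> - h \<xi>) x t = ev g x t - ev h x t"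
  unfolding ev_def using ev_integrand_integrable by (simp add: right_diff_distrib)

lemma ev_sum:
  "finite I \<Longrightarrow> (\<And>i. i \<in> I \<Longrightarrow> integrable lborel (g i)) \<Longrightarrow> ev (\<lambda>\<xi>. \<Sum>i\<in>I. g i \<xi>) x t = (\<Sum>i\<in>I. ev (g i) x t)"
  by (induction I rule: finite_induct) (auto simp: ev_add, simp add: ev_def)

lemma ev_cmult: "ev (\<lambda>\<xi>. c * g \<xi>) x t = c * ev g x t"
  unfolding ev_def by (simp add: mult.left_commute)

text \<open>In terms of the exponents of the theorem, \<open>2 / p + 1 / q = 2 / k < 1 / 2\<close> and \<open>\<beta> = 2 / k + 1 / p\<close>;
  a datum \<open>f\<close> in \<open>L^2\<close> stands for \<open>|\<xi>|^s \<phi> / sqrt (2 \<pi>)\<close>.\<close>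

locale airy_exponents =
  fixes p q :: real
  assumes p_pos: "0 < p" and q_pos: "0 < q" and subcritical: "2 / p + 1 / q < 1 / 2"
begin

text \<open>The scaling exponent: multiplying u (x / l, t / l^3) by l^(-\<beta>) leaves the mixed
  norm unchanged.\<close>

definition \<beta> :: real where "\<beta> = 1 / q + 3 / p"

text \<open>The multiplier |\<xi>|^(1/p) divided by |\<xi>|^s, since 1/p - s = \<beta> - 1/2. With
  \<open>f\<close> = |\<xi>|^s \<phi> / sqrt (2 pi), the lifted datum is |\<xi>|^(1/p) \<phi> / (2
  pi), the amplitude of the inverse Fourier transform.\<close>

definition wt :: "real \<Rightarrow> real" where "wt \<xi> = \<bar>\<xi>\<bar> powr (\<beta> - 1 / 2) / sqrt (2 * pi)"

definition lift :: "(real \<Rightarrow> complex) \<Rightarrow> real \<Rightarrow> complex" where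
  "lift f \<xi> = complex_of_real (wt \<xi>) * f \<xi>"

definition evol :: "(real \<Rightarrow> complex) \<Rightarrow> real \<Rightarrow> real \<Rightarrow> complex" where
  "evol f = ev (lift f)"

definition evol_norm :: "(real \<Rightarrow> complex) \<Rightarrow> ennreal" where
  "evol_norm f = mixed_norm p q (evol f)"

text \<open>For such data the lift is integrable, whatever the sign of \<beta> - 1/2, so the
  evolution is an absolutely convergent integral.\<close>

definition annular :: "(real \<Rightarrow> complex) \<Rightarrow> bool" where
  "annular f \<longleftrightarrow> sqint lborel f \<and> (\<exists>R>0. \<forall>\<xi>. f \<xi> \<noteq> 0 \<longrightarrow> 1 / R \<le> \<bar>\<xi>\<bar> \<and> \<bar>\<xi>\<bar> \<le> R)"

definition piece :: "(real \<Rightarrow> complex) \<Rightarrow> int \<Rightarrow> real \<Rightarrow> complex" where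
  "piece f j \<xi> = complex_of_real (indicator (band (2 powr real_of_int j)) \<xi>) * f \<xi>"

lemma p_gt: "4 < p" 
proof -
  have "0 < 1 / q" using q_pos by simp
  then have "2 / p < 1 / 2" using subcritical by linarith
  then show ?thesis using p_pos by (simp add: field_simps)
qed

lemma q_gt: "2 < q" 
proof -
  have "0 < 2 / p" using p_pos by simp
  then have "1 / q < 1 / 2" using subcritical by linarith
  then show ?thesis using q_pos by (simp add: field_simps)
qed

lemma beta_pos: "0 < \<beta>" using p_pos q_pos by (simp add: \<beta>_def add_pos_pos)

lemma beta_less: "\<beta> < 3 / 4"
proof -
  have "1 / p < 1 / 4" using p_gt by (simp add: field_simps)
  moreover have "3 / p = 2 / p + 1 / p" by (simp add: add_divide_distrib[symmetric])
  ultimately show ?thesis using subcritical unfolding \<beta>_def by linarith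
qed

lemma wt_measurable [measurable]: "wt \<in> borel_measurable borel"
  unfolding wt_def[abs_def] by measurable

lemma wt_nonneg: "0 \<le> wt \<xi>" by (simp add: wt_def)

lemma lift_measurable [measurable]: "f \<in> borel_measurable borel \<Longrightarrow> lift f \<in> borel_measurable borel"
  unfolding lift_def[abs_def] by measurable

text \<open>The exponent \<beta> - 1/2 may have either sign. Across a band the power changes by at
  most a factor 2, because \<beta> < 3/4, and sqrt (2 pi) >= 2 absorbs it.\<close>

lemma wt_band:
  assumes N: "0 < N" and \<xi>: "\<xi> \<in> band N"
  shows "wt \<xi> \<le> N powr (\<beta> - 1 / 2)"
proof -
  have x: "N \<le> \<bar>\<xi>\<bar>" "\<bar>\<xi>\<bar> < 2 * N" using \<xi> by (auto simp: band_def)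
  have "\<bar>\<xi>\<bar> powr (\<beta> - 1 / 2) \<le> 2 * N powr (\<beta> - 1 / 2)"
  proof (cases "0 \<le> \<beta> - 1 / 2")
    case True
    have "\<bar>\<xi>\<bar> powr (\<beta> - 1 / 2) \<le> (2 * N) powr (\<beta> - 1 / 2)" using True x N by (intro powr_mono2) auto
    also have "\<dots> = 2 powr (\<beta> - 1 / 2) * N powr (\<beta> - 1 / 2)" using N by (simp add: powr_mult)
    also have "2 powr (\<beta> - 1 / 2) \<le> 2 powr (1 :: real)" using beta_less by (intro powr_mono) auto
    finally show ?thesis by (simp add: mult_right_mono)
  next
    case False
    have "\<bar>\<xi>\<bar> powr (\<beta> - 1 / 2) \<le> N powr (\<beta> - 1 / 2)" using False x N by (intro powr_mono2') auto
    then show ?thesis using powr_ge_zero[of N "\<beta> - 1 / 2"] by linarith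
  qed
  moreover have "2 \<le> sqrt (2 * pi)"
  proof -
    have "sqrt (2 ^ 2) \<le> sqrt (2 * pi)" using pi_gt3 by (intro real_sqrt_le_mono) auto
    then show ?thesis by simp
  qed
  ultimately have "\<bar>\<xi>\<bar> powr (\<beta> - 1 / 2) \<le> sqrt (2 * pi) * N powr (\<beta> - 1 / 2)"
    using mult_right_mono[of 2 "sqrt (2 * pi)" "N powr (\<beta> - 1 / 2)"] by simp
  then show ?thesis by (simp add: wt_def field_simps)
qed

lemma sqint_piece: "sqint lborel f \<Longrightarrow> sqint lborel (piece f j)"
  by (rule sqint_bound[of _ f]) (auto simp: piece_def[abs_def] sqint_def norm_mult split: split_indicator)

lemma lift_piece_supp: "lift (piece f j) \<xi> \<noteq> 0 \<Longrightarrow> \<xi> \<in> band (2 powr real_of_int j)"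
  by (auto simp: lift_def piece_def split: split_indicator_asm)

lemma sqint_lift_piece:
  assumes f: "sqint lborel f"
  shows "sqint lborel (lift (piece f j))"
    and "n2 lborel (lift (piece f j)) \<le> (2 powr real_of_int j) powr (2 * \<beta> - 1) * n2 lborel (piece f j)"
proof -
  define N where "N = 2 powr real_of_int j"
  have N: "0 < N" by (simp add: N_def)
  note [measurable] = sqint_measurable[OF f]
  have b: "cmod (lift (piece f j) \<xi>) \<le> cmod (complex_of_real (N powr (\<beta> - 1 / 2)) * piece f j \<xi>)" for \<xi>
  proof (cases "\<xi> \<in> band N")
    case True
    then show ?thesis using wt_band[OF N True] wt_nonneg by (simp add: lift_def norm_mult mult_right_mono)
  qed (simp add: lift_def piece_def N_def)
  have m: "lift (piece f j) \<in> borel_measurable lborel"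
    using sqint_measurable[OF sqint_piece[OF f]] by simp
  show s: "sqint lborel (lift (piece f j))"
    by (rule sqint_bound[OF sqint_cmult[OF sqint_piece[OF f]] m b])
  have "n2 lborel (lift (piece f j)) \<le> n2 lborel (\<lambda>\<xi>. complex_of_real (N powr (\<beta> - 1 / 2)) * piece f j \<xi>)"
    by (rule n2_mono[OF sqint_cmult[OF sqint_piece[OF f]] s b])
  also have "\<dots> = (N powr (\<beta> - 1 / 2))\<^sup>2 * n2 lborel (piece f j)" by (simp add: n2_cmult)
  also have "(N powr (\<beta> - 1 / 2))\<^sup>2 = N powr (2 * \<beta> - 1)"
    by (simp add: power2_eq_square powr_add[symmetric])
  finally show "n2 lborel (lift (piece f j)) \<le> (2 powr real_of_int j) powr (2 * \<beta> - 1) * n2 lborel (piece f j)"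
    by (simp add: N_def)
qed

lemma band_dyadic_iff:
  assumes "\<xi> \<noteq> 0" shows "\<xi> \<in> band (2 powr real_of_int j) \<longleftrightarrow> j = \<lfloor>log 2 \<bar>\<xi>\<bar>\<rfloor>"
proof -
  have "\<xi> \<in> band (2 powr real_of_int j) \<longleftrightarrow> 2 powr real_of_int j \<le> \<bar>\<xi>\<bar> \<and> \<bar>\<xi>\<bar> < 2 powr (real_of_int j + 1)"
    by (simp add: band_def powr_add mult.commute)
  also have "\<dots> \<longleftrightarrow> real_of_int j \<le> log 2 \<bar>\<xi>\<bar> \<and> log 2 \<bar>\<xi>\<bar> < real_of_int j + 1"
    using assms by (simp add: le_log_iff log_less_iff)
  also have "\<dots> \<longleftrightarrow> j = \<lfloor>log 2 \<bar>\<xi>\<bar>\<rfloor>" by linarith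
  finally show ?thesis .
qed

lemma piece_sum_le:
  assumes f: "sqint lborel f" and J: "finite J"
  shows "(\<Sum>j\<in>J. n2 lborel (piece f j)) \<le> n2 lborel f"
proof -
  have "(\<Sum>j\<in>J. n2 lborel (piece f j)) = (LINT \<xi>|lborel. (\<Sum>j\<in>J. (cmod (piece f j \<xi>))\<^sup>2))"
    unfolding n2_def using sqint_piece[OF f] by (subst Bochner_Integration.integral_sum) (auto simp: sqint_def)
  also have "\<dots> \<le> n2 lborel f"
    unfolding n2_def
  proof (rule integral_mono)
    fix \<xi> :: real
    show "(\<Sum>j\<in>J. (cmod (piece f j \<xi>))\<^sup>2) \<le> (cmod (f \<xi>))\<^sup>2"
    proof (cases "\<xi> = 0")
      case True
      then show ?thesis by (simp add: piece_def band_def)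
    next
      case False
      have "(\<Sum>j\<in>J. (cmod (piece f j \<xi>))\<^sup>2) = (\<Sum>j\<in>J. if j = \<lfloor>log 2 \<bar>\<xi>\<bar>\<rfloor> then (cmod (f \<xi>))\<^sup>2 else 0)"
        by (intro sum.cong refl) (simp add: piece_def indicator_def band_dyadic_iff[OF False])
      also have "\<dots> \<le> (cmod (f \<xi>))\<^sup>2" using J by simp
      finally show ?thesis .
    qed
  qed (use sqint_piece[OF f] f in \<open>auto simp: sqint_def\<close>)
  finally show ?thesis .
qed

lemma annular_decompose:
  assumes "annular f"
  obtains J where "finite J" "\<And>\<xi>. f \<xi> = (\<Sum>j\<in>J. piece f j \<xi>)"
proof -
  obtain R where R: "0 < R" "\<And>\<xi>. f \<xi> \<noteq> 0 \<Longrightarrow> 1 / R \<le> \<bar>\<xi>\<bar> \<and> \<bar>\<xi>\<bar> \<le> R" using assms by (auto simp: annular_def)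
  define J where "J = {\<lfloor>log 2 (1 / R)\<rfloor>..\<lfloor>log 2 R\<rfloor>}"
  show ?thesis
  proof (rule that[of J])
    fix \<xi>
    show "f \<xi> = (\<Sum>j\<in>J. piece f j \<xi>)"
    proof (cases "f \<xi> = 0")
      case False
      with R have x: "1 / R \<le> \<bar>\<xi>\<bar>" "\<bar>\<xi>\<bar> \<le> R" by auto
      then have "0 < \<bar>\<xi>\<bar>" using R(1) by (meson divide_pos_pos less_le_trans zero_less_one)
      then have n: "\<xi> \<noteq> 0" by simp
      have "\<lfloor>log 2 \<bar>\<xi>\<bar>\<rfloor> \<in> J"
        unfolding J_def using x R(1) n by (auto intro!: floor_mono)
      moreover have "(\<Sum>j\<in>J. piece f j \<xi>) = (\<Sum>j\<in>J. if j = \<lfloor>log 2 \<bar>\<xi>\<bar>\<rfloor> then f \<xi> else 0)"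
        by (intro sum.cong refl) (simp add: piece_def indicator_def band_dyadic_iff[OF n])
      ultimately show ?thesis by (simp add: J_def)
    qed (simp add: piece_def)
  qed (simp add: J_def)
qed

lemma lift_sum: "lift (\<lambda>\<xi>. \<Sum>j\<in>J. F j \<xi>) = (\<lambda>\<xi>. \<Sum>j\<in>J. lift (F j) \<xi>)"
  by (simp add: lift_def fun_eq_iff sum_distrib_left)

lemma integrable_lift_piece: "sqint lborel f \<Longrightarrow> integrable lborel (lift (piece f j))"
  by (rule sqint_integrable_bounded_supp[OF sqint_lift_piece(1), of _ _ "2 * 2 powr real_of_int j"])
    (auto dest!: lift_piece_supp simp: band_def)

text \<open>In each term with i <= j of the bilinear expansion, |u_i|^\<eta> is bounded by the
  hypothesis on \<open>A\<close>, two powers of |u_j| are integrated in x by the energy bound, and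
  the other q - 2 - \<eta> powers go to the maximal estimate in t. Scaling cancels every power of
  the frequency except a decay in j - i. The sum over i is then geometric, and the sum over j is
  controlled by the total mass of the pieces.\<close>

theorem refined_Strichartz:
  obtains C \<theta> where "0 \<le> C" "0 < \<theta>" "\<And>f A. annular f \<Longrightarrow> n2 lborel f \<le> 1 \<Longrightarrow> 0 \<le> A \<Longrightarrow>
    (\<And>j x t. cmod (evol (piece f j) x t) \<le> A * 2 powr (\<beta> * real_of_int j)) \<Longrightarrow>
    enn_powr (evol_norm f) (min p q) \<le> ennreal (C * A powr \<theta>)"
proof -
  \<comment> \<open>Half of the margin q - 2 - 4 q / p, which is positive by
    \<open>subcritical\<close>; the other half makes r > 4.\<close>
  define \<eta> where "\<eta> = q * (1 / 2 - 1 / q - 2 / p)"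
  define r where "r = (q - 2 - \<eta>) * (p / q)"
  define m' where "m' = min 1 (q / p)"
  have \<eta>0: "0 < \<eta>" using q_pos subcritical by (simp add: \<eta>_def)
  have \<eta>2: "\<eta> < q - 2"
  proof -
    have "\<eta> = q / 2 - 1 - 2 * q / p" using q_pos by (simp add: \<eta>_def algebra_simps)
    moreover have "0 < 2 * q / p" using p_pos q_pos by simp
    ultimately show ?thesis using q_gt by linarith
  qed
  have r4: "4 < r"
  proof -
    have "\<eta> = q / 2 - 1 - 2 * (q / p)" using q_pos by (simp add: \<eta>_def algebra_simps)
    then have "4 * (q / p) < q - 2 - \<eta>" using \<eta>0 by linarith
    then have "4 * (q / p) * (p / q) < r" unfolding r_def using p_pos q_pos by (intro mult_strict_right_mono) auto
    then show ?thesis using p_pos q_pos by simp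
  qed
  have m': "0 < m'" "m' \<le> 1" "p * m' = min p q" using p_pos q_pos by (auto simp: m'_def min_def field_simps)
  \<comment> \<open>The bilinear inequality loses 2^(\<epsilon> (j - i)), while the factor 2^(i
    \<beta> \<eta>) gains 2^(-\<beta> \<eta> (j - i)) against scale j. Giving away half of this gain
    leaves decay at rate \<epsilon>.\<close>
  define \<epsilon> where "\<epsilon> = \<beta> * \<eta> / 2"
  have \<epsilon>: "0 < \<epsilon>" using beta_pos \<eta>0 by (simp add: \<epsilon>_def)
  define G where "G = (2 / (1 - 2 powr (- (\<epsilon> / q)))) powr q"
  obtain Z where Z: "0 \<le> Z" "\<And>N g. 0 < N \<Longrightarrow> sqint lborel g \<Longrightarrow> (\<And>\<xi>. g \<xi> \<noteq> 0 \<Longrightarrow> \<xi> \<in> band N) \<Longrightarrow>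
    \<exists>b. b \<in> borel_measurable lborel \<and> (\<forall>t. 0 \<le> b t) \<and> (\<forall>x t. cmod (ev g x t) \<le> b t) \<and>
      (\<integral>\<^sup>+ t. ennreal (b t powr r) \<partial>lborel) \<le> ennreal (1 / N ^ 3 * (Z * (N * n2 lborel g) powr (r / 2)))"
    using band_maximal_estimate[OF r4] by blast
  define D where "D = ((G * (2 * pi)) powr (p / q) * Z) powr m'"
  define \<delta> where "\<delta> = m' * (p / q) * \<epsilon>"
  have \<delta>: "0 < \<delta>" using m' p_pos q_pos \<epsilon> by (simp add: \<delta>_def)
  define \<theta> where "\<theta> = \<eta> * (p / q) * m'"
  have \<theta>: "0 < \<theta>" using m' p_pos q_pos \<eta>0 by (simp add: \<theta>_def)
  define C where "C = D * (1 / (1 - 2 powr (- \<delta>)))"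
  have \<rho>: "0 < 2 powr (- \<delta>)" "2 powr (- \<delta>) < (1 :: real)" using \<delta> by (auto simp: powr_less_one)
  have "0 \<le> C" using \<rho> by (simp add: C_def D_def)
  then show ?thesis
  proof (rule that[OF _ \<theta>])
    fix f A assume f: "annular f" and f1: "n2 lborel f \<le> 1" and A: "0 \<le> A"
      and bA: "\<And>j x t. cmod (evol (piece f j) x t) \<le> A * 2 powr (\<beta> * real_of_int j)"
    have fs: "sqint lborel f" using f by (simp add: annular_def)
    define g where "g j = lift (piece f j)" for j
    define u where "u j = ev (g j)" for j
    define c where "c j = n2 lborel (piece f j)" for j
    define N where "N j = (2 :: real) powr real_of_int j" for j
    have N: "0 < N j" for j by (simp add: N_def)
    have c0: "0 \<le> c j" for j by (simp add: c_def)
    have gs: "sqint lborel (g j)" and gn: "n2 lborel (g j) \<le> N j powr (2 * \<beta> - 1) * c j" for j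
      using sqint_lift_piece[OF fs] by (auto simp: g_def N_def c_def)
    have gsupp: "\<xi> \<in> band (N j)" if "g j \<xi> \<noteq> 0" for j \<xi> using lift_piece_supp that by (simp add: g_def N_def)
    have gi: "integrable lborel (g j)" for j unfolding g_def by (rule integrable_lift_piece[OF fs])
    have [measurable]: "g j \<in> borel_measurable lborel" for j using gs by (rule sqint_measurable)
    have ub: "cmod (u j x t) \<le> A * N j powr \<beta>" for j x t
      using bA[of j x t] by (simp add: evol_def u_def g_def N_def powr_powr mult.commute)
    obtain J where J: "finite J" "\<And>\<xi>. f \<xi> = (\<Sum>j\<in>J. piece f j \<xi>)" using annular_decompose[OF f] by blast
    have "lift f = (\<lambda>\<xi>. \<Sum>j\<in>J. g j \<xi>)"
      unfolding g_def lift_sum[symmetric] by (subst J(2)[abs_def]) simp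
    then have uS: "evol f x t = (\<Sum>j\<in>J. u j x t)" for x t
      using ev_sum[OF J(1) gi] by (simp add: evol_def u_def)
    have csum: "(\<Sum>j\<in>J. c j) \<le> 1" unfolding c_def using piece_sum_le[OF fs J(1)] f1 by linarith
    have c1: "c j \<le> 1" if "j \<in> J" for j using member_le_sum[OF that, of c] c0 J(1) csum by auto
    have "\<exists>b. b \<in> borel_measurable lborel \<and> (\<forall>t. 0 \<le> b t) \<and> (\<forall>x t. cmod (u j x t) \<le> b t) \<and>
      (\<integral>\<^sup>+ t. ennreal (b t powr r) \<partial>lborel) \<le> ennreal (1 / N j ^ 3 * (Z * (N j * n2 lborel (g j)) powr (r / 2)))" for j
      unfolding u_def using Z(2)[OF N gs gsupp] .
    then obtain b where b [measurable]: "\<And>j. b j \<in> borel_measurable lborel" and b0: "\<And>j t. 0 \<le> b j t"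
      and ub': "\<And>j x t. cmod (u j x t) \<le> b j t"
      and bint: "\<And>j. (\<integral>\<^sup>+ t. ennreal (b j t powr r) \<partial>lborel) \<le> ennreal (1 / N j ^ 3 * (Z * (N j * n2 lborel (g j)) powr (r / 2)))"
      by metis
    define P where "P = {(i, j) \<in> J \<times> J. i \<le> j}"
    have P: "finite P" unfolding P_def using J by (auto intro: finite_subset[of _ "J \<times> J"])
    define h where "h = (\<lambda>(i, j) t. G * (2 powr (\<epsilon> * real_of_int (j - i)) * ((A * N i powr \<beta>) powr \<eta> * b j t powr (q - 2 - \<eta>))))"
    have h0: "0 \<le> h z t" for z t by (auto simp: h_def G_def split: prod.split)
    have [measurable]: "h z \<in> borel_measurable lborel" for z by (cases z) (simp add: h_def)
    have pw: "cmod (evol f x t) powr q \<le> (\<Sum>z\<in>P. h z t * (cmod (u (snd z) x t))\<^sup>2)" for x t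
    proof -
      have "cmod (evol f x t) powr q \<le> (\<Sum>j\<in>J. cmod (u j x t)) powr q"
        unfolding uS using q_pos by (intro powr_mono2 norm_sum) auto
      also have "\<dots> \<le> G * (\<Sum>(i, j)\<in>P. 2 powr (\<epsilon> * real_of_int (j - i)) * (cmod (u i x t) powr \<eta> * cmod (u j x t) powr (q - \<eta>)))"
        unfolding G_def P_def using \<eta>0 \<eta>2 \<epsilon> q_pos J(1) by (intro sum_powr_le_bilinear) auto
      also have "\<dots> \<le> (\<Sum>z\<in>P. h z t * (cmod (u (snd z) x t))\<^sup>2)"
        unfolding sum_distrib_left
      proof (intro sum_mono)
        fix z :: "int \<times> int" obtain i j where z: "z = (i, j)" by fastforce
        have "cmod (u j x t) powr (q - \<eta>) = cmod (u j x t) powr (q - 2 - \<eta>) * (cmod (u j x t))\<^sup>2"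
        proof (cases "u j x t = 0")
          case False
          then have "(cmod (u j x t))\<^sup>2 = cmod (u j x t) powr 2" by simp
          then show ?thesis by (simp only: powr_add[symmetric]) (simp add: algebra_simps)
        qed simp
        also have "\<dots> \<le> b j t powr (q - 2 - \<eta>) * (cmod (u j x t))\<^sup>2"
          using ub'[of j x t] \<eta>2 by (intro mult_right_mono powr_mono2) auto
        finally have 1: "cmod (u j x t) powr (q - \<eta>) \<le> b j t powr (q - 2 - \<eta>) * (cmod (u j x t))\<^sup>2" .
        have 2: "cmod (u i x t) powr \<eta> \<le> (A * N i powr \<beta>) powr \<eta>"
          using ub[of i x t] \<eta>0 by (intro powr_mono2) auto
        have "G * (2 powr (\<epsilon> * real_of_int (j - i)) * (cmod (u i x t) powr \<eta> * cmod (u j x t) powr (q - \<eta>)))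
          \<le> G * (2 powr (\<epsilon> * real_of_int (j - i)) * ((A * N i powr \<beta>) powr \<eta> * (b j t powr (q - 2 - \<eta>) * (cmod (u j x t))\<^sup>2)))"
          using 1 2 by (intro mult_left_mono mult_mono) (auto simp: G_def)
        then show "G * (case z of (i, j) \<Rightarrow> 2 powr (\<epsilon> * real_of_int (j - i)) * (cmod (u i x t) powr \<eta> * cmod (u j x t) powr (q - \<eta>)))
          \<le> h z t * (cmod (u (snd z) x t))\<^sup>2"
          by (simp add: z h_def mult.assoc)
      qed
      finally show ?thesis .
    qed
    have en: "(\<integral>\<^sup>+ x. ennreal ((cmod (u j x t))\<^sup>2) \<partial>lborel) \<le> ennreal (2 * pi * (N j powr (2 * \<beta> - 1) * c j))" for j t
    proof -
      have "(\<integral>\<^sup>+ x. ennreal ((cmod (u j x t))\<^sup>2) \<partial>lborel) \<le> ennreal (2 * pi) * ennreal (n2 lborel (g j))"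
        unfolding u_def sqint_nn_integral[OF gs, symmetric] by (rule ev_energy[OF gi])
      also have "\<dots> \<le> ennreal (2 * pi) * ennreal (N j powr (2 * \<beta> - 1) * c j)"
        using gn by (intro mult_left_mono ennreal_leI) auto
      also have "\<dots> = ennreal (2 * pi * (N j powr (2 * \<beta> - 1) * c j))"
        using c0[of j] by (intro ennreal_mult[symmetric]) auto
      finally show ?thesis .
    qed
    define F where "F t = (\<integral>\<^sup>+ x. ennreal (cmod (evol f x t) powr q) \<partial>lborel)" for t
    define k where "k = (\<lambda>(i, j). G * 2 powr (\<epsilon> * real_of_int (j - i)) * (A * N i powr \<beta>) powr \<eta> * (2 * pi * (N j powr (2 * \<beta> - 1) * c j)))"
    have k0: "0 \<le> k z" for z using c0 by (auto simp: k_def G_def split: prod.split)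
    have Fb: "F t \<le> (\<Sum>z\<in>P. ennreal (k z) * ennreal (b (snd z) t powr (q - 2 - \<eta>)))" for t
    proof -
      have [measurable]: "(\<lambda>x. u j x t) \<in> borel_measurable lborel" for j
        unfolding u_def using meas2_inner(2)[OF meas2_ev] by auto
      have "F t \<le> (\<integral>\<^sup>+ x. ennreal (\<Sum>z\<in>P. h z t * (cmod (u (snd z) x t))\<^sup>2) \<partial>lborel)"
        unfolding F_def by (intro nn_integral_mono ennreal_leI pw)
      also have "\<dots> = (\<Sum>z\<in>P. ennreal (h z t) * (\<integral>\<^sup>+ x. ennreal ((cmod (u (snd z) x t))\<^sup>2) \<partial>lborel))"
        using h0 by (subst sum_ennreal[symmetric]) (auto simp: nn_integral_sum ennreal_mult nn_integral_cmult)
      also have "\<dots> \<le> (\<Sum>z\<in>P. ennreal (k z) * ennreal (b (snd z) t powr (q - 2 - \<eta>)))"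
      proof (intro sum_mono)
        fix z :: "int \<times> int" obtain i j where z: "z = (i, j)" by fastforce
        have "ennreal (h z t) * (\<integral>\<^sup>+ x. ennreal ((cmod (u (snd z) x t))\<^sup>2) \<partial>lborel) \<le> ennreal (h z t) * ennreal (2 * pi * (N j powr (2 * \<beta> - 1) * c j))"
          unfolding z snd_conv by (intro mult_left_mono en) auto
        also have "\<dots> = ennreal (h z t * (2 * pi * (N j powr (2 * \<beta> - 1) * c j)))"
          using h0 c0 by (intro ennreal_mult[symmetric]) auto
        also have "h z t * (2 * pi * (N j powr (2 * \<beta> - 1) * c j)) = k z * b j t powr (q - 2 - \<eta>)"
          by (simp add: h_def k_def z mult_ac)
        also have "ennreal \<dots> = ennreal (k z) * ennreal (b (snd z) t powr (q - 2 - \<eta>))"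
          using k0 by (simp add: ennreal_mult z)
        finally show "ennreal (h z t) * (\<integral>\<^sup>+ x. ennreal ((cmod (u (snd z) x t))\<^sup>2) \<partial>lborel) \<le> ennreal (k z) * ennreal (b (snd z) t powr (q - 2 - \<eta>))" .
      qed
      finally show ?thesis .
    qed
    have pq: "0 < p / q" using p_pos q_pos by simp
    \<comment> \<open>\<open>Phi\<close> is subadditive, so each pair is integrated in time
      separately. The power p/q turns the exponent q - 2 - \<eta> of \<open>b\<close> into
      r.\<close>
    have pair: "Phi (p / q) lborel (\<lambda>t. ennreal (k z) * ennreal (b (snd z) t powr (q - 2 - \<eta>)))
        \<le> ennreal (D * A powr \<theta> * (c (snd z) * (2 powr (- \<delta>)) ^ nat (snd z - fst z)))" if "z \<in> P" for z
    proof -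
      obtain i j where z: "z = (i, j)" by fastforce
      with that have ij: "i \<le> j" "i \<in> J" "j \<in> J" by (auto simp: P_def)
      have "Phi (p / q) lborel (\<lambda>t. ennreal (k z) * ennreal (b (snd z) t powr (q - 2 - \<eta>)))
        = enn_powr (enn_powr (ennreal (k z)) (p / q) * (\<integral>\<^sup>+ t. ennreal (b j t powr r) \<partial>lborel)) m'"
        using pq k0 m' unfolding Phi_def
        by (simp add: enn_powr_mult nn_integral_cmult enn_powr_ennreal powr_powr z r_def m'_def)
      also have "\<dots> \<le> enn_powr (ennreal (k z powr (p / q)) * ennreal (1 / N j ^ 3 * (Z * (N j * n2 lborel (g j)) powr (r / 2)))) m'"
        using m' k0 by (intro enn_powr_mono mult_mono bint) (auto simp: enn_powr_ennreal)
      also have "\<dots> \<le> enn_powr (ennreal (k z powr (p / q)) * ennreal (1 / N j ^ 3 * (Z * (N j powr (2 * \<beta>) * c j) powr (r / 2)))) m'"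
      proof -
        have "N j * n2 lborel (g j) \<le> N j * (N j powr (2 * \<beta> - 1) * c j)" using gn[of j] N[of j] by (intro mult_left_mono) auto
        also have "\<dots> = N j powr (2 * \<beta>) * c j" using N[of j] by (simp add: mult.assoc[symmetric] powr_mult_base)
        finally have "(N j * n2 lborel (g j)) powr (r / 2) \<le> (N j powr (2 * \<beta>) * c j) powr (r / 2)"
          using N[of j] r4 by (intro powr_mono2) auto
        then show ?thesis using m' Z(1) N[of j]
          by (intro enn_powr_mono mult_left_mono ennreal_leI) auto
      qed
      also have "\<dots> = ennreal ((k z powr (p / q) * (1 / N j ^ 3 * (Z * (N j powr (2 * \<beta>) * c j) powr (r / 2)))) powr m')"
        using N[of j] Z(1) by (subst ennreal_mult[symmetric]) (auto simp: enn_powr_ennreal)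
      also have "\<dots> \<le> ennreal (D * A powr \<theta> * (c j * (2 powr (- \<delta>)) ^ nat (j - i)))"
      proof (rule ennreal_leI)
        define d where "d = real_of_int (j - i)"
        define s where "s = real_of_int j"
        have i_eq: "real_of_int i = s - d" by (simp add: s_def d_def)
        have k_eq: "k z powr (p / q) = (G * (2 * pi)) powr (p / q) * A powr (\<eta> * (p / q)) * c j powr (p / q) *
            2 powr ((p / q) * (\<epsilon> * d + \<beta> * \<eta> * (s - d) + (2 * \<beta> - 1) * s))"
        proof -
          have "k z = (G * (2 * pi)) * A powr \<eta> * c j * 2 powr (\<epsilon> * d + \<beta> * \<eta> * (s - d) + (2 * \<beta> - 1) * s)"
            unfolding k_def z prod.case d_def[symmetric] N_def i_eq s_def[symmetric]
            using A by (simp add: powr_mult powr_powr powr_add mult_ac)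
          then show ?thesis using A c0 by (simp add: powr_mult powr_powr G_def mult_ac)
        qed
        have b_eq: "1 / N j ^ 3 * (Z * (N j powr (2 * \<beta>) * c j) powr (r / 2)) = Z * c j powr (r / 2) * 2 powr (\<beta> * r * s - 3 * s)"
        proof -
          have "N j ^ 3 = 2 powr (3 * s)" unfolding N_def s_def by (simp add: powr_powr powr_realpow[symmetric] mult.commute)
          moreover have "(N j powr (2 * \<beta>) * c j) powr (r / 2) = 2 powr (\<beta> * r * s) * c j powr (r / 2)"
            using c0 by (simp add: N_def s_def powr_mult powr_powr mult_ac)
          ultimately show ?thesis by (simp add: powr_diff)
        qed
        \<comment> \<open>Scale invariance: the coefficient of \<open>s\<close> is (p/q) (\<beta> q
          - 1) - 3, which is 0 by the choice of \<beta>. Only the decay in the index difference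
          \<open>d\<close> is left.\<close>
        have expo: "(p / q) * (\<epsilon> * d + \<beta> * \<eta> * (s - d) + (2 * \<beta> - 1) * s) + (\<beta> * r * s - 3 * s) = - ((p / q) * \<epsilon> * d)"
        proof -
          have eb: "\<beta> * \<eta> = 2 * \<epsilon>" by (simp add: \<epsilon>_def)
          have "\<beta> * r = (p / q) * (\<beta> * q - 2 * \<beta> - 2 * \<epsilon>)" unfolding r_def eb[symmetric] by (simp add: algebra_simps)
          then have "(p / q) * (\<epsilon> * d + \<beta> * \<eta> * (s - d) + (2 * \<beta> - 1) * s) + (\<beta> * r * s - 3 * s)
            = - ((p / q) * \<epsilon> * d) + ((p / q) * (\<beta> * q - 1) - 3) * s"
            unfolding eb by (simp only:) (simp add: algebra_simps)
          moreover have "(p / q) * (\<beta> * q - 1) - 3 = 0" using p_pos q_pos by (simp add: \<beta>_def field_simps)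
          ultimately show ?thesis by simp
        qed
        have "k z powr (p / q) * (1 / N j ^ 3 * (Z * (N j powr (2 * \<beta>) * c j) powr (r / 2)))
          = ((G * (2 * pi)) powr (p / q) * Z) * A powr (\<eta> * (p / q)) * c j powr (p / q + r / 2) *
            2 powr ((p / q) * (\<epsilon> * d + \<beta> * \<eta> * (s - d) + (2 * \<beta> - 1) * s) + (\<beta> * r * s - 3 * s))"
          unfolding k_eq b_eq by (simp add: powr_add mult_ac)
        also have "\<dots> = ((G * (2 * pi)) powr (p / q) * Z) * A powr (\<eta> * (p / q)) * c j powr (p / q + r / 2) * 2 powr (- ((p / q) * \<epsilon> * d))"
          unfolding expo ..
        finally have "(k z powr (p / q) * (1 / N j ^ 3 * (Z * (N j powr (2 * \<beta>) * c j) powr (r / 2)))) powr m'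
          = D * A powr \<theta> * c j powr ((p / q + r / 2) * m') * 2 powr (- \<delta> * d)"
          using Z(1) A c0 by (simp add: powr_mult powr_powr D_def \<theta>_def \<delta>_def mult_ac)
        also have "c j powr ((p / q + r / 2) * m') \<le> c j powr 1"
        proof -
          \<comment> \<open>An exponent of at least 1 together with c_j <= 1 reduces the power to
            c_j itself, which can be summed over j.\<close>
          have "1 \<le> (p / q + r / 2) * m'"
          proof (cases "q \<le> p")
            case True
            then have mq: "m' = q / p" using p_pos by (simp add: m'_def min_def)
            have "(p / q + r / 2) * m' = 1 + r / 2 * (q / p)" unfolding mq using p_pos q_pos by (simp add: field_simps)
            then show ?thesis using r4 p_pos q_pos by simp
          next
            case False
            then have "m' = 1" using p_pos by (simp add: m'_def min_def)
            then show ?thesis using r4 pq by simp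
          qed
          then show ?thesis using c0[of j] c1[OF ij(3)] by (intro powr_mono') auto
        qed
        also have "c j powr 1 = c j" using c0 by simp
        also have "2 powr (- \<delta> * d) = (2 powr (- \<delta>)) ^ nat (j - i)"
          using ij(1) by (simp add: powr_realpow[symmetric] powr_powr d_def)
        finally show "(k z powr (p / q) * (1 / N j ^ 3 * (Z * (N j powr (2 * \<beta>) * c j) powr (r / 2)))) powr m'
          \<le> D * A powr \<theta> * (c j * (2 powr (- \<delta>)) ^ nat (j - i))"
          by (simp add: D_def mult.assoc mult_left_mono mult_right_mono)
      qed
      finally show ?thesis by (simp add: z)
    qed
    have "enn_powr (evol_norm f) (min p q) = Phi (p / q) lborel F"
      unfolding evol_norm_def mixed_norm_Phi[OF p_pos q_pos] F_def[abs_def] ..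
    also have "\<dots> \<le> Phi (p / q) lborel (\<lambda>t. \<Sum>z\<in>P. ennreal (k z) * ennreal (b (snd z) t powr (q - 2 - \<eta>)))"
      using pq Fb by (intro Phi_mono) auto
    also have "\<dots> \<le> (\<Sum>z\<in>P. Phi (p / q) lborel (\<lambda>t. ennreal (k z) * ennreal (b (snd z) t powr (q - 2 - \<eta>))))"
      using pq P by (intro Phi_sum) auto
    also have "\<dots> \<le> (\<Sum>z\<in>P. ennreal (D * A powr \<theta> * (c (snd z) * (2 powr (- \<delta>)) ^ nat (snd z - fst z))))"
      by (intro sum_mono pair)
    also have "\<dots> = ennreal (\<Sum>z\<in>P. D * A powr \<theta> * (c (snd z) * (2 powr (- \<delta>)) ^ nat (snd z - fst z)))"
      using c0 by (intro sum_ennreal) (auto simp: D_def)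
    also have "\<dots> \<le> ennreal (C * A powr \<theta>)"
    proof (rule ennreal_leI)
      have "(\<Sum>z\<in>P. c (snd z) * (2 powr (- \<delta>)) ^ nat (snd z - fst z)) = (\<Sum>j\<in>J. \<Sum>i\<in>{i \<in> J. i \<le> j}. c j * (2 powr (- \<delta>)) ^ nat (j - i))"
      proof -
        have "(\<Sum>j\<in>J. \<Sum>i\<in>{i \<in> J. i \<le> j}. c j * (2 powr (- \<delta>)) ^ nat (j - i))
          = (\<Sum>w\<in>(SIGMA j:J. {i \<in> J. i \<le> j}). c (fst w) * (2 powr (- \<delta>)) ^ nat (fst w - snd w))"
          using J(1) by (subst sum.Sigma) (auto simp: case_prod_beta')
        also have "\<dots> = (\<Sum>z\<in>P. c (snd z) * (2 powr (- \<delta>)) ^ nat (snd z - fst z))"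
          by (rule sum.reindex_bij_witness[of _ prod.swap prod.swap]) (auto simp: P_def)
        finally show ?thesis by simp
      qed
      also have "\<dots> = (\<Sum>j\<in>J. c j * (\<Sum>i\<in>{i \<in> J. i \<le> j}. (2 powr (- \<delta>)) ^ nat (j - i)))"
        by (simp add: sum_distrib_left)
      also have "\<dots> \<le> (\<Sum>j\<in>J. c j * (1 / (1 - 2 powr (- \<delta>))))"
        using \<rho> c0 J(1) by (intro sum_mono mult_left_mono sum_geometric_le) auto
      also have "\<dots> = (\<Sum>j\<in>J. c j) * (1 / (1 - 2 powr (- \<delta>)))" by (simp only: sum_distrib_right)
      also have "\<dots> \<le> 1 * (1 / (1 - 2 powr (- \<delta>)))" using csum \<rho> by (intro mult_right_mono) auto
      finally have "D * A powr \<theta> * (\<Sum>z\<in>P. c (snd z) * (2 powr (- \<delta>)) ^ nat (snd z - fst z)) \<le> D * A powr \<theta> * (1 * (1 / (1 - 2 powr (- \<delta>))))"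
        by (intro mult_left_mono) (auto simp: D_def)
      then show "(\<Sum>z\<in>P. D * A powr \<theta> * (c (snd z) * (2 powr (- \<delta>)) ^ nat (snd z - fst z))) \<le> C * A powr \<theta>"
        by (simp add: sum_distrib_left C_def mult_ac)
    qed
    finally show "enn_powr (evol_norm f) (min p q) \<le> ennreal (C * A powr \<theta>)" .
  qed
qed

section \<open>Symmetries and the best constant\<close>

lemma annular_sqint: "annular f \<Longrightarrow> sqint lborel f" by (simp add: annular_def)

lemma lift_diff: "lift (\<lambda>\<xi>. f \<xi> - g \<xi>) = (\<lambda>\<xi>. lift f \<xi> - lift g \<xi>)"
  by (simp add: lift_def fun_eq_iff right_diff_distrib)

lemma lift_cmult: "lift (\<lambda>\<xi>. c * f \<xi>) = (\<lambda>\<xi>. c * lift f \<xi>)"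
  by (simp add: lift_def fun_eq_iff)

lemma annular_lift:
  assumes "annular f" shows "integrable lborel (lift f)" "sqint lborel (lift f)"
proof -
  obtain J where J: "finite J" "\<And>\<xi>. f \<xi> = (\<Sum>j\<in>J. piece f j \<xi>)" using annular_decompose[OF assms] by blast
  have "lift f = lift (\<lambda>\<xi>. \<Sum>j\<in>J. piece f j \<xi>)" by (subst J(2)[abs_def]) simp
  then have eq: "lift f = (\<lambda>\<xi>. \<Sum>j\<in>J. lift (piece f j) \<xi>)" by (simp add: lift_sum)
  show "integrable lborel (lift f)" unfolding eq
    using integrable_lift_piece[OF annular_sqint[OF assms]] by (intro Bochner_Integration.integrable_sum)
  show "sqint lborel (lift f)" unfolding eq
    using sqint_lift_piece(1)[OF annular_sqint[OF assms]] J(1) by (intro sqint_sum)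
qed

lemma annular_common_radius:
  assumes "annular f" "annular g"
  obtains R where "0 < R" "\<And>\<xi>. f \<xi> \<noteq> 0 \<or> g \<xi> \<noteq> 0 \<Longrightarrow> 1 / R \<le> \<bar>\<xi>\<bar> \<and> \<bar>\<xi>\<bar> \<le> R"
proof -
  obtain R1 where R1: "0 < R1" "\<And>\<xi>. f \<xi> \<noteq> 0 \<Longrightarrow> 1 / R1 \<le> \<bar>\<xi>\<bar> \<and> \<bar>\<xi>\<bar> \<le> R1"
    using assms(1) by (auto simp: annular_def)
  obtain R2 where R2: "0 < R2" "\<And>\<xi>. g \<xi> \<noteq> 0 \<Longrightarrow> 1 / R2 \<le> \<bar>\<xi>\<bar> \<and> \<bar>\<xi>\<bar> \<le> R2"
    using assms(2) by (auto simp: annular_def)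
  have "1 / max R1 R2 \<le> 1 / R1" "1 / max R1 R2 \<le> 1 / R2" using R1(1) R2(1) by (auto intro!: divide_left_mono)
  then show ?thesis using R1 R2 by (intro that[of "max R1 R2"]) fastforce+
qed

lemma annular_add:
  assumes "annular f" "annular g" shows "annular (\<lambda>\<xi>. f \<xi> + g \<xi>)"
proof -
  obtain R where "0 < R" "\<And>\<xi>. f \<xi> \<noteq> 0 \<or> g \<xi> \<noteq> 0 \<Longrightarrow> 1 / R \<le> \<bar>\<xi>\<bar> \<and> \<bar>\<xi>\<bar> \<le> R"
    using annular_common_radius[OF assms] by blast
  then have "\<forall>\<xi>. f \<xi> + g \<xi> \<noteq> 0 \<longrightarrow> 1 / R \<le> \<bar>\<xi>\<bar> \<and> \<bar>\<xi>\<bar> \<le> R" by (metis add.right_neutral)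
  with \<open>0 < R\<close> show ?thesis using assms unfolding annular_def by (auto intro: sqint_add)
qed

lemma annular_cmult: "annular f \<Longrightarrow> annular (\<lambda>\<xi>. c * f \<xi>)"
  unfolding annular_def by (auto intro: sqint_cmult)

lemma annular_diff: "annular f \<Longrightarrow> annular g \<Longrightarrow> annular (\<lambda>\<xi>. f \<xi> - g \<xi>)"
  using annular_add[of f "\<lambda>\<xi>. -1 * g \<xi>"] annular_cmult[of g "-1"] by simp

lemma evol_diff: "annular f \<Longrightarrow> annular g \<Longrightarrow> evol (\<lambda>\<xi>. f \<xi> - g \<xi>) x t = evol f x t - evol g x t"
  by (simp add: evol_def lift_diff ev_diff annular_lift)

lemma evol_cmult: "evol (\<lambda>\<xi>. c * f \<xi>) x t = c * evol f x t"
  by (simp add: evol_def lift_cmult ev_cmult)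

lemma meas2_S: "f \<in> borel_measurable lborel \<Longrightarrow> meas2 (evol f)"
  unfolding evol_def by (intro meas2_ev) simp

lemma mixed_norm_cmult:
  assumes "meas2 u" shows "mixed_norm p q (\<lambda>x t. c * u x t) = ennreal (cmod c) * mixed_norm p q u"
proof -
  note [measurable] = meas2_inner(2)[OF assms] meas2_inner(1)[OF assms]
  have q: "(\<integral>\<^sup>+ x. ennreal (cmod (c * u x t) powr q) \<partial>lborel) = ennreal (cmod c powr q) * (\<integral>\<^sup>+ x. ennreal (cmod (u x t) powr q) \<partial>lborel)" for t
    by (subst nn_integral_cmult[symmetric]) (auto simp: norm_mult powr_mult ennreal_mult)
  have pq: "0 < p / q" using p_pos q_pos by simp
  have e: "enn_powr (ennreal (cmod c powr q)) (p / q) = enn_powr (ennreal (cmod c)) p"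
    using q_pos by (simp add: enn_powr_ennreal powr_powr)
  show ?thesis unfolding mixed_norm_def q using pq p_pos
    by (simp add: enn_powr_mult e nn_integral_cmult enn_powr_powr)
qed

lemma evol_norm_cmult: "annular f \<Longrightarrow> evol_norm (\<lambda>\<xi>. c * f \<xi>) = ennreal (cmod c) * evol_norm f"
  unfolding evol_norm_def evol_cmult by (rule mixed_norm_cmult[OF meas2_S[OF sqint_measurable[OF annular_sqint]]])

lemma evol_norm_triangle:
  assumes "annular f" "annular g" shows "evol_norm f \<le> evol_norm g + evol_norm (\<lambda>\<xi>. f \<xi> - g \<xi>)"
proof -
  have "evol_norm f = mixed_norm p q (\<lambda>x t. evol g x t + evol (\<lambda>\<xi>. f \<xi> - g \<xi>) x t)"
    unfolding evol_norm_def by (intro arg_cong[where f = "mixed_norm p q"]) (simp add: evol_diff[OF assms] fun_eq_iff)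
  also have "\<dots> \<le> evol_norm g + evol_norm (\<lambda>\<xi>. f \<xi> - g \<xi>)"
    unfolding evol_norm_def using p_gt q_gt assms
    by (intro mixed_norm_triangle meas2_S sqint_measurable annular_sqint annular_diff) auto
  finally show ?thesis .
qed

text \<open>The unrefined Strichartz inequality: for data in the unit ball Bernstein's inequality
  always permits \<open>A\<close> = sqrt 120.\<close>

lemma evol_norm_bounded:
  obtains K where "0 \<le> K" "\<And>f. annular f \<Longrightarrow> n2 lborel f \<le> 1 \<Longrightarrow> evol_norm f \<le> ennreal K"
proof -
  obtain C \<theta> where C: "0 \<le> C" "\<And>f A. annular f \<Longrightarrow> n2 lborel f \<le> 1 \<Longrightarrow> 0 \<le> A \<Longrightarrow>
    (\<And>j x t. cmod (evol (piece f j) x t) \<le> A * 2 powr (\<beta> * real_of_int j)) \<Longrightarrow>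
    enn_powr (evol_norm f) (min p q) \<le> ennreal (C * A powr \<theta>)"
    using refined_Strichartz by metis
  define m where "m = min p q"
  have m: "0 < m" using p_pos q_pos by (simp add: m_def)
  define B where "B = C * sqrt 120 powr \<theta>"
  show ?thesis
  proof (rule that[of "B powr (1 / m)"])
    fix f assume f: "annular f" and f1: "n2 lborel f \<le> 1"
    note fs = annular_sqint[OF f]
    have "cmod (evol (piece f j) x t) \<le> sqrt 120 * 2 powr (\<beta> * real_of_int j)" for j x t
    proof -
      define N where "N = 2 powr real_of_int j"
      have N: "0 < N" by (simp add: N_def)
      have "(cmod (evol (piece f j) x t))\<^sup>2 \<le> 120 * N * n2 lborel (lift (piece f j))"
        unfolding evol_def by (rule band_ev_bound[OF N sqint_lift_piece(1)[OF fs]]) (use lift_piece_supp N_def in auto)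
      also have "\<dots> \<le> 120 * N * (N powr (2 * \<beta> - 1) * 1)"
      proof -
        have "n2 lborel (piece f j) \<le> n2 lborel f" using piece_sum_le[OF fs, of "{j}"] by simp
        then have "n2 lborel (piece f j) \<le> 1" using f1 by simp
        then have "N powr (2 * \<beta> - 1) * n2 lborel (piece f j) \<le> N powr (2 * \<beta> - 1) * 1" by (intro mult_left_mono) auto
        then have "n2 lborel (lift (piece f j)) \<le> N powr (2 * \<beta> - 1) * 1"
          using order_trans[OF sqint_lift_piece(2)[OF fs, of j]] unfolding N_def by blast
        then show ?thesis using N by (intro mult_left_mono) auto
      qed
      also have "\<dots> = 120 * N powr (2 * \<beta>)" using N by (simp add: powr_mult_base)
      also have "\<dots> = (sqrt 120 * N powr \<beta>)\<^sup>2" using N by (simp add: power_mult_distrib powr_power mult.commute)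
      finally have "cmod (evol (piece f j) x t) \<le> sqrt 120 * N powr \<beta>" by (rule power2_le_imp_le) simp
      then show ?thesis by (simp add: N_def powr_powr mult.commute)
    qed
    then have "enn_powr (evol_norm f) m \<le> ennreal B" unfolding B_def m_def using f f1 by (intro C(2)) auto
    then have "enn_powr (enn_powr (evol_norm f) m) (1 / m) \<le> enn_powr (ennreal B) (1 / m)"
      using m by (intro enn_powr_mono) auto
    then show "evol_norm f \<le> ennreal (B powr (1 / m))"
      using m C(1) by (simp add: enn_powr_powr enn_powr_ennreal B_def)
  qed simp
qed

definition best_const :: ennreal where
  "best_const = (SUP f\<in>{f. annular f \<and> n2 lborel f \<le> 1}. evol_norm f)"

lemma best_const_finite: "best_const < top"
proof -
  obtain K where "0 \<le> K" "\<And>f. annular f \<Longrightarrow> n2 lborel f \<le> 1 \<Longrightarrow> evol_norm f \<le> ennreal K" using evol_norm_bounded by metis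
  then have "best_const \<le> ennreal K" unfolding best_const_def by (auto intro: SUP_least)
  then show ?thesis by (simp add: order.strict_trans1)
qed

text \<open>Homogeneity. Normalising by sqrt (n2 + e) and letting e tend to 0 treats data of norm
  zero on the same footing.\<close>

lemma evol_norm_le:
  assumes f: "annular f" shows "evol_norm f \<le> best_const * ennreal (sqrt (n2 lborel f))"
proof -
  obtain M' where M': "best_const = ennreal M'" "0 \<le> M'" using best_const_finite by (cases best_const) auto
  have pos: "evol_norm f \<le> ennreal (M' * sqrt (n2 lborel f + e))" if e: "0 < e" for e
  proof -
    define a where "a = sqrt (n2 lborel f + e)"
    have a: "0 < a" using e n2_nonneg[of lborel f] by (simp add: a_def add_nonneg_pos)
    have "n2 lborel (\<lambda>\<xi>. complex_of_real (1 / a) * f \<xi>) = n2 lborel f / (n2 lborel f + e)"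
      unfolding n2_cmult using a e n2_nonneg[of lborel f] by (simp add: norm_divide power_divide a_def)
    also have "\<dots> \<le> 1"
    proof -
      have "0 < n2 lborel f + e" using e by (simp add: add_nonneg_pos)
      then show ?thesis using e by (simp add: divide_le_eq_1_pos)
    qed
    finally have "evol_norm (\<lambda>\<xi>. complex_of_real (1 / a) * f \<xi>) \<le> best_const"
      unfolding best_const_def using annular_cmult[OF f] by (intro SUP_upper) blast
    then have "ennreal (1 / a) * evol_norm f \<le> best_const" using evol_norm_cmult[OF f, of "complex_of_real (1 / a)"] a by (simp add: norm_divide)
    then have "ennreal a * (ennreal (1 / a) * evol_norm f) \<le> ennreal a * best_const" by (intro mult_left_mono) auto
    moreover have "ennreal a * (ennreal (1 / a) * evol_norm f) = evol_norm f"
      using a by (simp add: mult.assoc[symmetric] ennreal_mult[symmetric])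
    ultimately show ?thesis using a M' by (simp add: ennreal_mult[symmetric] a_def mult.commute)
  qed
  have "evol_norm f \<le> ennreal (M' * sqrt (n2 lborel f + 0))"
  proof (rule tendsto_lowerbound)
    show "((\<lambda>n. ennreal (M' * sqrt (n2 lborel f + 1 / real (Suc n)))) \<longlongrightarrow> ennreal (M' * sqrt (n2 lborel f + 0))) sequentially"
      by (intro tendsto_ennrealI tendsto_intros LIMSEQ_Suc[OF lim_1_over_n])
    show "\<forall>\<^sub>F n in sequentially. evol_norm f \<le> ennreal (M' * sqrt (n2 lborel f + 1 / real (Suc n)))"
      using pos by (intro always_eventually allI) simp
  qed simp
  then show ?thesis using M' by (simp add: ennreal_mult)
qed

text \<open>The unitary dilation and the space-time translation, seen on the Fourier side. The
  translation phase uses the dilated frequency, so \<open>x0\<close> and \<open>t0\<close> are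
  coordinates of the evolution before rescaling: the origin is mapped to the point (x0, t0).\<close>

definition sym :: "real \<Rightarrow> real \<Rightarrow> real \<Rightarrow> (real \<Rightarrow> complex) \<Rightarrow> real \<Rightarrow> complex" where
  "sym l x0 t0 f \<xi> = complex_of_real (sqrt l) * exp (\<i> * complex_of_real (x0 * (l * \<xi>) + t0 * (l * \<xi>) ^ 3)) * f (l * \<xi>)"

lemma cmod_sym: "0 < l \<Longrightarrow> cmod (sym l x0 t0 f \<xi>) = sqrt l * cmod (f (l * \<xi>))"
  unfolding sym_def norm_mult norm_exp_i_times by simp

lemma n2_sym:
  assumes l: "0 < l" shows "n2 lborel (sym l x0 t0 f) = n2 lborel f"
proof -
  have "n2 lborel f = \<bar>l\<bar> *\<^sub>R (LINT \<xi>|lborel. (cmod (f (0 + l * \<xi>)))\<^sup>2)"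
    unfolding n2_def using l by (intro lborel_integral_real_affine) auto
  then show ?thesis using l by (simp add: n2_def cmod_sym[OF l] power_mult_distrib)
qed

lemma annular_sym:
  assumes l: "0 < l" and f: "annular f" shows "annular (sym l x0 t0 f)"
proof -
  have fs: "sqint lborel f" using f by (rule annular_sqint)
  then have [measurable]: "f \<in> borel_measurable borel" by (simp add: sqint_def)
  obtain R where R: "0 < R" "\<And>\<xi>. f \<xi> \<noteq> 0 \<Longrightarrow> 1 / R \<le> \<bar>\<xi>\<bar> \<and> \<bar>\<xi>\<bar> \<le> R" using f by (auto simp: annular_def)
  have "sqint lborel (sym l x0 t0 f)"
    unfolding sqint_def
  proof
    show "sym l x0 t0 f \<in> borel_measurable lborel" unfolding sym_def[abs_def] by measurable
    have "integrable lborel (\<lambda>\<xi>. (cmod (f (0 + l * \<xi>)))\<^sup>2)"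
      using fs l by (intro lborel_integrable_real_affine) (auto simp: sqint_def)
    then show "integrable lborel (\<lambda>\<xi>. (cmod (sym l x0 t0 f \<xi>))\<^sup>2)"
      by (simp add: cmod_sym[OF l] power_mult_distrib)
  qed
  moreover have "1 / (R * max l (1 / l)) \<le> \<bar>\<xi>\<bar> \<and> \<bar>\<xi>\<bar> \<le> R * max l (1 / l)" if "sym l x0 t0 f \<xi> \<noteq> 0" for \<xi>
  proof -
    have "f (l * \<xi>) \<noteq> 0" using that by (auto simp: sym_def)
    then have *: "1 / R \<le> l * \<bar>\<xi>\<bar>" "l * \<bar>\<xi>\<bar> \<le> R" using R(2)[of "l * \<xi>"] l by (auto simp: abs_mult)
    have "\<bar>\<xi>\<bar> \<le> R * (1 / l)" using *(2) l by (simp add: field_simps)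
    also have "\<dots> \<le> R * max l (1 / l)" using R(1) by (intro mult_left_mono) auto
    finally have 1: "\<bar>\<xi>\<bar> \<le> R * max l (1 / l)" .
    have "1 / (R * max l (1 / l)) \<le> 1 / (R * l)"
      using R(1) l by (intro divide_left_mono mult_left_mono) (auto simp: less_max_iff_disj)
    also have "\<dots> \<le> \<bar>\<xi>\<bar>" using *(1) R(1) l by (simp add: field_simps)
    finally show ?thesis using 1 by simp
  qed
  moreover have "0 < R * max l (1 / l)" using R(1) l by (auto simp: less_max_iff_disj)
  ultimately show ?thesis unfolding annular_def by blast
qed

lemma evol_sym:
  assumes l: "0 < l"
  shows "evol (sym l x0 t0 f) x t = complex_of_real (l powr (- \<beta>)) * evol f (x0 + 1 / l * x) (t0 + 1 / l ^ 3 * t)"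
proof -
  define G where "G \<eta> = exp (\<i> * complex_of_real ((x0 + 1 / l * x) * \<eta> + (t0 + 1 / l ^ 3 * t) * \<eta> ^ 3)) * lift f \<eta>" for \<eta>
  have "evol f (x0 + 1 / l * x) (t0 + 1 / l ^ 3 * t) = \<bar>l\<bar> *\<^sub>R (LINT \<xi>|lborel. G (0 + l * \<xi>))"
    unfolding evol_def ev_def G_def using l by (intro lborel_integral_real_affine) auto
  also have "(LINT \<xi>|lborel. G (0 + l * \<xi>)) = (LINT \<xi>|lborel. complex_of_real (l powr (\<beta> - 1)) * (osc x t \<xi> * lift (sym l x0 t0 f) \<xi>))"
  proof (intro Bochner_Integration.integral_cong refl)
    fix \<xi>
    have e: "exp (\<i> * complex_of_real ((x0 + 1 / l * x) * (l * \<xi>) + (t0 + 1 / l ^ 3 * t) * (l * \<xi>) ^ 3))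
      = osc x t \<xi> * exp (\<i> * complex_of_real (x0 * (l * \<xi>) + t0 * (l * \<xi>) ^ 3))"
    proof -
      have "(x0 + 1 / l * x) * (l * \<xi>) + (t0 + 1 / l ^ 3 * t) * (l * \<xi>) ^ 3 = (x * \<xi> + t * \<xi> ^ 3) + (x0 * (l * \<xi>) + t0 * (l * \<xi>) ^ 3)"
        using l by (simp add: power_mult_distrib) (simp add: field_simps)
      then show ?thesis by (simp only: of_real_add distrib_left exp_add)
    qed
    have w: "wt (l * \<xi>) = l powr (\<beta> - 1) * sqrt l * wt \<xi>"
    proof -
      have "l powr (\<beta> - 1) * sqrt l = l powr (\<beta> - 1 / 2)"
        using l by (simp add: powr_half_sqrt[symmetric] powr_add[symmetric])
      then show ?thesis using l by (simp add: wt_def abs_mult powr_mult)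
    qed
    show "G (0 + l * \<xi>) = complex_of_real (l powr (\<beta> - 1)) * (osc x t \<xi> * lift (sym l x0 t0 f) \<xi>)"
      unfolding G_def lift_def sym_def add_0 e w of_real_mult[of "l powr (\<beta> - 1) * sqrt l"] of_real_mult[of "l powr (\<beta> - 1)"] by (simp only: mult_ac)
  qed
  also have "\<dots> = complex_of_real (l powr (\<beta> - 1)) * evol (sym l x0 t0 f) x t"
    by (simp add: evol_def ev_def)
  finally have eq: "evol f (x0 + 1 / l * x) (t0 + 1 / l ^ 3 * t) = complex_of_real (l * l powr (\<beta> - 1)) * evol (sym l x0 t0 f) x t"
    using l by (simp add: scaleR_conv_of_real mult.assoc)
  have "l powr (- \<beta>) * (l * l powr (\<beta> - 1)) = 1"
    using l by (simp add: powr_mult_base powr_add[symmetric])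
  then have "complex_of_real (l powr (- \<beta>)) * complex_of_real (l * l powr (\<beta> - 1)) = 1"
    by (metis of_real_1 of_real_mult)
  then show ?thesis unfolding eq mult.assoc[symmetric] by simp
qed

text \<open>The changes of variables in x and t produce l and l^3; the factor l^(-\<beta>) from
  \<open>evol_sym\<close> compensates them because (1 - \<beta> q) p / q = -3.\<close>

lemma evol_norm_sym:
  assumes l: "0 < l" and f: "annular f" shows "evol_norm (sym l x0 t0 f) = evol_norm f"
proof -
  define I where "I t = (\<integral>\<^sup>+ x. ennreal (cmod (evol f x t) powr q) \<partial>lborel)" for t
  have m: "meas2 (evol f)" by (rule meas2_S[OF sqint_measurable[OF annular_sqint[OF f]]])
  note [measurable] = meas2_inner(2)[OF m, simplified]
  have [measurable]: "I \<in> borel_measurable borel" using meas2_inner(1)[OF m, of q] by (simp add: I_def[abs_def])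
  have pq: "0 < p / q" using p_pos q_pos by simp
  have q1: "(\<integral>\<^sup>+ x. ennreal (cmod (evol (sym l x0 t0 f) x t) powr q) \<partial>lborel) = ennreal (l powr (1 - \<beta> * q)) * I (t0 + 1 / l ^ 3 * t)" for t
  proof -
    have "I (t0 + 1 / l ^ 3 * t) = ennreal \<bar>1 / l\<bar> * (\<integral>\<^sup>+ x. ennreal (cmod (evol f (x0 + 1 / l * x) (t0 + 1 / l ^ 3 * t)) powr q) \<partial>lborel)"
      unfolding I_def using l by (intro nn_integral_real_affine) auto
    then have "ennreal (l powr (1 - \<beta> * q)) * I (t0 + 1 / l ^ 3 * t) = (ennreal (l powr (1 - \<beta> * q)) * ennreal (1 / l)) * (\<integral>\<^sup>+ x. ennreal (cmod (evol f (x0 + 1 / l * x) (t0 + 1 / l ^ 3 * t)) powr q) \<partial>lborel)"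
      using l by (simp add: mult.assoc)
    also have "ennreal (l powr (1 - \<beta> * q)) * ennreal (1 / l) = ennreal (l powr (- \<beta> * q))"
      using l by (simp add: ennreal_mult[symmetric] powr_diff powr_minus_divide)
    also have "\<dots> * (\<integral>\<^sup>+ x. ennreal (cmod (evol f (x0 + 1 / l * x) (t0 + 1 / l ^ 3 * t)) powr q) \<partial>lborel)
      = (\<integral>\<^sup>+ x. ennreal (cmod (evol (sym l x0 t0 f) x t) powr q) \<partial>lborel)"
      unfolding evol_sym[OF l] using l
      by (subst nn_integral_cmult[symmetric]) (auto simp: norm_mult powr_mult powr_powr ennreal_mult intro!: nn_integral_cong)
    finally show ?thesis by simp
  qed
  have "(\<integral>\<^sup>+ t. enn_powr (ennreal (l powr (1 - \<beta> * q)) * I (t0 + 1 / l ^ 3 * t)) (p / q) \<partial>lborel)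
    = ennreal (l powr ((1 - \<beta> * q) * (p / q))) * (\<integral>\<^sup>+ t. enn_powr (I (t0 + 1 / l ^ 3 * t)) (p / q) \<partial>lborel)"
    using pq by (subst nn_integral_cmult[symmetric]) (auto simp: enn_powr_mult enn_powr_ennreal powr_powr)
  also have "ennreal (l powr ((1 - \<beta> * q) * (p / q))) = ennreal (1 / l ^ 3)"
  proof -
    have "(1 - \<beta> * q) * (p / q) = - 3" using p_pos q_pos by (simp add: \<beta>_def field_simps)
    then show ?thesis using l by (simp add: powr_minus_divide)
  qed
  also have "\<dots> * (\<integral>\<^sup>+ t. enn_powr (I (t0 + 1 / l ^ 3 * t)) (p / q) \<partial>lborel) = (\<integral>\<^sup>+ t. enn_powr (I t) (p / q) \<partial>lborel)"
    using l pq nn_integral_real_affine[of "\<lambda>t. enn_powr (I t) (p / q)" "1 / l ^ 3" t0] by simp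
  finally show ?thesis unfolding evol_norm_def mixed_norm_def q1 I_def by simp
qed

text \<open>A dyadic dilation carries the j-th band exactly onto the zeroth one.\<close>

lemma piece_sym:
  assumes "l = 2 powr real_of_int j"
  shows "piece (sym l x0 t0 f) 0 = sym l x0 t0 (piece f j)"
proof
  fix \<xi>
  have l: "0 < l" using assms by simp
  have "indicator (band (2 powr real_of_int 0)) \<xi> = (indicator (band l) (l * \<xi>) :: real)"
    using l by (auto simp: band_def indicator_def abs_mult)
  then show "piece (sym l x0 t0 f) 0 \<xi> = sym l x0 t0 (piece f j) \<xi>"
    by (simp add: piece_def sym_def assms[symmetric])
qed

text \<open>If all pieces were small in the scaled sup norm, the refined inequality would push the
  evolution norm below c. Hence some piece is large at some point, and a symmetry moves that piece
  to band 0 and that point to the origin.\<close>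

lemma normalise_nonvanishing:
  assumes "0 < c"
  obtains A where "0 < A" "\<And>f. annular f \<Longrightarrow> n2 lborel f \<le> 1 \<Longrightarrow> ennreal c \<le> evol_norm f \<Longrightarrow>
    \<exists>g. annular g \<and> n2 lborel g = n2 lborel f \<and> evol_norm g = evol_norm f \<and> A \<le> cmod (evol (piece g 0) 0 0)"
proof -
  obtain C \<theta> where C: "0 \<le> C" "0 < \<theta>" "\<And>f A. annular f \<Longrightarrow> n2 lborel f \<le> 1 \<Longrightarrow> 0 \<le> A \<Longrightarrow>
    (\<And>j x t. cmod (evol (piece f j) x t) \<le> A * 2 powr (\<beta> * real_of_int j)) \<Longrightarrow>
    enn_powr (evol_norm f) (min p q) \<le> ennreal (C * A powr \<theta>)"
    using refined_Strichartz by metis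
  define m where "m = min p q"
  have m: "0 < m" using p_pos q_pos by (simp add: m_def)
  \<comment> \<open>Chosen so that C A^\<theta> = c^m C / (2 (C + 1)), strictly below c^m even when
    C = 0.\<close>
  define A where "A = (c powr m / (2 * (C + 1))) powr (1 / \<theta>)"
  have A: "0 < A" using assms C(1) by (simp add: A_def)
  have CA: "C * A powr \<theta> < c powr m"
  proof -
    have "C * A powr \<theta> = C * (c powr m / (2 * (C + 1)))" using C assms by (simp add: A_def powr_powr)
    also have "\<dots> = c powr m * (C / (2 * (C + 1)))" by simp
    also have "\<dots> < c powr m * 1" using C(1) assms by (intro mult_strict_left_mono) auto
    finally show ?thesis by simp
  qed
  show ?thesis
  proof (rule that[OF A])
    fix f assume f: "annular f" and f1: "n2 lborel f \<le> 1" and Xf: "ennreal c \<le> evol_norm f"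
    have "\<exists>j x t. A * 2 powr (\<beta> * real_of_int j) < cmod (evol (piece f j) x t)"
    proof (rule ccontr)
      assume "\<not> ?thesis"
      then have "enn_powr (evol_norm f) m \<le> ennreal (C * A powr \<theta>)"
        unfolding m_def using A by (intro C(3)[OF f f1]) (auto simp: not_less)
      moreover have "ennreal (c powr m) \<le> enn_powr (evol_norm f) m"
        using enn_powr_mono[OF _ Xf, of m] m assms by (simp add: enn_powr_ennreal)
      ultimately have "ennreal (c powr m) \<le> ennreal (C * A powr \<theta>)" by (rule order_trans[rotated])
      then show False using CA C(1) by (simp add: ennreal_le_iff)
    qed
    then obtain j x t where jxt: "A * 2 powr (\<beta> * real_of_int j) < cmod (evol (piece f j) x t)" by blast
    define l where "l = 2 powr real_of_int j"
    have l: "0 < l" by (simp add: l_def)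
    have "evol (piece (sym l x t f) 0) 0 0 = complex_of_real (l powr (- \<beta>)) * evol (piece f j) x t"
      unfolding piece_sym[OF l_def] evol_sym[OF l] by simp
    then have "cmod (evol (piece (sym l x t f) 0) 0 0) = l powr (- \<beta>) * cmod (evol (piece f j) x t)"
      by (simp add: norm_mult)
    also have "\<dots> \<ge> l powr (- \<beta>) * (A * 2 powr (\<beta> * real_of_int j))"
      using jxt by (intro mult_left_mono) auto
    also have "l powr (- \<beta>) * (A * 2 powr (\<beta> * real_of_int j)) = A"
      by (simp add: l_def powr_powr powr_minus_divide mult.commute)
    finally show "\<exists>g. annular g \<and> n2 lborel g = n2 lborel f \<and> evol_norm g = evol_norm f \<and> A \<le> cmod (evol (piece g 0) 0 0)"
      using annular_sym[OF l f] n2_sym[OF l] evol_norm_sym[OF l f] by blast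
  qed
qed

end

section \<open>Local compactness\<close>

lemma AE_subseq_of_n2_tendsto_0:
  assumes v: "\<And>n. sqint N (v n)" and lim: "(\<lambda>n. n2 N (v n)) \<longlonglongrightarrow> 0"
  obtains r :: "nat \<Rightarrow> nat" where "strict_mono r" "AE w in N. (\<lambda>n. v (r n) w) \<longlonglongrightarrow> 0"
proof -
  have "\<exists>r::nat\<Rightarrow>nat. strict_mono r \<and> (AE w in N. (\<lambda>n. (cmod (v (r n) w))\<^sup>2) \<longlonglongrightarrow> 0)"
    using v lim by (intro tendsto_L1_AE_subseq) (auto simp: sqint_def n2_def)
  then obtain r :: "nat \<Rightarrow> nat" where r: "strict_mono r" "AE w in N. (\<lambda>n. (cmod (v (r n) w))\<^sup>2) \<longlonglongrightarrow> 0" by blast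
  from r(2) have "AE w in N. (\<lambda>n. v (r n) w) \<longlonglongrightarrow> 0"
  proof eventually_elim
    case (elim w)
    from tendsto_real_sqrt[OF this] have "(\<lambda>n. cmod (v (r n) w)) \<longlonglongrightarrow> 0" by simp
    then show ?case by (rule tendsto_norm_zero_cancel)
  qed
  with r(1) show ?thesis by (rule that)
qed

lemma nn_integral_std_normal_le:
  assumes [measurable]: "h \<in> borel_measurable borel"
  shows "(\<integral>\<^sup>+ t. h t \<partial>std_normal_distribution) \<le> (\<integral>\<^sup>+ t. h t \<partial>lborel)"
proof -
  have "std_normal_density t \<le> 1" for t
  proof -
    have "1 \<le> sqrt (2 * pi)" using pi_gt3 by simp
    then have "1 / sqrt (2 * pi) \<le> 1" by simp
    moreover have "exp (- t\<^sup>2 / 2) \<le> 1" by simp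
    ultimately have "1 / sqrt (2 * pi) * exp (- t\<^sup>2 / 2) \<le> 1 * 1" by (intro mult_mono) auto
    then show ?thesis by (simp add: std_normal_density_def)
  qed
  then have "ennreal (std_normal_density t) * h t \<le> 1 * h t" for t
    by (intro mult_right_mono) (auto simp: ennreal_le_1)
  then show ?thesis by (subst nn_integral_density) (auto intro!: nn_integral_mono)
qed

text \<open>A probability measure with the null sets of the plane and density at most 1. Bounded
  functions are square integrable for it, Lebesgue bounds in t carry over to it, and almost
  everywhere convergence carries back.\<close>

definition gauss2 :: "(real \<times> real) measure" where
  "gauss2 = std_normal_distribution \<Otimes>\<^sub>M std_normal_distribution"

lemma sets_gauss2 [measurable_cong]: "sets gauss2 = sets (lborel \<Otimes>\<^sub>M lborel)"
  unfolding gauss2_def by (intro sets_pair_measure_cong) auto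

lemma prob_space_std_normal: "prob_space std_normal_distribution"
  by (rule prob_space_normal_density) simp

lemma prob_space_gauss2: "prob_space gauss2"
proof -
  interpret g: prob_space std_normal_distribution by (rule prob_space_std_normal)
  interpret pair_prob_space std_normal_distribution std_normal_distribution ..
  show ?thesis unfolding gauss2_def by (rule prob_space_axioms)
qed

text \<open>Fits local smoothing, which bounds the time integral uniformly in x; the x integral is
  then an average.\<close>

lemma nn_integral_gauss2_le:
  assumes f [measurable]: "f \<in> borel_measurable (lborel \<Otimes>\<^sub>M lborel)" and le: "\<And>x. (\<integral>\<^sup>+ t. f (t, x) \<partial>lborel) \<le> C"
  shows "(\<integral>\<^sup>+ z. f z \<partial>gauss2) \<le> C"
proof -
  interpret g: prob_space std_normal_distribution by (rule prob_space_std_normal)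
  interpret pair_prob_space std_normal_distribution std_normal_distribution ..
  have "f \<in> borel_measurable gauss2" using f by (simp cong: measurable_cong_sets add: sets_gauss2)
  then have "(\<integral>\<^sup>+ z. f z \<partial>gauss2) = (\<integral>\<^sup>+ x. \<integral>\<^sup>+ t. f (t, x) \<partial>std_normal_distribution \<partial>std_normal_distribution)"
    unfolding gauss2_def by (rule nn_integral_snd[symmetric])
  also have "\<dots> \<le> (\<integral>\<^sup>+ x. C \<partial>std_normal_distribution)"
  proof (intro nn_integral_mono)
    fix x
    have "(\<integral>\<^sup>+ t. f (t, x) \<partial>std_normal_distribution) \<le> (\<integral>\<^sup>+ t. f (t, x) \<partial>lborel)"
      by (rule nn_integral_std_normal_le) (use measurable_compose[OF measurable_Pair2' f, of x] in simp)
    then show "(\<integral>\<^sup>+ t. f (t, x) \<partial>std_normal_distribution) \<le> C" using le order_trans by blast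
  qed
  also have "\<dots> = C" by (simp add: g.emeasure_space_1[simplified])
  finally show ?thesis .
qed

text \<open>The Gaussian density is positive, so null sets agree with Lebesgue ones. The iterated
  form is the one required by \<open>mixed_norm_Fatou\<close>.\<close>

lemma AE_gauss2_iterated:
  assumes "AE z in gauss2. P (fst z) (snd z)"
  shows "AE t in lborel. AE x in lborel. P t x"
proof -
  interpret g: prob_space std_normal_distribution by (rule prob_space_std_normal)
  interpret pair_prob_space std_normal_distribution std_normal_distribution ..
  have "AE t in std_normal_distribution. AE x in std_normal_distribution. P (fst (t, x)) (snd (t, x))"
    using assms unfolding gauss2_def by (rule AE_pair)
  moreover have "(AE t in std_normal_distribution. Q t) \<longleftrightarrow> (AE t in lborel. Q t)" for Q
    by (subst AE_density) (auto simp: normal_density_pos)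
  ultimately show ?thesis by simp
qed

context airy_exponents begin

section \<open>Frequency truncations, point evaluation and high-frequency decay\<close>

definition trunc :: "real \<Rightarrow> (real \<Rightarrow> complex) \<Rightarrow> real \<Rightarrow> complex" where
  "trunc R f \<xi> = complex_of_real (indicator {\<xi>. 1 / R \<le> \<bar>\<xi>\<bar> \<and> \<bar>\<xi>\<bar> \<le> R} \<xi>) * f \<xi>"

text \<open>A low-pass filter that retains frequencies near 0: point evaluation after this cut is
  bounded on L^2 because \<beta> > 0.\<close>

definition cut :: "real \<Rightarrow> (real \<Rightarrow> complex) \<Rightarrow> real \<Rightarrow> complex" where
  "cut \<rho> f \<xi> = complex_of_real (indicator {- \<rho>..\<rho>} \<xi>) * f \<xi>"

text \<open>The L^2 function representing the functional that sends f to the value at (x, t) of the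
  evolution of its low frequencies; see \<open>evol_cut\<close>.\<close>

definition test :: "real \<Rightarrow> real \<Rightarrow> real \<Rightarrow> real \<Rightarrow> complex" where
  "test \<rho> x t \<xi> = exp (- (\<i> * complex_of_real (x * \<xi> + t * \<xi> ^ 3))) * complex_of_real (wt \<xi> * indicator {- \<rho>..\<rho>} \<xi>)"

lemma trunc_measurable [measurable]: "f \<in> borel_measurable borel \<Longrightarrow> trunc R f \<in> borel_measurable borel"
  unfolding trunc_def[abs_def] by measurable

lemma cut_measurable [measurable]: "f \<in> borel_measurable borel \<Longrightarrow> cut \<rho> f \<in> borel_measurable borel"
  unfolding cut_def[abs_def] by measurable

lemma cmod_trunc_le: "cmod (trunc R f \<xi>) \<le> cmod (f \<xi>)"
  by (simp add: trunc_def norm_mult split: split_indicator)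

lemma cmod_cut_le: "cmod (cut \<rho> f \<xi>) \<le> cmod (f \<xi>)"
  by (simp add: cut_def norm_mult split: split_indicator)

lemma sqint_trunc: "sqint lborel f \<Longrightarrow> sqint lborel (trunc R f)"
  using sqint_measurable[of lborel f] by (rule_tac sqint_bound[of _ f]) (auto simp: cmod_trunc_le)

lemma sqint_cut: "sqint lborel f \<Longrightarrow> sqint lborel (cut \<rho> f)"
  using sqint_measurable[of lborel f] by (rule_tac sqint_bound[of _ f]) (auto simp: cmod_cut_le)

lemma n2_trunc_le: "sqint lborel f \<Longrightarrow> n2 lborel (trunc R f) \<le> n2 lborel f"
  by (intro n2_mono sqint_trunc cmod_trunc_le)

lemma annular_trunc: "sqint lborel f \<Longrightarrow> 0 < R \<Longrightarrow> annular (trunc R f)"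
  unfolding annular_def by (intro conjI sqint_trunc exI[of _ R]) (auto simp: trunc_def split: split_indicator_asm)

lemma annular_cut: "annular f \<Longrightarrow> annular (cut \<rho> f)"
  unfolding annular_def by (auto intro: sqint_cut simp: cut_def)

lemma n2_trunc_tendsto:
  assumes f: "sqint lborel f"
  shows "(\<lambda>n. n2 lborel (\<lambda>\<xi>. trunc (real (Suc n)) f \<xi> - f \<xi>)) \<longlonglongrightarrow> 0"
proof -
  have [measurable]: "f \<in> borel_measurable borel" using f by (simp add: sqint_def)
  have "(\<lambda>n. LINT \<xi>|lborel. (cmod (trunc (real (Suc n)) f \<xi> - f \<xi>))\<^sup>2) \<longlonglongrightarrow> (LINT \<xi>|(lborel :: real measure). (0 :: real))"
  proof (rule integral_dominated_convergence[where w = "\<lambda>\<xi>. (cmod (f \<xi>))\<^sup>2"])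
    show "integrable lborel (\<lambda>\<xi>. (cmod (f \<xi>))\<^sup>2)" using f by (simp add: sqint_def)
    show "AE \<xi> in lborel. norm ((cmod (trunc (real (Suc n)) f \<xi> - f \<xi>))\<^sup>2) \<le> (cmod (f \<xi>))\<^sup>2" for n
      by (auto simp: trunc_def split: split_indicator)
    show "AE \<xi> in lborel. (\<lambda>n. (cmod (trunc (real (Suc n)) f \<xi> - f \<xi>))\<^sup>2) \<longlonglongrightarrow> 0"
      using AE_lborel_singleton[of 0]
    proof eventually_elim
      case (elim \<xi>)
      obtain K :: nat where K: "\<bar>\<xi>\<bar> + 1 / \<bar>\<xi>\<bar> \<le> real K" using real_arch_simple by blast
      have x: "0 < \<bar>\<xi>\<bar>" using elim by simp
      have "trunc (real (Suc n)) f \<xi> = f \<xi>" if "K \<le> n" for n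
      proof -
        have "\<bar>\<xi>\<bar> \<le> real (Suc n)" "1 / \<bar>\<xi>\<bar> \<le> real (Suc n)" using K that x by (smt (verit) divide_nonneg_nonneg of_nat_Suc of_nat_mono)+
        then have "1 / real (Suc n) \<le> \<bar>\<xi>\<bar>" using x by (simp add: field_simps)
        then show ?thesis using \<open>\<bar>\<xi>\<bar> \<le> real (Suc n)\<close> by (simp add: trunc_def)
      qed
      then have "\<forall>\<^sub>F n in sequentially. (cmod (trunc (real (Suc n)) f \<xi> - f \<xi>))\<^sup>2 = 0"
        by (auto simp: eventually_sequentially)
      then show ?case by (rule tendsto_eventually)
    qed
  qed auto
  then show ?thesis by (simp add: n2_def)
qed

text \<open>The squared weight is a multiple of |\<xi>|^(2 \<beta> - 1), integrable at 0 because
  \<beta> > 0. This makes evaluation of low frequencies weakly continuous.\<close>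

lemma sqint_wt:
  assumes \<rho>: "0 < \<rho>" shows "sqint lborel (\<lambda>\<xi>. complex_of_real (wt \<xi> * indicator {- \<rho>..\<rho>} \<xi>))"
proof -
  define a where "a = 2 * \<beta> - 1"
  have a: "- 1 < a" using beta_pos by (simp add: a_def)
  define h where "h \<xi> = (if \<xi> \<in> {0..\<rho>} then \<xi> powr a else 0)" for \<xi>
  have [measurable]: "h \<in> borel_measurable borel" unfolding h_def by measurable
  have h: "(\<integral>\<^sup>+ \<xi>. ennreal (h \<xi>) \<partial>lborel) = ennreal (\<rho> powr (a + 1) / (a + 1))"
  proof (rule nn_integral_has_integral_lborel)
    show "(h has_integral (\<rho> powr (a + 1) / (a + 1))) UNIV"
      unfolding h_def[abs_def] has_integral_restrict_UNIV using \<rho> by (intro has_integral_powr_from_0 a) auto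
    show "0 \<le> h \<xi>" for \<xi> by (simp add: h_def)
  qed simp
  have h': "(\<integral>\<^sup>+ \<xi>. ennreal (h (- \<xi>)) \<partial>lborel) = ennreal (\<rho> powr (a + 1) / (a + 1))"
    using nn_integral_real_affine[of "\<lambda>\<xi>. ennreal (h \<xi>)" "-1" 0] h by simp
  show ?thesis
  proof (rule sqintI_nn)
    have "(\<integral>\<^sup>+ \<xi>. ennreal ((cmod (complex_of_real (wt \<xi> * indicator {- \<rho>..\<rho>} \<xi>)))\<^sup>2) \<partial>lborel) \<le> (\<integral>\<^sup>+ \<xi>. ennreal (h \<xi>) + ennreal (h (- \<xi>)) \<partial>lborel)"
    proof (intro nn_integral_mono)
      fix \<xi>
      have "(wt \<xi>)\<^sup>2 = \<bar>\<xi>\<bar> powr a / (2 * pi)"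
        by (simp add: wt_def power_divide a_def power2_eq_square powr_add[symmetric])
      also have "\<dots> \<le> \<bar>\<xi>\<bar> powr a / 1" using pi_gt3 by (intro divide_left_mono) auto
      finally have w: "(wt \<xi>)\<^sup>2 \<le> \<bar>\<xi>\<bar> powr a" by simp
      have "(cmod (complex_of_real (wt \<xi> * indicator {- \<rho>..\<rho>} \<xi>)))\<^sup>2 \<le> h \<xi> + h (- \<xi>)"
        using w by (cases "0 \<le> \<xi>") (auto simp: h_def split: split_indicator)
      then show "ennreal ((cmod (complex_of_real (wt \<xi> * indicator {- \<rho>..\<rho>} \<xi>)))\<^sup>2) \<le> ennreal (h \<xi>) + ennreal (h (- \<xi>))"
        by (subst ennreal_plus[symmetric]) (auto simp: h_def intro!: ennreal_leI)
    qed
    also have "\<dots> = ennreal (\<rho> powr (a + 1) / (a + 1)) + ennreal (\<rho> powr (a + 1) / (a + 1))"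
      by (simp add: nn_integral_add h h')
    also have "\<dots> = ennreal (\<rho> powr (a + 1) / (a + 1) + \<rho> powr (a + 1) / (a + 1))"
      using a by (intro ennreal_plus[symmetric]) auto
    finally show "(\<integral>\<^sup>+ \<xi>. ennreal ((cmod (complex_of_real (wt \<xi> * indicator {- \<rho>..\<rho>} \<xi>)))\<^sup>2) \<partial>lborel)
      \<le> ennreal (\<rho> powr (a + 1) / (a + 1) + \<rho> powr (a + 1) / (a + 1))" .
  qed measurable
qed

lemma cmod_test: "cmod (test \<rho> x t \<xi>) = cmod (complex_of_real (wt \<xi> * indicator {- \<rho>..\<rho>} \<xi>))"
proof -
  have "cmod (exp (- (\<i> * complex_of_real (x * \<xi> + t * \<xi> ^ 3)))) = 1"
    using norm_exp_i_times[of "- (x * \<xi> + t * \<xi> ^ 3)"] by simp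
  then show ?thesis unfolding test_def norm_mult by simp
qed

lemma sqint_test: "0 < \<rho> \<Longrightarrow> sqint lborel (test \<rho> x t)"
  by (rule sqint_bound[OF sqint_wt _ eq_refl[OF cmod_test]]) (auto simp: test_def[abs_def])

lemma n2_test: "n2 lborel (test \<rho> x t) = n2 lborel (\<lambda>\<xi>. complex_of_real (wt \<xi> * indicator {- \<rho>..\<rho>} \<xi>))"
  unfolding n2_def cmod_test ..

lemma evol_cut: "evol (cut \<rho> f) x t = ip lborel (test \<rho> x t) f"
  unfolding evol_def ev_def ip_def
proof (intro Bochner_Integration.integral_cong refl)
  fix \<xi>
  have "cnj (test \<rho> x t \<xi>) = osc x t \<xi> * complex_of_real (wt \<xi> * indicator {- \<rho>..\<rho>} \<xi>)"
    by (simp add: test_def exp_cnj)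
  then show "osc x t \<xi> * lift (cut \<rho> f) \<xi> = cnj (test \<rho> x t \<xi>) * f \<xi>"
    by (simp add: lift_def cut_def)
qed

text \<open>Local smoothing divides by 3 \<xi>^2, which changes the squared weight to |\<xi>|^(2
  \<beta> - 3) up to constants. Since \<beta> < 3/4 this decreases, so its value at \<rho> controls
  all higher frequencies.\<close>

lemma evol_high_bound:
  assumes z: "annular z" and \<rho>: "0 < \<rho>"
  shows "(\<integral>\<^sup>+ t. ennreal ((cmod (evol (\<lambda>\<xi>. z \<xi> - cut \<rho> z \<xi>) x t))\<^sup>2) \<partial>lborel) \<le> ennreal (\<rho> powr (2 * \<beta> - 3) * n2 lborel z)"
proof -
  define w where "w \<xi> = z \<xi> - cut \<rho> z \<xi>" for \<xi>
  have w: "annular w" unfolding w_def[abs_def] by (intro annular_diff z annular_cut)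
  have w0: "w \<xi> = (if \<bar>\<xi>\<bar> \<le> \<rho> then 0 else z \<xi>)" for \<xi> by (auto simp: w_def cut_def indicator_def)
  obtain R where R: "0 < R" "\<And>\<xi>. w \<xi> \<noteq> 0 \<Longrightarrow> 1 / R \<le> \<bar>\<xi>\<bar> \<and> \<bar>\<xi>\<bar> \<le> R" using w by (auto simp: annular_def)
  have "\<xi> \<noteq> 0 \<and> \<bar>\<xi>\<bar> \<le> R" if "lift w \<xi> \<noteq> 0" for \<xi>
    using that R \<rho> by (auto simp: lift_def w0 split: if_splits)
  then have "(\<integral>\<^sup>+ t. ennreal ((cmod (evol w x t))\<^sup>2) \<partial>lborel) \<le> ennreal (2 * pi) * (\<integral>\<^sup>+ \<xi>. ennreal ((cmod (lift w \<xi>))\<^sup>2 / (3 * \<xi>\<^sup>2)) \<partial>lborel)"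
    unfolding evol_def using annular_lift(1)[OF w] R(1) by (intro ev_smoothing) auto
  also have "\<dots> \<le> ennreal (2 * pi) * (\<integral>\<^sup>+ \<xi>. ennreal (\<rho> powr (2 * \<beta> - 3) / (2 * pi)) * ennreal ((cmod (z \<xi>))\<^sup>2) \<partial>lborel)"
  proof (intro mult_left_mono nn_integral_mono)
    fix \<xi>
    have "(cmod (lift w \<xi>))\<^sup>2 / (3 * \<xi>\<^sup>2) \<le> \<rho> powr (2 * \<beta> - 3) / (2 * pi) * (cmod (z \<xi>))\<^sup>2"
    proof (cases "\<bar>\<xi>\<bar> \<le> \<rho>")
      case False
      then have x: "\<rho> \<le> \<bar>\<xi>\<bar>" "0 < \<bar>\<xi>\<bar>" using \<rho> by auto
      have "(wt \<xi>)\<^sup>2 / (3 * \<xi>\<^sup>2) = \<bar>\<xi>\<bar> powr (2 * \<beta> - 1) / (2 * pi) / (3 * \<bar>\<xi>\<bar> powr 2)"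
        using x by (simp add: wt_def power_divide power2_eq_square powr_add[symmetric])
      also have "\<dots> = \<bar>\<xi>\<bar> powr (2 * \<beta> - 3) / (2 * pi) / 3"
      proof -
        have "\<bar>\<xi>\<bar> powr (2 * \<beta> - 3) = \<bar>\<xi>\<bar> powr (2 * \<beta> - 1) / \<bar>\<xi>\<bar> powr 2" by (simp only: powr_diff[symmetric]) simp
        then show ?thesis by simp
      qed
      also have "\<dots> \<le> \<bar>\<xi>\<bar> powr (2 * \<beta> - 3) / (2 * pi) / 1" by (intro divide_left_mono) auto
      also have "\<dots> \<le> \<rho> powr (2 * \<beta> - 3) / (2 * pi)"
        using x \<rho> beta_less by (simp add: divide_right_mono powr_mono2')
      finally have "(wt \<xi>)\<^sup>2 / (3 * \<xi>\<^sup>2) * (cmod (z \<xi>))\<^sup>2 \<le> \<rho> powr (2 * \<beta> - 3) / (2 * pi) * (cmod (z \<xi>))\<^sup>2"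
        by (intro mult_right_mono) auto
      then show ?thesis using False by (simp add: lift_def w0 norm_mult power_mult_distrib)
    qed (simp add: lift_def w0)
    then show "ennreal ((cmod (lift w \<xi>))\<^sup>2 / (3 * \<xi>\<^sup>2)) \<le> ennreal (\<rho> powr (2 * \<beta> - 3) / (2 * pi)) * ennreal ((cmod (z \<xi>))\<^sup>2)"
      by (subst ennreal_mult[symmetric]) (auto intro!: ennreal_leI)
  qed auto
  also have "\<dots> = ennreal (2 * pi) * (ennreal (\<rho> powr (2 * \<beta> - 3) / (2 * pi)) * ennreal (n2 lborel z))"
    using sqint_measurable[OF annular_sqint[OF z]] by (simp add: nn_integral_cmult sqint_nn_integral[OF annular_sqint[OF z]])
  also have "\<dots> = ennreal (2 * pi * (\<rho> powr (2 * \<beta> - 3) / (2 * pi) * n2 lborel z))"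
    by (subst (2) ennreal_mult, simp, simp, subst ennreal_mult) auto
  finally show ?thesis by (simp add: w_def[abs_def])
qed

section \<open>Convergence of evolutions in Gaussian-weighted L^2\<close>

definition evol_pair :: "(real \<Rightarrow> complex) \<Rightarrow> real \<times> real \<Rightarrow> complex" where
  "evol_pair f z = evol f (snd z) (fst z)"

lemma evol_pair_measurable:
  assumes "f \<in> borel_measurable lborel"
  shows "evol_pair f \<in> borel_measurable (lborel \<Otimes>\<^sub>M lborel)" "evol_pair f \<in> borel_measurable gauss2"
proof -
  show *: "evol_pair f \<in> borel_measurable (lborel \<Otimes>\<^sub>M lborel)"
    using meas2_S[OF assms] by (simp add: evol_pair_def[abs_def] case_prod_beta')
  then show "evol_pair f \<in> borel_measurable gauss2" by (simp cong: measurable_cong_sets add: sets_gauss2)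
qed

lemma evol_pair_high:
  assumes z: "annular z" and \<rho>: "0 < \<rho>"
  shows "sqint gauss2 (evol_pair (\<lambda>\<xi>. z \<xi> - cut \<rho> z \<xi>))" "n2 gauss2 (evol_pair (\<lambda>\<xi>. z \<xi> - cut \<rho> z \<xi>)) \<le> \<rho> powr (2 * \<beta> - 3) * n2 lborel z"
proof -
  have m: "(\<lambda>\<xi>. z \<xi> - cut \<rho> z \<xi>) \<in> borel_measurable lborel"
    by (rule sqint_measurable[OF annular_sqint[OF annular_diff[OF z annular_cut[OF z]]]])
  note [measurable] = evol_pair_measurable(1)[OF m]
  have "(\<integral>\<^sup>+ w. ennreal ((cmod (evol_pair (\<lambda>\<xi>. z \<xi> - cut \<rho> z \<xi>) w))\<^sup>2) \<partial>gauss2) \<le> ennreal (\<rho> powr (2 * \<beta> - 3) * n2 lborel z)"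
  proof (rule nn_integral_gauss2_le)
    show "(\<integral>\<^sup>+ t. ennreal ((cmod (evol_pair (\<lambda>\<xi>. z \<xi> - cut \<rho> z \<xi>) (t, x)))\<^sup>2) \<partial>lborel) \<le> ennreal (\<rho> powr (2 * \<beta> - 3) * n2 lborel z)" for x
      using evol_high_bound[OF z \<rho>, of x] by (simp add: evol_pair_def)
  qed measurable
  then show "sqint gauss2 (evol_pair (\<lambda>\<xi>. z \<xi> - cut \<rho> z \<xi>))" "n2 gauss2 (evol_pair (\<lambda>\<xi>. z \<xi> - cut \<rho> z \<xi>)) \<le> \<rho> powr (2 * \<beta> - 3) * n2 lborel z"
    using evol_pair_measurable(2)[OF m] by (auto intro: sqintI_nn n2_le_nn)
qed

lemma evol_pair_cut_bound:
  assumes f: "sqint lborel f" and \<rho>: "0 < \<rho>" and B: "n2 lborel f \<le> B"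
  shows "cmod (evol_pair (cut \<rho> f) z) \<le> sqrt (n2 lborel (\<lambda>\<xi>. complex_of_real (wt \<xi> * indicator {- \<rho>..\<rho>} \<xi>))) * sqrt B"
proof -
  have "cmod (evol_pair (cut \<rho> f) z) \<le> sqrt (n2 lborel (test \<rho> (snd z) (fst z))) * sqrt (n2 lborel f)"
    unfolding evol_pair_def evol_cut by (rule ip_bound[OF sqint_test[OF \<rho>] f])
  also have "\<dots> \<le> sqrt (n2 lborel (test \<rho> (snd z) (fst z))) * sqrt B"
    using B by (intro mult_left_mono) auto
  finally show ?thesis by (simp add: n2_test)
qed

lemma evol_pair_cut_sqint:
  assumes f: "sqint lborel f" and \<rho>: "0 < \<rho>" shows "sqint gauss2 (evol_pair (cut \<rho> f))"
proof -
  interpret prob_space gauss2 by (rule prob_space_gauss2)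
  define K where "K = sqrt (n2 lborel (\<lambda>\<xi>. complex_of_real (wt \<xi> * indicator {- \<rho>..\<rho>} \<xi>))) * sqrt (n2 lborel f)"
  have K: "0 \<le> K" by (simp add: K_def)
  have "sqint gauss2 (\<lambda>z. complex_of_real K)" by (simp add: sqint_def)
  then show ?thesis
  proof (rule sqint_bound)
    show "evol_pair (cut \<rho> f) \<in> borel_measurable gauss2"
      using sqint_measurable[OF sqint_cut[OF f]] by (rule evol_pair_measurable(2))
    show "cmod (evol_pair (cut \<rho> f) z) \<le> cmod (complex_of_real K)" for z
      using evol_pair_cut_bound[OF f \<rho> order_refl, of z] by (simp only: norm_of_real abs_of_nonneg[OF K]) (simp only: K_def)
  qed
qed

text \<open>Weak convergence tested against \<open>test\<close> gives pointwise convergence. The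
  values are uniformly bounded and the measure is finite, so dominated convergence applies.\<close>

lemma evol_pair_cut_tendsto:
  assumes z: "\<And>n. sqint lborel (z n)" "\<And>n. n2 lborel (z n) \<le> B" and f: "sqint lborel f"
    and weak: "\<And>e. sqint lborel e \<Longrightarrow> (\<lambda>n. ip lborel e (z n)) \<longlonglongrightarrow> ip lborel e f" and \<rho>: "0 < \<rho>"
  shows "(\<lambda>n. n2 gauss2 (\<lambda>w. evol_pair (cut \<rho> (z n)) w - evol_pair (cut \<rho> f) w)) \<longlonglongrightarrow> 0"
proof -
  interpret prob_space gauss2 by (rule prob_space_gauss2)
  define k where "k = sqrt (n2 lborel (\<lambda>\<xi>. complex_of_real (wt \<xi> * indicator {- \<rho>..\<rho>} \<xi>)))"
  define K where "K = k * sqrt B + k * sqrt (n2 lborel f)"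
  have [measurable]: "evol_pair (cut \<rho> (z n)) \<in> borel_measurable gauss2" "evol_pair (cut \<rho> f) \<in> borel_measurable gauss2" for n
    using evol_pair_cut_sqint[OF _ \<rho>] z(1) f sqint_measurable by blast+
  have "(\<lambda>n. LINT w|gauss2. (cmod (evol_pair (cut \<rho> (z n)) w - evol_pair (cut \<rho> f) w))\<^sup>2) \<longlonglongrightarrow> (LINT w|gauss2. 0)"
  proof (rule integral_dominated_convergence[where w = "\<lambda>_. K\<^sup>2"])
    show "AE w in gauss2. norm ((cmod (evol_pair (cut \<rho> (z n)) w - evol_pair (cut \<rho> f) w))\<^sup>2) \<le> K\<^sup>2" for n
    proof (rule AE_I2)
      fix w
      have "cmod (evol_pair (cut \<rho> (z n)) w - evol_pair (cut \<rho> f) w) \<le> K"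
        unfolding K_def k_def using evol_pair_cut_bound[OF z(1) \<rho> z(2), of n w] evol_pair_cut_bound[OF f \<rho> order_refl, of w]
        by (intro order_trans[OF norm_triangle_ineq4] add_mono)
      then show "norm ((cmod (evol_pair (cut \<rho> (z n)) w - evol_pair (cut \<rho> f) w))\<^sup>2) \<le> K\<^sup>2"
        by (simp add: power_mono)
    qed
    show "AE w in gauss2. (\<lambda>n. (cmod (evol_pair (cut \<rho> (z n)) w - evol_pair (cut \<rho> f) w))\<^sup>2) \<longlonglongrightarrow> 0"
    proof (rule AE_I2)
      fix w
      have "(\<lambda>n. evol_pair (cut \<rho> (z n)) w) \<longlonglongrightarrow> evol_pair (cut \<rho> f) w"
        unfolding evol_pair_def evol_cut by (rule weak[OF sqint_test[OF \<rho>]])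
      then have "(\<lambda>n. (cmod (evol_pair (cut \<rho> (z n)) w - evol_pair (cut \<rho> f) w))\<^sup>2) \<longlonglongrightarrow> (cmod (evol_pair (cut \<rho> f) w - evol_pair (cut \<rho> f) w))\<^sup>2"
        by (intro tendsto_intros)
      then show "(\<lambda>n. (cmod (evol_pair (cut \<rho> (z n)) w - evol_pair (cut \<rho> f) w))\<^sup>2) \<longlonglongrightarrow> 0" by simp
    qed
  qed auto
  then show ?thesis by (simp add: n2_def)
qed

text \<open>Low frequencies converge pointwise, high frequencies are uniformly
  small in \<open>L^2\<close> of a Gaussian weight by local smoothing.\<close>

lemma evol_pair_converges:
  assumes z: "\<And>n. annular (z n)" "\<And>n. n2 lborel (z n) \<le> B" and f: "sqint lborel f"
    and weak: "\<And>e. sqint lborel e \<Longrightarrow> (\<lambda>n. ip lborel e (z n)) \<longlonglongrightarrow> ip lborel e f"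
  obtains u where "sqint gauss2 u" "\<And>n. sqint gauss2 (evol_pair (z n))" "(\<lambda>n. n2 gauss2 (\<lambda>w. evol_pair (z n) w - u w)) \<longlonglongrightarrow> 0"
proof -
  note zs = annular_sqint[OF z(1)]
  have split: "evol_pair (z n) w = evol_pair (cut \<rho> (z n)) w + evol_pair (\<lambda>\<xi>. z n \<xi> - cut \<rho> (z n) \<xi>) w" for n \<rho> w
    unfolding evol_pair_def using evol_diff[OF z(1) annular_cut[OF z(1)], of n \<rho> n] by simp
  have Us: "sqint gauss2 (evol_pair (z n))" for n
  proof -
    have "evol_pair (z n) = (\<lambda>w. evol_pair (cut 1 (z n)) w + evol_pair (\<lambda>\<xi>. z n \<xi> - cut 1 (z n) \<xi>) w)" using split by blast
    then show ?thesis using sqint_add[OF evol_pair_cut_sqint[OF zs, of 1 n] evol_pair_high(1)[OF z(1), of 1 n]] by simp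
  qed
  have B: "0 \<le> B" using z(2)[of 0] n2_nonneg[of lborel "z 0"] by linarith
  \<comment> \<open>Only the Cauchy property is shown: \<open>f\<close> need not be annular, so the
    limit is left abstract instead of being written as the evolution of \<open>f\<close>.\<close>
  have "\<exists>N. \<forall>m\<ge>N. \<forall>n\<ge>N. n2 gauss2 (\<lambda>w. evol_pair (z m) w - evol_pair (z n) w) < e" if e: "0 < e" for e
  proof -
    \<comment> \<open>Each evolution is within 2 d of the low-frequency part of the limit, d for its
      low and d for its high frequencies; two of them are then within 4 d = sqrt e.\<close>
    define d where "d = sqrt e / 4"
    have d: "0 < d" using e by (simp add: d_def)
    have "((\<lambda>\<rho>. \<rho> powr (2 * \<beta> - 3) * B) \<longlongrightarrow> 0 * B) at_top"
      using beta_less by (intro tendsto_intros tendsto_neg_powr filterlim_ident) auto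
    then have "\<forall>\<^sub>F \<rho> in at_top. \<rho> powr (2 * \<beta> - 3) * B < d\<^sup>2"
      using d by (intro order_tendstoD) auto
    then have "\<forall>\<^sub>F \<rho> in at_top. 0 < \<rho> \<and> \<rho> powr (2 * \<beta> - 3) * B < d\<^sup>2"
      using eventually_gt_at_top[of 0] by eventually_elim auto
    from eventually_happens'[OF trivial_limit_at_top_linorder this]
    obtain \<rho> where \<rho>: "0 < \<rho>" "\<rho> powr (2 * \<beta> - 3) * B < d\<^sup>2" by blast
    have hi: "sqrt (n2 gauss2 (evol_pair (\<lambda>\<xi>. z n \<xi> - cut \<rho> (z n) \<xi>))) < d" for n
    proof -
      have "n2 gauss2 (evol_pair (\<lambda>\<xi>. z n \<xi> - cut \<rho> (z n) \<xi>)) \<le> \<rho> powr (2 * \<beta> - 3) * n2 lborel (z n)"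
        by (rule evol_pair_high(2)[OF z(1) \<rho>(1)])
      also have "\<dots> \<le> \<rho> powr (2 * \<beta> - 3) * B" using z(2) by (intro mult_left_mono) auto
      finally show ?thesis using \<rho>(2) d by (intro real_less_lsqrt) auto
    qed
    have "\<forall>\<^sub>F n in sequentially. n2 gauss2 (\<lambda>w. evol_pair (cut \<rho> (z n)) w - evol_pair (cut \<rho> f) w) < d\<^sup>2"
      using evol_pair_cut_tendsto[OF zs z(2) f weak \<rho>(1)] d by (intro order_tendstoD) auto
    then obtain N where N: "\<And>n. n \<ge> N \<Longrightarrow> n2 gauss2 (\<lambda>w. evol_pair (cut \<rho> (z n)) w - evol_pair (cut \<rho> f) w) < d\<^sup>2"
      by (auto simp: eventually_sequentially)
    have close: "sqrt (n2 gauss2 (\<lambda>w. evol_pair (z n) w - evol_pair (cut \<rho> f) w)) < 2 * d" if "n \<ge> N" for n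
    proof -
      have "(\<lambda>w. evol_pair (z n) w - evol_pair (cut \<rho> f) w) = (\<lambda>w. (evol_pair (cut \<rho> (z n)) w - evol_pair (cut \<rho> f) w) + evol_pair (\<lambda>\<xi>. z n \<xi> - cut \<rho> (z n) \<xi>) w)"
        by (simp add: split[of n _ \<rho>] fun_eq_iff)
      moreover have "sqrt (n2 gauss2 (\<lambda>w. evol_pair (cut \<rho> (z n)) w - evol_pair (cut \<rho> f) w)) < d"
        using N[OF that] d by (intro real_less_lsqrt) auto
      ultimately show ?thesis
        using sqrt_n2_triangle[OF sqint_diff[OF evol_pair_cut_sqint[OF zs \<rho>(1)] evol_pair_cut_sqint[OF f \<rho>(1)]] evol_pair_high(1)[OF z(1) \<rho>(1)], of n n] hi[of n]
        by simp
    qed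
    have "n2 gauss2 (\<lambda>w. evol_pair (z m) w - evol_pair (z n) w) < e" if mn: "m \<ge> N" "n \<ge> N" for m n
    proof -
      have "(\<lambda>w. evol_pair (z m) w - evol_pair (z n) w) = (\<lambda>w. (evol_pair (z m) w - evol_pair (cut \<rho> f) w) + (evol_pair (cut \<rho> f) w - evol_pair (z n) w))" by simp
      then have "sqrt (n2 gauss2 (\<lambda>w. evol_pair (z m) w - evol_pair (z n) w)) \<le> sqrt (n2 gauss2 (\<lambda>w. evol_pair (z m) w - evol_pair (cut \<rho> f) w)) + sqrt (n2 gauss2 (\<lambda>w. evol_pair (cut \<rho> f) w - evol_pair (z n) w))"
        using sqrt_n2_triangle[OF sqint_diff[OF Us evol_pair_cut_sqint[OF f \<rho>(1)]] sqint_diff[OF evol_pair_cut_sqint[OF f \<rho>(1)] Us], of m n] by simp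
      also have "\<dots> < 2 * d + 2 * d"
        using close[OF mn(1)] close[OF mn(2)] n2_diff_swap[of gauss2 "evol_pair (cut \<rho> f)" "evol_pair (z n)"] by (intro add_strict_mono) auto
      also have "\<dots> = sqrt e" by (simp add: d_def)
      finally show ?thesis by simp
    qed
    then show ?thesis by blast
  qed
  from sqint_complete[OF Us this] show ?thesis using Us that by blast
qed

text \<open>The sequence \<open>h\<close> and the truncations of f both converge weakly to f.
  Interlaced, they form one weakly convergent annular sequence, whose evolutions have a single
  limit. This is the link between u and f.\<close>

lemma evolution_AE_limit:
  assumes h: "\<And>n. annular (h n)" "\<And>n. n2 lborel (h n) \<le> B" and f: "sqint lborel f"
    and weak: "\<And>e. sqint lborel e \<Longrightarrow> (\<lambda>n. ip lborel e (h n)) \<longlonglongrightarrow> ip lborel e f"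
  obtains u r s where "meas2 u" "strict_mono (r :: nat \<Rightarrow> nat)" "strict_mono (s :: nat \<Rightarrow> nat)"
    "AE t in lborel. AE x in lborel. (\<lambda>n. evol (h (r n)) x t) \<longlonglongrightarrow> u x t"
    "AE t in lborel. AE x in lborel. (\<lambda>n. evol (trunc (real (Suc (s n))) f) x t) \<longlonglongrightarrow> u x t"
proof -
  define T where "T n = trunc (real (Suc n)) f" for n
  have T: "annular (T n)" "n2 lborel (T n) \<le> n2 lborel f" for n
    unfolding T_def using f by (auto intro: annular_trunc n2_trunc_le)
  have Tweak: "(\<lambda>n. ip lborel e (T n)) \<longlonglongrightarrow> ip lborel e f" if e: "sqint lborel e" for e
  proof (rule LIM_zero_cancel, rule tendsto_0_le[where K = 1])
    show "(\<lambda>n. sqrt (n2 lborel e) * sqrt (n2 lborel (\<lambda>\<xi>. T n \<xi> - f \<xi>))) \<longlonglongrightarrow> 0"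
      using tendsto_mult_right_zero[OF tendsto_real_sqrt[OF n2_trunc_tendsto[OF f], simplified]] by (simp add: T_def)
    show "\<forall>\<^sub>F n in sequentially. norm (ip lborel e (T n) - ip lborel e f) \<le> norm (sqrt (n2 lborel e) * sqrt (n2 lborel (\<lambda>\<xi>. T n \<xi> - f \<xi>))) * 1"
      using ip_bound[OF e sqint_diff[OF annular_sqint[OF T(1)] f]]
      by (intro always_eventually allI) (simp add: ip_diff_right[OF e annular_sqint[OF T(1)] f] abs_mult)
  qed
  define z where "z n = (if even n then h (n div 2) else T (n div 2))" for n
  have z: "annular (z n)" "n2 lborel (z n) \<le> max B (n2 lborel f)" for n
    using h T by (auto simp: z_def le_max_iff_disj)
  have half: "filterlim (\<lambda>n::nat. n div 2) at_top at_top"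
    unfolding filterlim_at_top
  proof
    fix Z :: nat
    show "\<forall>\<^sub>F n in at_top. Z \<le> n div 2"
      using eventually_ge_at_top[of "2 * Z"] by eventually_elim auto
  qed
  have zweak: "(\<lambda>n. ip lborel e (z n)) \<longlonglongrightarrow> ip lborel e f" if e: "sqint lborel e" for e
  proof -
    have "(\<lambda>n. ip lborel e (h (n div 2))) \<longlonglongrightarrow> ip lborel e f" "(\<lambda>n. ip lborel e (T (n div 2))) \<longlonglongrightarrow> ip lborel e f"
      using filterlim_compose[OF weak[OF e] half] filterlim_compose[OF Tweak[OF e] half] by auto
    then have "(\<lambda>n. if even n then ip lborel e (h (n div 2)) else ip lborel e (T (n div 2))) \<longlonglongrightarrow> ip lborel e f"
      by (rule filterlim_If[OF tendsto_mono[OF inf_le1] tendsto_mono[OF inf_le1]])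
    moreover have "(\<lambda>n. ip lborel e (z n)) = (\<lambda>n. if even n then ip lborel e (h (n div 2)) else ip lborel e (T (n div 2)))"
      by (auto simp: z_def)
    ultimately show ?thesis by simp
  qed
  obtain v where v: "sqint gauss2 v" "\<And>n. sqint gauss2 (evol_pair (z n))" "(\<lambda>n. n2 gauss2 (\<lambda>w. evol_pair (z n) w - v w)) \<longlonglongrightarrow> 0"
    using evol_pair_converges[OF z f zweak] by blast
  have zh: "z (2 * n) = h n" "z (2 * n + 1) = T n" for n by (auto simp: z_def)
  have sm: "strict_mono (\<lambda>n::nat. 2 * n)" "strict_mono (\<lambda>n::nat. 2 * n + 1)" by (auto simp: strict_mono_def)
  have lh: "(\<lambda>n. n2 gauss2 (\<lambda>w. evol_pair (h n) w - v w)) \<longlonglongrightarrow> 0" and lT: "(\<lambda>n. n2 gauss2 (\<lambda>w. evol_pair (T n) w - v w)) \<longlonglongrightarrow> 0"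
    using LIMSEQ_subseq_LIMSEQ[OF v(3) sm(1)] LIMSEQ_subseq_LIMSEQ[OF v(3) sm(2)] unfolding o_def zh by auto
  have Uh: "sqint gauss2 (evol_pair (h n))" and UT: "sqint gauss2 (evol_pair (T n))" for n
    using v(2)[of "2 * n"] v(2)[of "2 * n + 1"] unfolding zh by auto
  obtain r where r: "strict_mono r" "AE w in gauss2. (\<lambda>n. evol_pair (h (r n)) w - v w) \<longlonglongrightarrow> 0"
    using AE_subseq_of_n2_tendsto_0[OF sqint_diff[OF Uh v(1)] lh] by blast
  obtain s where s: "strict_mono s" "AE w in gauss2. (\<lambda>n. evol_pair (T (s n)) w - v w) \<longlonglongrightarrow> 0"
    using AE_subseq_of_n2_tendsto_0[OF sqint_diff[OF UT v(1)] lT] by blast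
  define u where "u x t = v (t, x)" for x t
  show ?thesis
  proof (rule that[OF _ r(1) s(1)])
    have "v \<in> borel_measurable (lborel \<Otimes>\<^sub>M lborel)"
      using sqint_measurable[OF v(1)] by (simp cong: measurable_cong_sets add: sets_gauss2)
    then show "meas2 u" by (simp add: u_def case_prod_eta)
    have "AE w in gauss2. (\<lambda>n. evol (h (r n)) (snd w) (fst w)) \<longlonglongrightarrow> u (snd w) (fst w)"
      using r(2) by eventually_elim (auto simp: evol_pair_def u_def intro: LIM_zero_cancel)
    then show "AE t in lborel. AE x in lborel. (\<lambda>n. evol (h (r n)) x t) \<longlonglongrightarrow> u x t"
      by (rule AE_gauss2_iterated)
    have "AE w in gauss2. (\<lambda>n. evol (trunc (real (Suc (s n))) f) (snd w) (fst w)) \<longlonglongrightarrow> u (snd w) (fst w)"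
      using s(2) by eventually_elim (auto simp: evol_pair_def u_def T_def intro: LIM_zero_cancel)
    then show "AE t in lborel. AE x in lborel. (\<lambda>n. evol (trunc (real (Suc (s n))) f) x t) \<longlonglongrightarrow> u x t"
      by (rule AE_gauss2_iterated)
  qed
qed

end

section \<open>Existence of extremisers\<close>

text \<open>Strictness is what excludes a splitting of mass between the weak limit and the
  remainder.\<close>

lemma powr_sum_less_one:
  fixes a e :: real
  assumes "0 < a" "a < 1" "1 < e"
  shows "a powr e + (1 - a) powr e < 1"
proof -
  have "x powr e < x" if "0 < x" "x < 1" for x :: real
  proof -
    have "x powr e < x powr 1" using that assms by (intro powr_less_mono') auto
    then show ?thesis using that by simp
  qed
  from this[of a] this[of "1 - a"] assms show ?thesis by simp
qed

context airy_exponents begin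

text \<open>\<open>strich_norm\<close> is defined through \<open>lim\<close>, so the limit must be
  shown to exist. The norms of the truncations are Cauchy by the triangle inequality and the finite
  best constant.\<close>

lemma evol_norm_trunc_tendsto:
  assumes f: "sqint lborel f"
  obtains L where "(\<lambda>n. evol_norm (trunc (real (Suc n)) f)) \<longlonglongrightarrow> L" "L \<le> best_const * ennreal (sqrt (n2 lborel f))"
proof -
  define T where "T n = trunc (real (Suc n)) f" for n
  have T: "annular (T n)" "n2 lborel (T n) \<le> n2 lborel f" for n
    unfolding T_def using f by (auto intro: annular_trunc n2_trunc_le)
  obtain M' where M': "best_const = ennreal M'" "0 \<le> M'" using best_const_finite by (cases best_const) auto
  have XT: "evol_norm (T n) \<le> best_const * ennreal (sqrt (n2 lborel f))" for n
  proof -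
    have "best_const * ennreal (sqrt (n2 lborel (T n))) \<le> best_const * ennreal (sqrt (n2 lborel f))"
      using T(2) by (intro mult_left_mono ennreal_leI) auto
    with evol_norm_le[OF T(1)] show ?thesis by (rule order_trans)
  qed
  define x where "x n = enn2real (evol_norm (T n))" for n
  have x: "evol_norm (T n) = ennreal (x n)" "0 \<le> x n" for n
  proof -
    have "evol_norm (T n) < top" using XT[of n] M' by (auto simp: ennreal_mult[symmetric] intro: order.strict_trans1)
    then show "evol_norm (T n) = ennreal (x n)" "0 \<le> x n" by (auto simp: x_def)
  qed
  define d where "d n = sqrt (n2 lborel (\<lambda>\<xi>. T n \<xi> - f \<xi>))" for n
  have d0: "d \<longlonglongrightarrow> 0" using tendsto_real_sqrt[OF n2_trunc_tendsto[OF f]] by (simp add: d_def[abs_def] T_def)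
  have dn: "0 \<le> d n" for n by (simp add: d_def)
  have step: "x m \<le> x n + M' * (d m + d n)" for m n
  proof -
    have "sqrt (n2 lborel (\<lambda>\<xi>. T m \<xi> - T n \<xi>)) \<le> d m + d n"
      using sqrt_n2_triangle[OF sqint_diff[OF annular_sqint[OF T(1)] f] sqint_diff[OF f annular_sqint[OF T(1)]], of m n]
        n2_diff_swap[of lborel f "T n"] by (simp add: d_def)
    then have b: "ennreal (sqrt (n2 lborel (\<lambda>\<xi>. T m \<xi> - T n \<xi>))) \<le> ennreal (d m + d n)" by (rule ennreal_leI)
    have "evol_norm (T m) \<le> evol_norm (T n) + evol_norm (\<lambda>\<xi>. T m \<xi> - T n \<xi>)" by (rule evol_norm_triangle[OF T(1) T(1)])
    also have "\<dots> \<le> evol_norm (T n) + best_const * ennreal (d m + d n)"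
      using order_trans[OF evol_norm_le[OF annular_diff[OF T(1) T(1)]] mult_left_mono[OF b, of best_const]] by (intro add_left_mono) auto
    also have "\<dots> = ennreal (x n + M' * (d m + d n))"
      using M' x dn by (simp add: ennreal_mult[symmetric] ennreal_plus[symmetric] del: ennreal_plus)
    finally have "ennreal (x m) \<le> ennreal (x n + M' * (d m + d n))" unfolding x(1)[of m] .
    moreover have "0 \<le> x n + M' * (d m + d n)" using x(2)[of n] M' dn by simp
    ultimately show ?thesis using ennreal_le_iff by blast
  qed
  have "Cauchy x"
  proof (rule metric_CauchyI)
    fix e :: real assume e: "0 < e"
    have "(\<lambda>n. M' * d n) \<longlonglongrightarrow> 0" using d0 by (rule tendsto_mult_right_zero)
    from order_tendstoD(2)[OF this, of "e / 2"] e obtain N where N: "\<And>n. n \<ge> N \<Longrightarrow> M' * d n < e / 2"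
      by (auto simp: eventually_sequentially)
    have "dist (x m) (x n) < e" if "m \<ge> N" "n \<ge> N" for m n
      using step[of m n] step[of n m] N[OF that(1)] N[OF that(2)] by (simp add: dist_real_def distrib_left)
    then show "\<exists>N. \<forall>m\<ge>N. \<forall>n\<ge>N. dist (x m) (x n) < e" by blast
  qed
  then obtain l where l: "x \<longlonglongrightarrow> l" using Cauchy_convergent convergent_def by blast
  have lim: "(\<lambda>n. evol_norm (T n)) \<longlonglongrightarrow> ennreal l" unfolding x(1) using l by (rule tendsto_ennrealI)
  show ?thesis
  proof (rule that)
    show "(\<lambda>n. evol_norm (trunc (real (Suc n)) f)) \<longlonglongrightarrow> ennreal l" using lim by (simp add: T_def)
    show "ennreal l \<le> best_const * ennreal (sqrt (n2 lborel f))"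
      by (rule LIMSEQ_le_const2[OF lim]) (use XT in auto)
  qed
qed

text \<open>After normalisation the zeroth piece is bounded below at the origin. Its value there is
  the pairing with a fixed L^2 function, so the lower bound survives in the weak limit and makes it
  nonzero.\<close>

lemma maximising_sequence:
  assumes best_const: "0 < best_const"
  obtains h f where "\<And>n. annular (h n)" "\<And>n. n2 lborel (h n) \<le> 1" "(\<lambda>n. evol_norm (h n)) \<longlonglongrightarrow> best_const"
    "sqint lborel f" "\<And>e. sqint lborel e \<Longrightarrow> (\<lambda>n. ip lborel e (h n)) \<longlonglongrightarrow> ip lborel e f"
    "0 < n2 lborel f" "n2 lborel f \<le> 1"
proof -
  obtain M' where M': "best_const = ennreal M'" "0 \<le> M'" using best_const_finite by (cases best_const) auto
  then have M'0: "0 < M'" using best_const by (simp add: ennreal_less_zero_iff)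
  \<comment> \<open>The second entry of the maximum makes the sequence maximising; the first gives
    one threshold M' / 2, hence one constant \<open>A\<close> for all n.\<close>
  have "\<exists>g. annular g \<and> n2 lborel g \<le> 1 \<and> ennreal (max (M' / 2) (M' - 1 / real (Suc n))) < evol_norm g" for n
  proof -
    have "ennreal (max (M' / 2) (M' - 1 / real (Suc n))) < best_const"
      unfolding M'(1) using M'0 by (intro ennreal_lessI) auto
    then show ?thesis unfolding best_const_def less_SUP_iff by auto
  qed
  then obtain g where g: "\<And>n. annular (g n)" "\<And>n. n2 lborel (g n) \<le> 1"
    "\<And>n. ennreal (max (M' / 2) (M' - 1 / real (Suc n))) < evol_norm (g n)" by metis
  obtain A where A: "0 < A" "\<And>f. annular f \<Longrightarrow> n2 lborel f \<le> 1 \<Longrightarrow> ennreal (M' / 2) \<le> evol_norm f \<Longrightarrow>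
    \<exists>g. annular g \<and> n2 lborel g = n2 lborel f \<and> evol_norm g = evol_norm f \<and> A \<le> cmod (evol (piece g 0) 0 0)"
    using normalise_nonvanishing[of "M' / 2"] M'0 by auto
  have "\<exists>k. annular k \<and> n2 lborel k = n2 lborel (g n) \<and> evol_norm k = evol_norm (g n) \<and> A \<le> cmod (evol (piece k 0) 0 0)" for n
  proof (rule A(2)[OF g(1,2)])
    have "ennreal (M' / 2) \<le> ennreal (max (M' / 2) (M' - 1 / real (Suc n)))" by (intro ennreal_leI) simp
    then show "ennreal (M' / 2) \<le> evol_norm (g n)" using g(3)[of n] by (meson less_imp_le order_trans)
  qed
  then obtain k where k: "\<And>n. annular (k n)" "\<And>n. n2 lborel (k n) = n2 lborel (g n)" "\<And>n. evol_norm (k n) = evol_norm (g n)"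
    "\<And>n. A \<le> cmod (evol (piece (k n) 0) 0 0)" by metis
  have k1: "n2 lborel (k n) \<le> 1" for n using k(2) g(2) by simp
  have Xlim: "(\<lambda>n. evol_norm (k n)) \<longlonglongrightarrow> best_const"
  proof (rule tendsto_sandwich)
    show "\<forall>\<^sub>F n in sequentially. ennreal (M' - 1 / real (Suc n)) \<le> evol_norm (k n)"
    proof (intro always_eventually allI)
      fix n
      have "ennreal (M' - 1 / real (Suc n)) \<le> ennreal (max (M' / 2) (M' - 1 / real (Suc n)))" by (intro ennreal_leI) simp
      then show "ennreal (M' - 1 / real (Suc n)) \<le> evol_norm (k n)" unfolding k(3) using g(3)[of n] by (meson less_imp_le order_trans)
    qed
    show "\<forall>\<^sub>F n in sequentially. evol_norm (k n) \<le> best_const"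
      unfolding best_const_def using k(1) k1 by (intro always_eventually allI SUP_upper) auto
    have "(\<lambda>n. M' - 1 / real (Suc n)) \<longlonglongrightarrow> M' - 0"
      by (intro tendsto_diff tendsto_const LIMSEQ_Suc[OF lim_1_over_n])
    then have "(\<lambda>n. ennreal (M' - 1 / real (Suc n))) \<longlonglongrightarrow> ennreal (M' - 0)" by (rule tendsto_ennrealI)
    then show "(\<lambda>n. ennreal (M' - 1 / real (Suc n))) \<longlonglongrightarrow> best_const" by (simp add: M'(1))
  qed simp
  obtain r f where rf: "strict_mono r" "sqint lborel f" "\<And>e. sqint lborel e \<Longrightarrow> (\<lambda>n. ip lborel e (k (r n))) \<longlonglongrightarrow> ip lborel e f"
    using weak_compactness[where h = k, OF annular_sqint[OF k(1)] k1] by blast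
  \<comment> \<open>The cut at frequency 2 contains the zeroth band, which is 1 <= |\<xi>| <
    2.\<close>
  define e where "e = piece (test 2 0 0) 0"
  have e: "sqint lborel e" unfolding e_def by (intro sqint_piece sqint_test) simp
  have Se: "evol (piece z 0) 0 0 = ip lborel e z" for z
    unfolding evol_def ev_def ip_def
    by (intro Bochner_Integration.integral_cong refl)
      (auto simp: e_def piece_def test_def lift_def band_def split: split_indicator)
  have "A \<le> cmod (ip lborel e f)"
  proof (rule LIMSEQ_le_const[OF tendsto_norm[OF rf(3)[OF e]]])
    show "\<exists>N. \<forall>n\<ge>N. A \<le> cmod (ip lborel e (k (r n)))" using k(4) unfolding Se by blast
  qed
  then have "ip lborel e f \<noteq> 0" using A(1) by auto
  then have "n2 lborel f \<noteq> 0" using ip_bound[OF e rf(2)] by auto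
  then have f0: "0 < n2 lborel f" using n2_nonneg[of lborel f] by linarith
  \<comment> \<open>Weak lower semicontinuity of the norm, by pairing the sequence with
    \<open>f\<close> itself.\<close>
  have f1: "n2 lborel f \<le> 1"
  proof -
    have "cmod (ip lborel f f) \<le> sqrt (n2 lborel f) * 1"
    proof (rule LIMSEQ_le_const2[OF tendsto_norm[OF rf(3)[OF rf(2)]]])
      have "cmod (ip lborel f (k (r n))) \<le> sqrt (n2 lborel f) * 1" for n
      proof (rule order_trans[OF ip_bound[OF rf(2) annular_sqint[OF k(1)]]])
        show "sqrt (n2 lborel f) * sqrt (n2 lborel (k (r n))) \<le> sqrt (n2 lborel f) * 1"
          using k1[of "r n"] by (intro mult_left_mono) auto
      qed
      then show "\<exists>N. \<forall>n\<ge>N. cmod (ip lborel f (k (r n))) \<le> sqrt (n2 lborel f) * 1" by blast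
    qed
    then have "n2 lborel f \<le> sqrt (n2 lborel f)" by (simp add: ip_self)
    then have "(sqrt (n2 lborel f))\<^sup>2 \<le> sqrt (n2 lborel f)" by simp
    then have "sqrt (n2 lborel f) * sqrt (n2 lborel f) \<le> sqrt (n2 lborel f) * 1" by (simp add: power2_eq_square)
    then have "sqrt (n2 lborel f) \<le> 1" using f0 by (simp only: mult_le_cancel_left_pos real_sqrt_gt_0_iff)
    then show ?thesis by simp
  qed
  show ?thesis
  proof (rule that[of "\<lambda>n. k (r n)" f])
    show "(\<lambda>n. evol_norm (k (r n))) \<longlonglongrightarrow> best_const" using LIMSEQ_subseq_LIMSEQ[OF Xlim rf(1)] by (simp add: o_def)
  qed (use k(1) k1 rf f0 f1 in auto)
qed

text \<open>The mass a of the weak limit and the mass 1 - a of the remainder contribute to the norm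
  separately. Because m > 2, keeping the best constant forces one of them to vanish, and a >
  0.\<close>

theorem extremiser_exists:
  obtains f where "sqint lborel f" "n2 lborel f = 1" "(\<lambda>n. evol_norm (trunc (real (Suc n)) f)) \<longlonglongrightarrow> best_const"
proof (cases "best_const = 0")
  \<comment> \<open>With best constant 0 any unit vector attains it; the indicator of [1, 2] has
    norm 1.\<close>
  case True
  define f where "f \<xi> = complex_of_real (indicator {1..2} \<xi>)" for \<xi> :: real
  have eq: "(\<lambda>\<xi>. (cmod (f \<xi>))\<^sup>2) = (indicator {1..2} :: real \<Rightarrow> real)"
    by (auto simp: f_def fun_eq_iff split: split_indicator)
  have f: "sqint lborel f" "n2 lborel f = 1"
    unfolding sqint_def n2_def eq by (auto simp: f_def[abs_def])
  obtain L where L: "(\<lambda>n. evol_norm (trunc (real (Suc n)) f)) \<longlonglongrightarrow> L" "L \<le> best_const * ennreal (sqrt (n2 lborel f))"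
    using evol_norm_trunc_tendsto[OF f(1)] by blast
  then have "L = best_const" using True by simp
  with f L(1) show ?thesis by (intro that) auto
next
  case False
  then have M0: "0 < best_const" by (simp add: zero_less_iff_neq_zero)
  obtain h f where h: "\<And>n. annular (h n)" "\<And>n. n2 lborel (h n) \<le> 1" and Xh: "(\<lambda>n. evol_norm (h n)) \<longlonglongrightarrow> best_const"
    and f: "sqint lborel f" and weak: "\<And>e. sqint lborel e \<Longrightarrow> (\<lambda>n. ip lborel e (h n)) \<longlonglongrightarrow> ip lborel e f"
    and f0: "0 < n2 lborel f" and f1: "n2 lborel f \<le> 1"
    using maximising_sequence[OF M0] by metis
  obtain u r s where u: "meas2 u" and rs: "strict_mono (r :: nat \<Rightarrow> nat)" "strict_mono (s :: nat \<Rightarrow> nat)"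
    and ae: "AE t in lborel. AE x in lborel. (\<lambda>n. evol (h (r n)) x t) \<longlonglongrightarrow> u x t"
    and aeT: "AE t in lborel. AE x in lborel. (\<lambda>n. evol (trunc (real (Suc (s n))) f) x t) \<longlonglongrightarrow> u x t"
    by (rule evolution_AE_limit[where h = h, OF h f weak])
  obtain M' where M': "best_const = ennreal M'" "0 \<le> M'" using best_const_finite by (cases best_const) auto
  then have M'0: "0 < M'" using M0 by (simp add: ennreal_less_zero_iff)
  define a where "a = n2 lborel f"
  define m where "m = min p q"
  have m: "2 < m" using p_gt q_gt by (simp add: m_def)
  define T where "T n = trunc (real (Suc (s n))) f" for n
  have T: "annular (T n)" "n2 lborel (T n) \<le> a" for n
    unfolding T_def a_def using f by (auto intro: annular_trunc n2_trunc_le)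
  have Td: "(\<lambda>n. n2 lborel (\<lambda>\<xi>. T n \<xi> - f \<xi>)) \<longlonglongrightarrow> 0"
    using LIMSEQ_subseq_LIMSEQ[OF n2_trunc_tendsto[OF f] rs(2)] by (simp add: T_def o_def)
  define k where "k n = h (r n)" for n
  have k: "annular (k n)" "n2 lborel (k n) \<le> 1" for n using h by (auto simp: k_def)
  have mS: "meas2 (evol g)" if "annular g" for g using meas2_S[OF sqint_measurable[OF annular_sqint[OF that]]] .
  have Xk: "(\<lambda>n. evol_norm (k n)) \<longlonglongrightarrow> best_const" using LIMSEQ_subseq_LIMSEQ[OF Xh rs(1)] by (simp add: k_def o_def)
  \<comment> \<open>\<open>u\<close> is an almost everywhere limit of evolutions of truncations of
    \<open>f\<close>, so Fatou's lemma supplies the bound an evolution of \<open>f\<close> would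
    have.\<close>
  have u_le: "mixed_norm p q u \<le> ennreal (M' * sqrt a)"
  proof (rule mixed_norm_Fatou[OF p_pos q_pos u mS[OF T(1)] aeT[folded T_def] _ tendsto_const])
    fix n
    have "evol_norm (T n) \<le> best_const * ennreal (sqrt (n2 lborel (T n)))" by (rule evol_norm_le[OF T(1)])
    also have "\<dots> \<le> best_const * ennreal (sqrt a)" using T(2) by (intro mult_left_mono ennreal_leI) auto
    finally show "mixed_norm p q (evol (T n)) \<le> ennreal (M' * sqrt a)"
      using M' by (simp add: evol_norm_def ennreal_mult a_def)
  qed
  obtain U' where U': "mixed_norm p q u = ennreal U'" "0 \<le> U'"
    using u_le by (cases "mixed_norm p q u") (auto simp: top_unique)
  have U'_le: "U' \<le> M' * sqrt a" using u_le U' M' by (simp add: ennreal_le_iff a_def)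
  define w where "w n x t = evol (k n) x t - u x t" for n x t
  have w_meas: "meas2 (w n)" for n
    using mS[OF k(1)[of n]] u by (simp add: w_def case_prod_beta')
  have w_ae: "AE t in lborel. AE x in lborel. (\<lambda>n. w n x t) \<longlonglongrightarrow> 0"
    using ae
  proof eventually_elim
    case (elim t)
    then show ?case by eventually_elim (auto simp: w_def k_def intro: LIM_zero)
  qed
  \<comment> \<open>Expanding the square bounds the squared norm of \<open>k n\<close> minus
    \<open>f\<close> by \<open>b n\<close>; weak convergence tested with \<open>f\<close> sends this
    to 1 - a.\<close>
  define b where "b n = 1 - 2 * Re (ip lborel f (k n)) + a" for n
  have b: "b \<longlonglongrightarrow> 1 - a"
  proof -
    have "(\<lambda>n. ip lborel f (k n)) \<longlonglongrightarrow> ip lborel f f"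
      using LIMSEQ_subseq_LIMSEQ[OF weak[OF f] rs(1)] by (simp add: k_def o_def)
    then have "(\<lambda>n. 1 - 2 * Re (ip lborel f (k n)) + a) \<longlonglongrightarrow> 1 - 2 * Re (ip lborel f f) + a"
      by (intro tendsto_intros)
    then show ?thesis by (simp add: b_def[abs_def] ip_self a_def)
  qed
  have nb: "n2 lborel (\<lambda>\<xi>. k n \<xi> - f \<xi>) \<le> b n" for n
    using n2_diff[OF annular_sqint[OF k(1)] f, of n] k(2)[of n] by (simp add: b_def a_def)
  then have b0: "0 \<le> b n" for n using n2_nonneg order_trans by blast
  \<comment> \<open>For fixed n the remainder \<open>w n\<close> is the limit in j of the evolutions
    of \<open>k n\<close> minus \<open>T j\<close>. These are annular, so the best constant applies
    before Fatou's lemma.\<close>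
  have w_le: "mixed_norm p q (w n) \<le> ennreal (M' * sqrt (b n))" for n
  proof -
    define c where "c j = ennreal (M' * (sqrt (b n) + sqrt (n2 lborel (\<lambda>\<xi>. T j \<xi> - f \<xi>))))" for j
    have c: "c \<longlonglongrightarrow> ennreal (M' * (sqrt (b n) + sqrt 0))"
      unfolding c_def by (intro tendsto_ennrealI tendsto_intros Td)
    have "mixed_norm p q (w n) \<le> ennreal (M' * (sqrt (b n) + sqrt 0))"
    proof (rule mixed_norm_Fatou[OF p_pos q_pos w_meas mS[OF annular_diff[OF k(1) T(1)]] _ _ c])
      show "AE t in lborel. AE x in lborel. (\<lambda>j. evol (\<lambda>\<xi>. k n \<xi> - T j \<xi>) x t) \<longlonglongrightarrow> w n x t"
        using aeT[folded T_def]
      proof eventually_elim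
        case (elim t)
        then show ?case
          by eventually_elim (auto simp: w_def evol_diff[OF k(1) T(1)] intro: tendsto_intros)
      qed
      fix j
      have "sqrt (n2 lborel (\<lambda>\<xi>. k n \<xi> - T j \<xi>)) \<le> sqrt (n2 lborel (\<lambda>\<xi>. k n \<xi> - f \<xi>)) + sqrt (n2 lborel (\<lambda>\<xi>. T j \<xi> - f \<xi>))"
        using sqrt_n2_triangle[OF sqint_diff[OF annular_sqint[OF k(1)] f] sqint_diff[OF f annular_sqint[OF T(1)]], of n j]
          n2_diff_swap[of lborel f "T j"] by simp
      also have "\<dots> \<le> sqrt (b n) + sqrt (n2 lborel (\<lambda>\<xi>. T j \<xi> - f \<xi>))" using nb by simp
      finally have "best_const * ennreal (sqrt (n2 lborel (\<lambda>\<xi>. k n \<xi> - T j \<xi>))) \<le> best_const * ennreal (sqrt (b n) + sqrt (n2 lborel (\<lambda>\<xi>. T j \<xi> - f \<xi>)))"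
        by (intro mult_left_mono ennreal_leI) auto
      also have "\<dots> = c j" unfolding c_def M'(1) using M'(2) b0[of n] by (intro ennreal_mult[symmetric]) auto
      finally show "mixed_norm p q (evol (\<lambda>\<xi>. k n \<xi> - T j \<xi>)) \<le> c j"
        using order_trans[OF evol_norm_le[OF annular_diff[OF k(1) T(1)]]] unfolding evol_norm_def by blast
    qed
    then show ?thesis by simp
  qed
  \<comment> \<open>The Brezis-Lieb inequality at fixed loss e, passed to the limit in n; the loss
    is removed in \<open>ineq0\<close>.\<close>
  have ineq: "M' powr m \<le> U' powr m + (1 + e) * (M' * sqrt (1 - a)) powr m" if e: "0 < e" for e
  proof -
    have "mixed_norm p q u < top" by (simp add: U')
    then obtain R where R: "R \<longlonglongrightarrow> 0" "\<And>n. enn_powr (mixed_norm p q (\<lambda>x t. u x t + w n x t)) m \<le>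
      enn_powr (mixed_norm p q u) m + ennreal (1 + e) * enn_powr (mixed_norm p q (w n)) m + R n"
      unfolding m_def using mixed_norm_Brezis_Lieb[OF p_pos q_pos e u w_meas w_ae] by blast
    have le: "enn_powr (evol_norm (k n)) m \<le> ennreal (U' powr m) + ennreal ((1 + e) * (M' * sqrt (b n)) powr m) + R n" for n
    proof -
      have "enn_powr (evol_norm (k n)) m \<le> enn_powr (mixed_norm p q u) m + ennreal (1 + e) * enn_powr (mixed_norm p q (w n)) m + R n"
        using R(2)[of n] by (simp add: w_def evol_norm_def)
      also have "\<dots> \<le> enn_powr (mixed_norm p q u) m + ennreal (1 + e) * enn_powr (ennreal (M' * sqrt (b n))) m + R n"
        using m by (intro add_mono order_refl mult_left_mono enn_powr_mono w_le) auto
      also have "\<dots> = ennreal (U' powr m) + ennreal ((1 + e) * (M' * sqrt (b n)) powr m) + R n"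
      proof -
        have "enn_powr (ennreal (M' * sqrt (b n))) m = ennreal ((M' * sqrt (b n)) powr m)"
          using M'(2) b0[of n] by (intro enn_powr_ennreal) auto
        moreover have "enn_powr (mixed_norm p q u) m = ennreal (U' powr m)"
          unfolding U'(1) by (rule enn_powr_ennreal[OF U'(2)])
        moreover have "ennreal (1 + e) * ennreal ((M' * sqrt (b n)) powr m) = ennreal ((1 + e) * (M' * sqrt (b n)) powr m)"
          using e by (intro ennreal_mult[symmetric]) auto
        ultimately show ?thesis by (simp only:)
      qed
      finally show ?thesis .
    qed
    have "enn_powr best_const m \<le> ennreal (U' powr m) + ennreal ((1 + e) * (M' * sqrt (1 - a)) powr m) + 0"
    proof (rule LIMSEQ_le)
      show "(\<lambda>n. enn_powr (evol_norm (k n)) m) \<longlonglongrightarrow> enn_powr best_const m" using m by (intro tendsto_enn_powr Xk) auto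
      show "(\<lambda>n. ennreal (U' powr m) + ennreal ((1 + e) * (M' * sqrt (b n)) powr m) + R n)
        \<longlonglongrightarrow> ennreal (U' powr m) + ennreal ((1 + e) * (M' * sqrt (1 - a)) powr m) + 0"
        using m M' b0 by (intro tendsto_add tendsto_const R(1) tendsto_ennrealI tendsto_mult tendsto_powr' tendsto_real_sqrt b) auto
      show "\<exists>N. \<forall>n\<ge>N. enn_powr (evol_norm (k n)) m \<le> ennreal (U' powr m) + ennreal ((1 + e) * (M' * sqrt (b n)) powr m) + R n"
        using le by blast
    qed
    also have "\<dots> = ennreal (U' powr m + (1 + e) * (M' * sqrt (1 - a)) powr m)"
      using e by (simp add: ennreal_plus)
    finally have "ennreal (M' powr m) \<le> ennreal (U' powr m + (1 + e) * (M' * sqrt (1 - a)) powr m)"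
      unfolding M'(1) enn_powr_ennreal[OF M'(2)] .
    moreover have "0 \<le> U' powr m + (1 + e) * (M' * sqrt (1 - a)) powr m" using e by simp
    ultimately show ?thesis using ennreal_le_iff by blast
  qed
  have ineq0: "M' powr m \<le> U' powr m + (M' * sqrt (1 - a)) powr m"
  proof (rule tendsto_lowerbound)
    show "(\<lambda>n. U' powr m + (1 + 1 / real (Suc n)) * (M' * sqrt (1 - a)) powr m) \<longlonglongrightarrow> U' powr m + (M' * sqrt (1 - a)) powr m"
    proof -
      have "(\<lambda>n. U' powr m + (1 + 1 / real (Suc n)) * (M' * sqrt (1 - a)) powr m) \<longlonglongrightarrow> U' powr m + (1 + 0) * (M' * sqrt (1 - a)) powr m"
        by (intro tendsto_add tendsto_mult tendsto_const LIMSEQ_Suc[OF lim_1_over_n])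
      then show ?thesis by simp
    qed
    show "\<forall>\<^sub>F n in sequentially. M' powr m \<le> U' powr m + (1 + 1 / real (Suc n)) * (M' * sqrt (1 - a)) powr m"
      by (intro always_eventually allI ineq) simp
  qed simp
  have a: "0 < a" "a \<le> 1" using f0 f1 by (auto simp: a_def)
  \<comment> \<open>If a were below 1, dividing by M'^m would give 1 <= a^(m/2) + (1 - a)^(m/2) with
    m/2 > 1.\<close>
  have a1: "a = 1"
  proof (rule ccontr)
    assume "a \<noteq> 1"
    then have a': "a < 1" using a by simp
    have "U' powr m \<le> (M' * sqrt a) powr m" using U'_le U' m by (intro powr_mono2) auto
    then have "M' powr m \<le> (M' * sqrt a) powr m + (M' * sqrt (1 - a)) powr m" using ineq0 by linarith
    also have "\<dots> = M' powr m * (a powr (m / 2) + (1 - a) powr (m / 2))"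
      using M'0 a a' by (simp add: powr_mult powr_half_sqrt[symmetric] powr_powr distrib_left)
    also have "\<dots> < M' powr m * 1"
      using powr_sum_less_one[OF a(1) a', of "m / 2"] m M'0 by (intro mult_strict_left_mono) auto
    finally show False by simp
  qed
  have "M' powr m \<le> U' powr m" using ineq0 m by (simp add: a1)
  then have "M' \<le> U'" using U' m M' by (meson leI not_le order.strict_trans powr_less_mono2 order_less_le_trans zero_less_numeral)
  then have Mu: "best_const \<le> mixed_norm p q u" by (simp add: M' U' ennreal_leI)
  obtain L where L: "(\<lambda>n. evol_norm (trunc (real (Suc n)) f)) \<longlonglongrightarrow> L" "L \<le> best_const * ennreal (sqrt (n2 lborel f))"
    using evol_norm_trunc_tendsto[OF f] by blast
  \<comment> \<open>Fatou's lemma along the truncations closes the chain best_const <= norm of u <=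
    L <= best_const.\<close>
  have "mixed_norm p q u \<le> L"
  proof (rule mixed_norm_Fatou[OF p_pos q_pos u mS[OF T(1)] aeT[folded T_def]])
    show "mixed_norm p q (evol (T n)) \<le> evol_norm (T n)" for n by (simp add: evol_norm_def)
    show "(\<lambda>n. evol_norm (T n)) \<longlonglongrightarrow> L" using LIMSEQ_subseq_LIMSEQ[OF L(1) rs(2)] by (simp add: T_def o_def)
  qed
  moreover have "L \<le> best_const" using L(2) a1 by (simp add: a_def)
  ultimately have "L = best_const" using Mu by simp
  with f a1 L(1) show ?thesis by (intro that) (auto simp: a_def)
qed

end

section \<open>Transfer to homogeneous Sobolev data\<close>

theorem theorem1p4:
  fixes k p q :: real
  assumes "k > 4" and "2/p + 1/q = 2/k" and "k + 2 < p"
  defines "s \<equiv> (k - 4) / (2 * k)"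
  defines "M \<equiv> Sup {strich_norm p q phi | phi. in_Hs s phi \<and> hs_norm s phi = 1}"
  shows "M < \<infinity> \<and> (\<exists>psi. in_Hs s psi \<and> hs_norm s psi = 1 \<and>
            strich_norm p q psi = M * ennreal (hs_norm s psi))"
proof -
  have p: "0 < p" using assms(1,3) by simp
  have "2 / p < 2 / k" using assms(1,3) by (simp add: frac_less2)
  then have "0 < 1 / q" using assms(2) by linarith
  then have q: "0 < q" by (simp add: zero_less_divide_iff)
  have "2 / k < 1 / 2" using assms(1) by (simp add: field_simps)
  then interpret airy_exponents p q using p q assms(2) by unfold_locales auto
  \<comment> \<open>The multiplier hidden in \<open>wt\<close> and the Sobolev weight together give
    the derivative of order 1/p.\<close>
  have s: "\<beta> - 1 / 2 + s = 1 / p"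
  proof -
    have "s = 1 / 2 - 2 / k" using assms(1) by (simp add: s_def field_simps)
    moreover have "3 / p = 2 / p + 1 / p" by (simp add: add_divide_distrib[symmetric])
    ultimately show ?thesis using assms(2) unfolding \<beta>_def by linarith
  qed
  \<comment> \<open>An isometry from the Sobolev norm to L^2; the factor 1 / sqrt (2 pi) is the
    Plancherel constant in \<open>hs_norm\<close>.\<close>
  define nrm where "nrm phi \<xi> = complex_of_real (\<bar>\<xi>\<bar> powr s / sqrt (2 * pi)) * phi \<xi>" for phi \<xi>
  have sq: "(cmod (nrm phi \<xi>))\<^sup>2 = 1 / (2 * pi) * (\<bar>\<xi>\<bar> powr (2 * s) * (cmod (phi \<xi>))\<^sup>2)" for phi \<xi>
  proof -
    have "(\<bar>\<xi>\<bar> powr s)\<^sup>2 = \<bar>\<xi>\<bar> powr (2 * s)" by (simp add: power2_eq_square powr_add[symmetric])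
    then show ?thesis by (simp add: nrm_def norm_mult norm_divide power_mult_distrib power_divide)
  qed
  have nrm_sqint: "sqint lborel (nrm phi)" if "in_Hs s phi" for phi
  proof -
    have "phi \<in> borel_measurable borel" "integrable lborel (\<lambda>xi. \<bar>xi\<bar> powr (2 * s) * (cmod (phi xi))\<^sup>2)"
      using that by (auto simp: in_Hs_def)
    then show ?thesis unfolding sqint_def sq by (auto simp: nrm_def[abs_def])
  qed
  have nrm_n2: "hs_norm s phi = sqrt (n2 lborel (nrm phi))" for phi
    unfolding n2_def sq hs_norm_def by simp
  have airy: "airy_trunc p phi R = evol (trunc R (nrm phi))" if "0 < R" for phi R
  proof (intro ext)
    fix x t
    have "airy_trunc p phi R x t = (LINT xi|lborel. complex_of_real (1 / (2 * pi)) * (indicator {xi. 1 / R \<le> \<bar>xi\<bar> \<and> \<bar>xi\<bar> \<le> R} xi *\<^sub>R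
        (osc x t xi * complex_of_real (\<bar>xi\<bar> powr (1 / p)) * phi xi)))"
      unfolding airy_trunc_def by (rule integral_mult_right_zero[symmetric])
    also have "\<dots> = evol (trunc R (nrm phi)) x t"
      unfolding evol_def ev_def
    proof (intro Bochner_Integration.integral_cong refl)
      fix xi
      have "wt xi * (\<bar>xi\<bar> powr s / sqrt (2 * pi)) = 1 / (2 * pi) * \<bar>xi\<bar> powr (1 / p)"
        unfolding s[symmetric] by (simp add: wt_def powr_add)
      then have c: "complex_of_real (wt xi) * complex_of_real (\<bar>xi\<bar> powr s / sqrt (2 * pi)) = complex_of_real (1 / (2 * pi)) * complex_of_real (\<bar>xi\<bar> powr (1 / p))"
        by (simp only: of_real_mult[symmetric])
      define E where "E = osc x t xi"
      have "E * lift (trunc R (nrm phi)) xi = (complex_of_real (wt xi) * complex_of_real (\<bar>xi\<bar> powr s / sqrt (2 * pi))) * (complex_of_real (indicator {xi. 1 / R \<le> \<bar>xi\<bar> \<and> \<bar>xi\<bar> \<le> R} xi) * (E * phi xi))"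
        unfolding lift_def trunc_def nrm_def by (simp only: mult_ac)
      also have "\<dots> = complex_of_real (1 / (2 * pi)) * (indicator {xi. 1 / R \<le> \<bar>xi\<bar> \<and> \<bar>xi\<bar> \<le> R} xi *\<^sub>R (E * complex_of_real (\<bar>xi\<bar> powr (1 / p)) * phi xi))"
        unfolding c scaleR_conv_of_real by (simp only: mult_ac)
      finally show "complex_of_real (1 / (2 * pi)) * (indicator {xi. 1 / R \<le> \<bar>xi\<bar> \<and> \<bar>xi\<bar> \<le> R} xi *\<^sub>R
        (osc x t xi * complex_of_real (\<bar>xi\<bar> powr (1 / p)) * phi xi))
        = osc x t xi * lift (trunc R (nrm phi)) xi"
        unfolding E_def[symmetric] by (rule sym)
    qed
    finally show "airy_trunc p phi R x t = evol (trunc R (nrm phi)) x t" .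
  qed
  have strich: "strich_norm p q phi = lim (\<lambda>n. evol_norm (trunc (real (Suc n)) (nrm phi)))" for phi
    unfolding strich_norm_def evol_norm_def using airy by simp
  let ?M = "airy_exponents.best_const p q"
  \<comment> \<open>Existence of the limit comes first; only then does \<open>limI\<close> evaluate
    the \<open>lim\<close> in \<open>strich_norm\<close>.\<close>
  have upper: "strich_norm p q phi \<le> ?M" if phi: "in_Hs s phi" "hs_norm s phi = 1" for phi
  proof -
    obtain L where L: "(\<lambda>n. evol_norm (trunc (real (Suc n)) (nrm phi))) \<longlonglongrightarrow> L" "L \<le> ?M * ennreal (sqrt (n2 lborel (nrm phi)))"
      using evol_norm_trunc_tendsto[OF nrm_sqint[OF phi(1)]] by blast
    then show ?thesis using phi(2) unfolding strich limI[OF L(1)] nrm_n2 by simp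
  qed
  obtain f where f: "sqint lborel f" "n2 lborel f = 1" "(\<lambda>n. evol_norm (trunc (real (Suc n)) f)) \<longlonglongrightarrow> ?M"
    by (rule extremiser_exists)
  have [measurable]: "f \<in> borel_measurable borel" using f(1) by (simp add: sqint_def)
  define psi where "psi \<xi> = complex_of_real (sqrt (2 * pi) * \<bar>\<xi>\<bar> powr (- s)) * f \<xi>" for \<xi>
  \<comment> \<open>A power of 0 is 0, so the inverse of the isometry fails at the single frequency
    0. That point is null, and every truncation discards it.\<close>
  have psi: "nrm psi \<xi> = (if \<xi> = 0 then 0 else f \<xi>)" for \<xi>
  proof (cases "\<xi> = 0")
    case False
    then have "(\<bar>\<xi>\<bar> powr s / sqrt (2 * pi)) * (sqrt (2 * pi) * \<bar>\<xi>\<bar> powr (- s)) = 1"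
      by (simp add: powr_minus)
    then have "complex_of_real (\<bar>\<xi>\<bar> powr s / sqrt (2 * pi)) * complex_of_real (sqrt (2 * pi) * \<bar>\<xi>\<bar> powr (- s)) = 1"
      by (metis of_real_1 of_real_mult)
    then show ?thesis using False unfolding nrm_def psi_def mult.assoc[symmetric] by simp
  qed (simp add: nrm_def)
  have psiAE: "AE \<xi> in lborel. (cmod (nrm psi \<xi>))\<^sup>2 = (cmod (f \<xi>))\<^sup>2"
    using AE_lborel_singleton[of 0] by eventually_elim (simp add: psi)
  have psi_meas [measurable]: "psi \<in> borel_measurable borel" "nrm psi \<in> borel_measurable borel"
    unfolding psi_def[abs_def] nrm_def[abs_def] by measurable
  have n2psi: "n2 lborel (nrm psi) = 1"
    unfolding f(2)[symmetric] n2_def by (intro integral_cong_AE psiAE) auto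
  have "integrable lborel (\<lambda>\<xi>. (cmod (nrm psi \<xi>))\<^sup>2)"
    using f(1) by (subst integrable_cong_AE[OF _ _ psiAE]) (auto simp: sqint_def)
  then have "integrable lborel (\<lambda>\<xi>. 2 * pi * (cmod (nrm psi \<xi>))\<^sup>2)" by (rule integrable_mult_right)
  then have inHs: "in_Hs s psi" unfolding sq in_Hs_def by simp
  have hs: "hs_norm s psi = 1" by (simp add: nrm_n2 n2psi)
  have "trunc (real (Suc n)) (nrm psi) = trunc (real (Suc n)) f" for n
    by (auto simp: trunc_def psi fun_eq_iff)
  then have sp: "strich_norm p q psi = ?M" unfolding strich using limI[OF f(3)] by simp
  have "M = ?M"
  proof (rule antisym)
    show "M \<le> ?M" unfolding M_def using upper by (auto intro!: Sup_least)
    show "?M \<le> M" unfolding M_def sp[symmetric] using inHs hs by (intro Sup_upper) auto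
  qed
  then show ?thesis using best_const_finite inHs hs sp by auto
qed

end
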